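(* Let $r\ge 3$ be an integer and set $q=r-1$. Let $w>0$ be a real number, and for each $n\in\mathbb N$ let $\mathsf G_n$ be a random graph with distribution $\mathbb P_{n,r}$ (with weight $w$). Then the following hold. (i) The reduced free energy satisfies $$\lim_{n\to\infty}F_{n,r}(w)=\frac{\ln 2}{2}\left(1-\frac1q\right).$$ (ii) For every $\varepsilon>0$ there are constants $c=c(\varepsilon,r)>0$ (not depending on $w$) and $N=N(\varepsilon,r,w)$ such that, for every $n\ge N$, $$\mathbb P\left(\delta_\square(W_{\mathsf G_n},B_q^\star)\ge\varepsilon\right)\le e^{-cn^2}.$$ (iii) For every $\varepsilon>0$ there are constants $c=c(\varepsilon,r)>0$ (not depending on $w$) and $n_0=n_0(\varepsilon,r,w)$ such that, for every $n\ge n_0$, with probability at least $1-e^{-cn^2}$, the graph $\mathsf G_n$ has a partition $[n]=V_1\sqcup\cdots\sqcup V_q$ with the following properties: (a) $\bigl||V_i|-n/q\bigr|\le\varepsilon n$ for every $i\in[q]$; (b) $\left|\dfrac{e_{\mathsf G_n}(V_i,V_j)}{|V_i||V_j|}-\dfrac12\right|\le\varepsilon$ for all distinct $i,j\in[q]$; (c) $\displaystyle\sum_{i=1}^q e_{\mathsf G_n}(V_i)\le\frac{\varepsilon n^2}{10q}$; (d) $\displaystyle\frac{\sum_{i=1}^q e_{\mathsf G_n}(V_i)}{\sum_{i=1}^q\binom{|V_i|}{2}}\le\varepsilon$. In particular, if $\mathsf G_n'$ is obtained from $\mathsf G_n$ by deleting all edges whose endpoints lie in the same part, then $\mathsf G_n'$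 is $q$-partite and $$d_{\mathrm{edit}}(\mathsf G_n,\mathsf G_n')\le\frac{\varepsilon}{10q}\le\frac{\varepsilon}{2}.$$
   Context: $[n]=\{1,\dots,n\}$, and $\mathbf G_n$ is the set of all simple graphs with vertex set $[n]$. $K_r(G)$ denotes the number of (unordered) copies of the complete graph $K_r$ in $G$, i.e. the number of subgraphs of $G$ isomorphic to $K_r$. The model. For $G\in\mathbf G_n$ let $N_r(G)=n^r-r!\,K_r(G)$ (the number of ordered $r$-tuples in $[n]^r$, repetitions allowed, that do not consist of $r$ distinct vertices forming an $r$-clique). The probability measure $\mathbb P_{n,r}$ on $\mathbf G_n$ is $$\mathbb P_{n,r}(G)=\frac{\exp(w\,N_r(G))}{\sum_{J\in\mathbf G_n}\exp(w\,N_r(J))}.$$ The reduced partition function is $\widetilde Z_{n,r}=\sum_{J\in\mathbf G_n}\exp(-r!\,w\,K_r(J))$ and the reduced free energy is $F_{n,r}(w)=\frac1{n^2}\ln\widetilde Z_{n,r}$. (Hence $\mathbb P_{n,r}(G)=\exp(-r!\,w\,K_r(G))/\widetilde Z_{n,r}$.) Graphs. For $A\subseteq[n]$, $e_G(A)$ is the number of edges of $G$ with both endpoints in $A$; for disjoint $A,B\subseteq[n]$, $e_G(A,B)$ is the number of edges with one endpoint in $A$ and the other in $B$. For $G,H\in\mathbf G_n$, $d_{\mathrm{edit}}(G,H)=\frac1{n^2}|E(G)\triangle E(H)|$. Graphons. $\lambda$ is Lebesgue measure on $[0,1]$. A graphon is a measurable $W:[0,1]^2\to[0,1]$ with $W(x,y)=W(y,x)$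 for almost every $(x,y)$. The empirical graphon $W_G$ of $G\in\mathbf G_n$ is defined as follows: let $I_i=[\frac{i-1}n,\frac in)$ for $i<n$ and $I_n=[\frac{n-1}n,1]$; for $x\in I_i$, $y\in I_j$ put $W_G(x,y)=1$ if $\{i,j\}\in E(G)$ and $W_G(x,y)=0$ otherwise. The cut norm of an integrable $U:[0,1]^2\to\mathbb R$ is $\|U\|_\square=\sup_{S,T}\left|\int_{S\times T}U\,dx\,dy\right|$ over measurable $S,T\subseteq[0,1]$. The cut distance of graphons is $\delta_\square(W_1,W_2)=\inf_\phi\|W_1-W_2^\phi\|_\square$, where $W^\phi(x,y)=W(\phi(x),\phi(y))$ and $\phi$ ranges over bijections of $[0,1]$ such that $\phi,\phi^{-1}$ are Lebesgue-measurable and $\phi$ preserves $\lambda$. For a nonempty family $\mathcal F$ of graphons, $\delta_\square(W,\mathcal F)=\inf_{V\in\mathcal F}\delta_\square(W,V)$. For $q\ge2$, $B_q^\star$ is the family of all graphons $W$ for which there is a measurable partition $[0,1]=A_1\sqcup\cdots\sqcup A_q$ with $\lambda(A_i)=1/q$ for every $i$, such that $W=0$ almost everywhere on each $A_i\times A_i$ and $W=\frac12$ almost everywhere on $A_i\times A_j$ for all distinct $i,j\in[q]$. *)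

theory Defs
  imports "HOL-Probability.Probability"
begin

section \<open>Graphs on \<open>{1..n}\<close>\<close>

text \<open>A simple graph with vertex set \<open>{1..n}\<close> is identified with its edge set, a set of
  two-element subsets of \<open>{1..n}\<close>.\<close>

type_synonym ugraph = "nat set set"

definition graphs_on :: "nat \<Rightarrow> ugraph set" where
  "graphs_on n = Pow {e. e \<subseteq> {1..n} \<and> card e = 2}"

text \<open>Copies of \<open>K\<^sub>r\<close> are counted by their vertex sets, which determine them.\<close>

definition clique_count :: "nat \<Rightarrow> nat \<Rightarrow> ugraph \<Rightarrow> nat" where
  "clique_count n r G =
    card {S. S \<subseteq> {1..n} \<and> card S = r \<and> (\<forall>u\<in>S. \<forall>v\<in>S. u \<noteq> v \<longrightarrow> {u, v} \<in> G)}"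

definition edges_within :: "ugraph \<Rightarrow> nat set \<Rightarrow> nat" where
  "edges_within G A = card {e \<in> G. e \<subseteq> A}"

definition edges_between :: "ugraph \<Rightarrow> nat set \<Rightarrow> nat set \<Rightarrow> nat" where
  "edges_between G A B = card {e \<in> G. \<exists>a\<in>A. \<exists>b\<in>B. e = {a, b}}"

definition edit_dist :: "nat \<Rightarrow> ugraph \<Rightarrow> ugraph \<Rightarrow> real" where
  "edit_dist n G H = real (card ((G - H) \<union> (H - G))) / (real n)\<^sup>2"

text \<open>Parts of a vertex partition may be empty here; nonemptiness is required separately
  where it is wanted.\<close>

definition vertex_partition :: "nat \<Rightarrow> nat \<Rightarrow> (nat \<Rightarrow> nat set) \<Rightarrow> bool" where
  "vertex_partition n q V \<longleftrightarrow>
    (\<Union>i\<in>{1..q}. V i) = {1..n} \<and> disjoint_family_on V {1..q}"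

definition q_partite :: "nat \<Rightarrow> nat \<Rightarrow> ugraph \<Rightarrow> bool" where
  "q_partite n q G \<longleftrightarrow>
    (\<exists>V. vertex_partition n q V \<and> (\<forall>e\<in>G. \<forall>i\<in>{1..q}. \<not> e \<subseteq> V i))"

definition delete_inner_edges :: "nat \<Rightarrow> (nat \<Rightarrow> nat set) \<Rightarrow> ugraph \<Rightarrow> ugraph" where
  "delete_inner_edges q V G = {e \<in> G. \<not> (\<exists>i\<in>{1..q}. e \<subseteq> V i)}"


section \<open>The model\<close>

definition nonclique_count :: "nat \<Rightarrow> nat \<Rightarrow> ugraph \<Rightarrow> real" where
  "nonclique_count n r G = real n ^ r - fact r * real (clique_count n r G)"

definition gibbs_measure :: "nat \<Rightarrow> nat \<Rightarrow> real \<Rightarrow> ugraph measure" where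
  "gibbs_measure n r w = point_measure (graphs_on n)
    (\<lambda>G. ennreal (exp (w * nonclique_count n r G) /
                  (\<Sum>J\<in>graphs_on n. exp (w * nonclique_count n r J))))"

definition reduced_partition_function :: "nat \<Rightarrow> nat \<Rightarrow> real \<Rightarrow> real" where
  "reduced_partition_function n r w =
    (\<Sum>J\<in>graphs_on n. exp (- (fact r * w * real (clique_count n r J))))"

definition reduced_free_energy :: "nat \<Rightarrow> nat \<Rightarrow> real \<Rightarrow> real" where
  "reduced_free_energy n r w = ln (reduced_partition_function n r w) / (real n)\<^sup>2"

lemma finite_graphs_on: "finite (graphs_on n)"
  unfolding graphs_on_def by (rule finite_Pow_iff[THEN iffD2])
    (rule finite_subset[of _ "Pow {1..n}"], auto)

lemma prob_space_gibbs_measure: "prob_space (gibbs_measure n r w)"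
proof
  let ?f = "\<lambda>G. exp (w * nonclique_count n r G)"
  let ?Z = "\<Sum>J\<in>graphs_on n. ?f J"
  have "{} \<in> graphs_on n" by (simp add: graphs_on_def)
  then have Z: "?Z > 0"
    by (intro sum_pos) (auto simp: finite_graphs_on)
  have "emeasure (gibbs_measure n r w) (space (gibbs_measure n r w))
      = (\<Sum>G\<in>graphs_on n. ennreal (?f G / ?Z))"
    unfolding gibbs_measure_def
    by (simp add: space_point_measure emeasure_point_measure_finite finite_graphs_on)
  also have "\<dots> = ennreal (\<Sum>G\<in>graphs_on n. ?f G / ?Z)"
    using Z by (intro sum_ennreal) (simp add: less_imp_le)
  also have "(\<Sum>G\<in>graphs_on n. ?f G / ?Z) = 1"
    using Z by (simp flip: sum_divide_distrib)
  finally show "emeasure (gibbs_measure n r w) (space (gibbs_measure n r w)) = 1" by simp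
qed


section \<open>Graphons\<close>

text \<open>Functions on the unit square are represented by functions on \<open>\<real> \<times> \<real>\<close> whose values
  outside the square are irrelevant. Measurability is in the sense of Lebesgue.\<close>

definition graphon :: "(real \<times> real \<Rightarrow> real) \<Rightarrow> bool" where
  "graphon W \<longleftrightarrow>
    W \<in> borel_measurable (lebesgue_on ({0..1} \<times> {0..1})) \<and>
    (\<forall>p \<in> {0..1} \<times> {0..1}. W p \<in> {0..1}) \<and>
    (AE (x, y) in lebesgue_on ({0..1} \<times> {0..1}). W (x, y) = W (y, x))"

definition vertex_interval :: "nat \<Rightarrow> nat \<Rightarrow> real set" where
  "vertex_interval n i =
    (if i < n then {(real i - 1) / real n ..< real i / real n}
     else {(real n - 1) / real n .. 1})"

definition empirical_graphon :: "nat \<Rightarrow> ugraph \<Rightarrow> real \<times> real \<Rightarrow> real" where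
  "empirical_graphon n G = (\<lambda>(x, y).
    if \<exists>i\<in>{1..n}. \<exists>j\<in>{1..n}.
      x \<in> vertex_interval n i \<and> y \<in> vertex_interval n j \<and> {i, j} \<in> G
    then 1 else 0)"

text \<open>The suprema and infima below are taken in \<open>real\<close>. The supremum is over a set bounded
  above when \<open>U\<close> is integrable on the unit square, and the infima are over sets bounded below
  by \<open>0\<close>.\<close>

definition cut_norm :: "(real \<times> real \<Rightarrow> real) \<Rightarrow> real" where
  "cut_norm U = (SUP (S, T) \<in> {(S, T). S \<in> sets lebesgue \<and> S \<subseteq> {0..1} \<and>
                                      T \<in> sets lebesgue \<and> T \<subseteq> {0..1}}.
    \<bar>LINT p:S \<times> T|lebesgue. U p\<bar>)"

definition measure_preserving_bijections :: "(real \<Rightarrow> real) set" where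
  "measure_preserving_bijections = {\<phi>.
    bij_betw \<phi> {0..1} {0..1} \<and>
    \<phi> \<in> lebesgue_on {0..1} \<rightarrow>\<^sub>M lebesgue_on {0..1} \<and>
    the_inv_into {0..1} \<phi> \<in> lebesgue_on {0..1} \<rightarrow>\<^sub>M lebesgue_on {0..1} \<and>
    distr (lebesgue_on {0..1}) (lebesgue_on {0..1}) \<phi> = lebesgue_on {0..1}}"

definition cut_dist :: "(real \<times> real \<Rightarrow> real) \<Rightarrow> (real \<times> real \<Rightarrow> real) \<Rightarrow> real" where
  "cut_dist W1 W2 = (INF \<phi> \<in> measure_preserving_bijections.
    cut_norm (\<lambda>(x, y). W1 (x, y) - W2 (\<phi> x, \<phi> y)))"

definition cut_dist_family ::
    "(real \<times> real \<Rightarrow> real) \<Rightarrow> (real \<times> real \<Rightarrow> real) set \<Rightarrow> real" where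
  "cut_dist_family W \<F> = (INF V \<in> \<F>. cut_dist W V)"

definition B_star :: "nat \<Rightarrow> (real \<times> real \<Rightarrow> real) set" where
  "B_star q = {W. graphon W \<and> (\<exists>A :: nat \<Rightarrow> real set.
    (\<Union>i\<in>{1..q}. A i) = {0..1} \<and> disjoint_family_on A {1..q} \<and>
    (\<forall>i\<in>{1..q}. A i \<in> sets lebesgue \<and> measure lebesgue (A i) = 1 / real q) \<and>
    (\<forall>i\<in>{1..q}. AE p in lebesgue. p \<in> A i \<times> A i \<longrightarrow> W p = 0) \<and>
    (\<forall>i\<in>{1..q}. \<forall>j\<in>{1..q}. i \<noteq> j \<longrightarrow>
      (AE p in lebesgue. p \<in> A i \<times> A j \<longrightarrow> W p = 1 / 2)))}"

end

theory Submission
  imports Defs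
begin

text \<open>
  Graphs with at least \<open>\<gamma> n\<^sup>r\<close> copies of \<open>K\<^sub>r\<close> have total weight at most
  \<open>2\<^bsup>n\<^sup>2\<^esup> exp (- w \<gamma> n\<^sup>r)\<close>, which is negligible as \<open>r \<ge> 3\<close>, so everything reduces to
  counting the graphs with few copies of \<open>K\<^sub>r\<close>. Such a graph is, up to \<open>\<delta> n\<^sup>2\<close> edges, contained in
  one of \<open>exp (O n)\<close> containers, each with few copies of \<open>K\<^sub>r\<close>: the container consists of the
  pairs on which an approximation of the graph in cut norm is not too small. By a robust form of
  Fueredi's stability argument a container has at most \<open>(1 - 1/q) n\<^sup>2/2\<close> edges, up to a small
  error, and is close to a balanced complete \<open>q\<close>-partite graph if it has almost that many.
  Chernoff's bound shows that almost all subgraphs of the latter have density \<open>1/2\<close> on all large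
  rectangles across the parts; the \<open>q\<close>-partite graphs provide the matching lower bound for the
  partition function. Finally, a kernel in the limit family is obtained from the vertex partition by
  moving a set of small measure so that all parts get measure \<open>1/q\<close>.
\<close>

section \<open>Cut norm of finite kernels\<close>

text \<open>The rate \<open>c\<close> must not depend on \<open>w\<close>. All counting is therefore
  free of \<open>w\<close>: the threshold \<open>\<gamma>\<close> and the rate come from
  \<open>\<epsilon>\<close> and \<open>r\<close> alone, and \<open>w\<close> only decides how large
  \<open>n\<close> must be before \<open>w * \<gamma> * n ^ r\<close> dominates
  \<open>n ^ 2\<close>. A weak (Frieze-Kannan) approximation is enough to build containers: it
  controls the number of cliques, and it is reached from the zero kernel in boundedly many updates
  with about \<open>4 ^ n\<close> choices each. A gain of \<open>exp (- c * n ^ 2)\<close> survives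
  a union bound over that many outcomes. The stability inequality adds the inner edges of a
  container to its edge count. A container with many inner edges or an unbalanced colouring hence
  has an entropy deficit of order \<open>n ^ 2\<close>, which pays for the edges that escape the
  container. In any other container one colouring serves all its graphs at once, and only
  discrepancy remains to be excluded, by a union bound over pairs of vertex sets. The single notion
  \<open>structured\<close> then yields both (ii) and (iii).\<close>

text \<open>A linear function on the cube is largest at a vertex: weight 1 goes to the terms with
  \<open>f a \<ge> 0\<close>, weight 0 to the others.\<close>

lemma sum_weighted_le_subset_sum:
  fixes c f :: "'a \<Rightarrow> real"
  assumes "finite A" "\<And>a. a \<in> A \<Longrightarrow> 0 \<le> c a \<and> c a \<le> 1"
  shows "\<exists>S\<subseteq>A. (\<Sum>a\<in>A. c a * f a) \<le> (\<Sum>a\<in>S. f a)"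
proof (intro exI[of _ "{a\<in>A. f a \<ge> 0}"] conjI)
  have "(\<Sum>a\<in>A. c a * f a) \<le> (\<Sum>a\<in>A. if f a \<ge> 0 then f a else 0)"
    using assms by (intro sum_mono) (auto simp: mult_left_le_one_le mult_nonneg_nonpos)
  also have "\<dots> = (\<Sum>a\<in>{a\<in>A. f a \<ge> 0}. f a)"
    using assms by (simp add: sum.If_cases Int_def)
  finally show "(\<Sum>a\<in>A. c a * f a) \<le> (\<Sum>a\<in>{a\<in>A. f a \<ge> 0}. f a)" .
qed auto

text \<open>Finite form of the cut norm, left unnormalised: \<open>M\<close> will be a small
  multiple of \<open>card V ^ 2\<close>. The sets \<open>S\<close> and \<open>T\<close> may
  overlap.\<close>

definition cut_bounded :: "'a set \<Rightarrow> real \<Rightarrow> ('a \<Rightarrow> 'a \<Rightarrow> real) \<Rightarrow> bool" where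
  "cut_bounded V M k \<longleftrightarrow> (\<forall>S T. S \<subseteq> V \<longrightarrow> T \<subseteq> V \<longrightarrow> \<bar>\<Sum>u\<in>S. \<Sum>v\<in>T. k u v\<bar> \<le> M)"

lemma cut_bounded_uminus: "cut_bounded V M (\<lambda>u v. - k u v) = cut_bounded V M k"
  unfolding cut_bounded_def by (simp add: sum_negf)

text \<open>The form is bilinear in \<open>a\<close> and \<open>b\<close>, so the weights can be
  rounded to indicators one argument at a time. Fractional weights arise twice: as products of the
  remaining factors in the counting lemma, and as relative measures of pieces of vertex intervals in
  the passage to graphons.\<close>

lemma cut_bounded_weighted_le:
  fixes a b :: "'a \<Rightarrow> real"
  assumes V: "finite V" and k: "cut_bounded V M k"
    and a: "\<And>v. v \<in> V \<Longrightarrow> 0 \<le> a v \<and> a v \<le> 1" and b: "\<And>v. v \<in> V \<Longrightarrow> 0 \<le> b v \<and> b v \<le> 1"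
  shows "(\<Sum>u\<in>V. \<Sum>v\<in>V. a u * b v * k u v) \<le> M"
proof -
  obtain S where S: "S \<subseteq> V"
    "(\<Sum>u\<in>V. a u * (\<Sum>v\<in>V. b v * k u v)) \<le> (\<Sum>u\<in>S. \<Sum>v\<in>V. b v * k u v)"
    using sum_weighted_le_subset_sum[of V a "\<lambda>u. \<Sum>v\<in>V. b v * k u v"] V a by auto
  obtain T where T: "T \<subseteq> V"
    "(\<Sum>v\<in>V. b v * (\<Sum>u\<in>S. k u v)) \<le> (\<Sum>v\<in>T. \<Sum>u\<in>S. k u v)"
    using sum_weighted_le_subset_sum[of V b "\<lambda>v. \<Sum>u\<in>S. k u v"] V b by auto
  have "(\<Sum>u\<in>V. \<Sum>v\<in>V. a u * b v * k u v) = (\<Sum>u\<in>V. a u * (\<Sum>v\<in>V. b v * k u v))"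
    by (simp add: sum_distrib_left mult.assoc)
  also note S(2)
  also have "(\<Sum>u\<in>S. \<Sum>v\<in>V. b v * k u v) = (\<Sum>v\<in>V. b v * (\<Sum>u\<in>S. k u v))"
    by (subst sum.swap) (simp add: sum_distrib_left)
  also note T(2)
  also have "(\<Sum>v\<in>T. \<Sum>u\<in>S. k u v) = (\<Sum>u\<in>S. \<Sum>v\<in>T. k u v)" by (rule sum.swap)
  also have "\<dots> \<le> M" using k S(1) T(1) unfolding cut_bounded_def by (meson abs_le_D1)
  finally show ?thesis .
qed

lemma cut_bounded_weighted:
  fixes a b :: "'a \<Rightarrow> real"
  assumes V: "finite V" and k: "cut_bounded V M k"
    and a: "\<And>v. v \<in> V \<Longrightarrow> 0 \<le> a v \<and> a v \<le> 1" and b: "\<And>v. v \<in> V \<Longrightarrow> 0 \<le> b v \<and> b v \<le> 1"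
  shows "\<bar>\<Sum>u\<in>V. \<Sum>v\<in>V. a u * b v * k u v\<bar> \<le> M"
proof -
  have "(\<Sum>u\<in>V. \<Sum>v\<in>V. a u * b v * - k u v) \<le> M"
    using assms by (intro cut_bounded_weighted_le) (auto simp: cut_bounded_uminus)
  moreover have "(\<Sum>u\<in>V. \<Sum>v\<in>V. a u * b v * k u v) \<le> M"
    using assms by (intro cut_bounded_weighted_le) auto
  ultimately show ?thesis by (simp add: sum_negf)
qed


section \<open>The counting lemma\<close>

definition pairs_below :: "nat \<Rightarrow> (nat \<times> nat) set" where
  "pairs_below r = {(i, j). i < j \<and> j < r}"

lemma finite_pairs_below [simp]: "finite (pairs_below r)"
  by (rule finite_subset[of _ "{..<r} \<times> {..<r}"]) (auto simp: pairs_below_def)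

text \<open>Unnormalised homomorphism count of a complete graph on \<open>r\<close> vertices into
  the weighted graph \<open>f\<close>. Entries of \<open>x\<close> may coincide, so diagonal values
  of \<open>f\<close> take part. Each edge enters once, as an increasing pair of indices.\<close>

definition hom_sum :: "nat \<Rightarrow> 'a set \<Rightarrow> ('a \<Rightarrow> 'a \<Rightarrow> real) \<Rightarrow> real" where
  "hom_sum r V f = (\<Sum>x\<in>{..<r} \<rightarrow>\<^sub>E V. \<Prod>e\<in>pairs_below r. f (x (fst e)) (x (snd e)))"

lemma sum_PiE_insert:
  fixes H :: "('i \<Rightarrow> 'a) \<Rightarrow> real"
  assumes "a \<notin> I"
  shows "(\<Sum>x\<in>insert a I \<rightarrow>\<^sub>E V. H x) = (\<Sum>z\<in>I \<rightarrow>\<^sub>E V. \<Sum>u\<in>V. H (z(a := u)))"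
proof -
  have "(\<Sum>x\<in>insert a I \<rightarrow>\<^sub>E V. H x) = (\<Sum>(u, z)\<in>V \<times> (I \<rightarrow>\<^sub>E V). H (z(a := u)))"
    unfolding PiE_insert_eq
    using inj_combinator[OF assms, of "\<lambda>_. V"] by (subst sum.reindex) (auto simp: case_prod_unfold)
  also have "\<dots> = (\<Sum>u\<in>V. \<Sum>z\<in>I \<rightarrow>\<^sub>E V. H (z(a := u)))"
    by (simp add: sum.cartesian_product)
  finally show ?thesis by (subst (asm) sum.swap)
qed

text \<open>Fix all coordinates except \<open>i\<close> and \<open>j\<close>. No factor of the
  product involves both of them, so it splits as \<open>a u * b v\<close> with weights in the unit
  interval, and the cut bound applies to each choice of the other \<open>r - 2\<close>
  coordinates.\<close>

lemma edge_functional_bound: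
  assumes V: "finite V" and ij: "i < j" "j < r"
    and E: "E \<subseteq> pairs_below r" "(i, j) \<notin> E"
    and F: "\<And>e u v. e \<in> E \<Longrightarrow> u \<in> V \<Longrightarrow> v \<in> V \<Longrightarrow> 0 \<le> F e u v \<and> F e u v \<le> (1::real)"
    and k: "cut_bounded V (\<eta> * real (card V) ^ 2) k"
  shows "\<bar>\<Sum>x\<in>{..<r} \<rightarrow>\<^sub>E V. k (x i) (x j) * (\<Prod>e\<in>E. F e (x (fst e)) (x (snd e)))\<bar>
    \<le> \<eta> * real (card V) ^ r"
proof -
  define I where "I = {..<r} - {i, j}"
  have r: "{..<r} = insert j (insert i I)" using ij by (auto simp: I_def)
  have nI: "i \<notin> I" "j \<notin> insert i I" using ij by (auto simp: I_def)
  have finE: "finite E" using E(1) finite_subset by fastforce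
  have cI: "card I + 2 = r" using r nI by (metis I_def add_2_eq_Suc' card_insert_disjoint
        card_lessThan finite.emptyI finite_Diff finite_insert finite_lessThan)
  have finI: "finite I" by (simp add: I_def)
  define G where "G x = (\<Prod>e\<in>E. F e (x (fst e)) (x (snd e)))" for x
  have one: "\<bar>\<Sum>u\<in>V. \<Sum>v\<in>V. k u v * G (z(i := u, j := v))\<bar> \<le> \<eta> * real (card V) ^ 2"
    if z: "z \<in> I \<rightarrow>\<^sub>E V" for z
  proof -
    \<comment> \<open>The pairs that avoid \<open>j\<close>. Those outside \<open>E1\<close> contain
      \<open>j\<close> and hence avoid \<open>i\<close>, because \<open>(i, j)\<close> itself is not
      in \<open>E\<close>.\<close>
    define E1 where "E1 = {e\<in>E. snd e \<noteq> j \<and> fst e \<noteq> j}"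
    define a where "a u = (\<Prod>e\<in>E1. F e ((z(i := u)) (fst e)) ((z(i := u)) (snd e)))" for u
    define b where "b v = (\<Prod>e\<in>E - E1. F e ((z(j := v)) (fst e)) ((z(j := v)) (snd e)))" for v
    have G: "G (z(i := u, j := v)) = a u * b v" for u v
    proof -
      have "G (z(i := u, j := v)) =
        (\<Prod>e\<in>E1. F e ((z(i := u, j := v)) (fst e)) ((z(i := u, j := v)) (snd e))) *
        (\<Prod>e\<in>E - E1. F e ((z(i := u, j := v)) (fst e)) ((z(i := u, j := v)) (snd e)))"
        unfolding G_def by (subst prod.subset_diff[of E1 E]) (use finE in \<open>auto simp: E1_def\<close>)
      also have "(\<Prod>e\<in>E1. F e ((z(i := u, j := v)) (fst e)) ((z(i := u, j := v)) (snd e))) = a u"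
        unfolding a_def by (rule prod.cong) (auto simp: E1_def)
      also have "(\<Prod>e\<in>E - E1. F e ((z(i := u, j := v)) (fst e)) ((z(i := u, j := v)) (snd e))) = b v"
        unfolding b_def
      proof (rule prod.cong)
        fix e assume e: "e \<in> E - E1"
        then have "fst e < snd e" "e \<noteq> (i, j)" using E by (auto simp: pairs_below_def)
        then have "fst e \<noteq> i" "snd e \<noteq> i" using e ij by (auto simp: E1_def)
        then show "F e ((z(i := u, j := v)) (fst e)) ((z(i := u, j := v)) (snd e)) =
          F e ((z(j := v)) (fst e)) ((z(j := v)) (snd e))" by simp
      qed simp
      finally show ?thesis .
    qed
    have mem: "(z(i := u)) t \<in> V" if "u \<in> V" "t < r" "t \<noteq> j" for u t
      using z that by (auto simp: I_def)
    have mem': "(z(j := u)) t \<in> V" if "u \<in> V" "t < r" "t \<noteq> i" for u t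
      using z that by (auto simp: I_def)
    have a: "0 \<le> a u \<and> a u \<le> 1" if "u \<in> V" for u
    proof -
      have "0 \<le> F e ((z(i := u)) (fst e)) ((z(i := u)) (snd e)) \<and>
        F e ((z(i := u)) (fst e)) ((z(i := u)) (snd e)) \<le> 1" if "e \<in> E1" for e
        using that \<open>u \<in> V\<close> E by (intro F mem) (auto simp: E1_def pairs_below_def)
      then show ?thesis unfolding a_def by (auto intro: prod_nonneg prod_le_1)
    qed
    have b: "0 \<le> b u \<and> b u \<le> 1" if "u \<in> V" for u
    proof -
      have "0 \<le> F e ((z(j := u)) (fst e)) ((z(j := u)) (snd e)) \<and>
        F e ((z(j := u)) (fst e)) ((z(j := u)) (snd e)) \<le> 1" if "e \<in> E - E1" for e
      proof -
        have "fst e < snd e" "e \<noteq> (i, j)" "snd e < r" using E that by (auto simp: pairs_below_def)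
        moreover from this have "fst e \<noteq> i" "snd e \<noteq> i" using that ij by (auto simp: E1_def)
        ultimately show ?thesis using that \<open>u \<in> V\<close> by (intro F mem') auto
      qed
      then show ?thesis unfolding b_def by (auto intro: prod_nonneg prod_le_1)
    qed
    show ?thesis
      using cut_bounded_weighted[OF V k a b] by (simp add: G mult.commute mult.left_commute)
  qed
  have "(\<Sum>x\<in>{..<r} \<rightarrow>\<^sub>E V. k (x i) (x j) * G x) =
    (\<Sum>z\<in>I \<rightarrow>\<^sub>E V. \<Sum>u\<in>V. \<Sum>v\<in>V. k u v * G (z(i := u, j := v)))"
    unfolding r sum_PiE_insert[OF nI(2)] sum_PiE_insert[OF nI(1)] using ij by simp
  also have "\<bar>\<dots>\<bar> \<le> (\<Sum>z\<in>I \<rightarrow>\<^sub>E V. \<eta> * real (card V) ^ 2)"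
    by (rule order_trans[OF sum_abs sum_mono]) (rule one)
  also have "\<dots> = \<eta> * real (card V) ^ r"
    by (simp add: card_PiE finI flip: cI) (simp add: power_add power2_eq_square)
  finally show ?thesis unfolding G_def .
qed

text \<open>Telescoping: \<open>T D\<close> uses \<open>h\<close> on the pairs in \<open>D\<close>
  and \<open>g\<close> on the others. Enlarging \<open>D\<close> by one pair changes the sum by an
  expression in which that pair carries \<open>g - h\<close>, and this costs at most
  \<open>\<eta> * card V ^ r\<close>.\<close>

lemma counting_lemma:
  assumes V: "finite V"
    and g: "\<And>u v. u \<in> V \<Longrightarrow> v \<in> V \<Longrightarrow> 0 \<le> g u v \<and> g u v \<le> (1::real)"
    and h: "\<And>u v. u \<in> V \<Longrightarrow> v \<in> V \<Longrightarrow> 0 \<le> h u v \<and> h u v \<le> (1::real)"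
    and cut: "cut_bounded V (\<eta> * real (card V) ^ 2) (\<lambda>u v. g u v - h u v)"
  shows "\<bar>hom_sum r V g - hom_sum r V h\<bar> \<le> real (card (pairs_below r)) * \<eta> * real (card V) ^ r"
proof -
  define m where "m D e = (if e \<in> D then h else g)" for D and e :: "nat \<times> nat"
  define T where "T D = (\<Sum>x\<in>{..<r} \<rightarrow>\<^sub>E V. \<Prod>e\<in>pairs_below r. m D e (x (fst e)) (x (snd e)))" for D
  have "\<bar>hom_sum r V g - T D\<bar> \<le> real (card D) * \<eta> * real (card V) ^ r"
    if "D \<subseteq> pairs_below r" for D
    using finite_subset[OF that finite_pairs_below] that
  proof (induction D rule: finite_induct)
    case empty
    then show ?case by (simp add: T_def m_def hom_sum_def)
  next
    case (insert e D)
    obtain i j where e: "e = (i, j)" "i < j" "j < r" using insert.prems by (auto simp: pairs_below_def)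
    define E where "E = pairs_below r - {e}"
    have split: "(\<Prod>e\<in>pairs_below r. m D' e (x (fst e)) (x (snd e))) =
        m D' e (x i) (x j) * (\<Prod>e\<in>E. m D' e (x (fst e)) (x (snd e)))" for D' x
      unfolding E_def using insert.prems by (subst prod.remove[of _ e]) (auto simp: e)
    have E: "(\<Prod>e'\<in>E. m (insert e D) e' (x (fst e')) (x (snd e'))) =
        (\<Prod>e\<in>E. m D e (x (fst e)) (x (snd e)))" for x
      by (rule prod.cong) (auto simp: m_def E_def)
    have "T D - T (insert e D) =
      (\<Sum>x\<in>{..<r} \<rightarrow>\<^sub>E V. (g (x i) (x j) - h (x i) (x j)) * (\<Prod>e\<in>E. m D e (x (fst e)) (x (snd e))))"
      unfolding T_def split E using insert.hyps
      by (simp add: sum_subtractf[symmetric] left_diff_distrib) (simp add: m_def)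
    also have "\<bar>\<dots>\<bar> \<le> \<eta> * real (card V) ^ r"
      using e by (intro edge_functional_bound[OF V _ _ _ _ _ cut]) (auto simp: E_def m_def g h)
    finally have "\<bar>T D - T (insert e D)\<bar> \<le> \<eta> * real (card V) ^ r" .
    with insert show ?case by (auto simp: algebra_simps)
  qed
  from this[OF order_refl] show ?thesis
    by (simp add: T_def m_def hom_sum_def)
qed

section \<open>Containers for graphs with few cliques\<close>

definition clamp01 :: "real \<Rightarrow> real" where
  "clamp01 x = max 0 (min 1 x)"

lemma clamp01_bounds [simp]: "0 \<le> clamp01 x" "clamp01 x \<le> 1"
  by (auto simp: clamp01_def)

lemma clamp01_closer: "0 \<le> a \<Longrightarrow> a \<le> 1 \<Longrightarrow> (a - clamp01 x)\<^sup>2 \<le> (a - x)\<^sup>2"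
  unfolding clamp01_def by (subst abs_le_square_iff[symmetric]) auto

text \<open>Starting from the zero kernel, each failure of \<open>kernel_approx\<close> below triggers an update that
  lowers the squared distance to the approximated kernel. Truncation does not increase this distance
  and keeps the values in the unit interval, as the counting lemma needs. The level update does not
  depend on the approximated kernel, so it does not enlarge the family of possible outcomes; it makes
  the graph sparse on the pairs outside the container.\<close>

definition rect_update :: "real \<Rightarrow> 'a set \<Rightarrow> 'a set \<Rightarrow> ('a \<Rightarrow> 'a \<Rightarrow> real) \<Rightarrow> 'a \<Rightarrow> 'a \<Rightarrow> real" where
  "rect_update c S T h u v =
    clamp01 (h u v + c * (of_bool (u \<in> S \<and> v \<in> T) + of_bool (u \<in> T \<and> v \<in> S)))"

definition level_update :: "real \<Rightarrow> ('a \<Rightarrow> 'a \<Rightarrow> real) \<Rightarrow> 'a \<Rightarrow> 'a \<Rightarrow> real" where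
  "level_update \<rho> h u v = clamp01 (h u v + \<rho> * of_bool (h u v < \<rho>))"

text \<open>Keeping \<open>h\<close> itself makes the families increase with the number of steps, so
  a run that succeeds early is still present after exactly \<open>k\<close> steps.\<close>

definition kernel_successors ::
    "'a set \<Rightarrow> real \<Rightarrow> real \<Rightarrow> ('a \<Rightarrow> 'a \<Rightarrow> real) \<Rightarrow> ('a \<Rightarrow> 'a \<Rightarrow> real) set" where
  "kernel_successors V \<eta> \<rho> h = insert h (insert (level_update \<rho> h)
    ((\<lambda>(c, S, T). rect_update c S T h) ` ({\<eta>/2, -\<eta>/2} \<times> Pow V \<times> Pow V)))"

primrec kernel_family :: "'a set \<Rightarrow> real \<Rightarrow> real \<Rightarrow> nat \<Rightarrow> ('a \<Rightarrow> 'a \<Rightarrow> real) set" where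
  "kernel_family V \<eta> \<rho> 0 = {\<lambda>_ _. 0}"
| "kernel_family V \<eta> \<rho> (Suc k) = (\<Union>h\<in>kernel_family V \<eta> \<rho> k. kernel_successors V \<eta> \<rho> h)"

lemma finite_kernel_successors: "finite V \<Longrightarrow> finite (kernel_successors V \<eta> \<rho> h)"
  by (simp add: kernel_successors_def)

lemma card_kernel_successors:
  assumes "finite V"
  shows "card (kernel_successors V \<eta> \<rho> h) \<le> 4 ^ (card V + 1)"
proof -
  let ?R = "(\<lambda>(c, S, T). rect_update c S T h) ` ({\<eta>/2, -\<eta>/2} \<times> Pow V \<times> Pow V)"
  have "card ?R \<le> card ({\<eta>/2, -\<eta>/2} \<times> Pow V \<times> Pow V)"
    using assms by (intro card_image_le) auto
  also have "\<dots> \<le> 2 * (2 ^ card V * 2 ^ card V)"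
    using assms by (simp add: card_cartesian_product card_Pow card_insert_if)
  also have "\<dots> = 2 * 4 ^ card V" by (simp flip: power_mult_distrib)
  finally have "card (kernel_successors V \<eta> \<rho> h) \<le> 2 + 2 * 4 ^ card V"
    using assms by (simp add: kernel_successors_def card_insert_if)
  also have "\<dots> \<le> 4 ^ (card V + 1)" by simp
  finally show ?thesis .
qed

lemma finite_kernel_family: "finite V \<Longrightarrow> finite (kernel_family V \<eta> \<rho> k)"
  by (induction k) (auto simp: finite_kernel_successors)

text \<open>For fixed \<open>k\<close> the exponent is linear in \<open>card V\<close>, hence
  negligible against the square of \<open>card V\<close> that is gained or lost in all later
  estimates.\<close>

lemma card_kernel_family:
  assumes "finite V"
  shows "card (kernel_family V \<eta> \<rho> k) \<le> 4 ^ ((card V + 1) * k)"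
proof (induction k)
  case (Suc k)
  have "card (kernel_family V \<eta> \<rho> (Suc k)) \<le>
    (\<Sum>h\<in>kernel_family V \<eta> \<rho> k. card (kernel_successors V \<eta> \<rho> h))"
    using assms by (auto intro!: card_UN_le finite_kernel_family)
  also have "\<dots> \<le> card (kernel_family V \<eta> \<rho> k) * 4 ^ (card V + 1)"
    using sum_bounded_above[OF card_kernel_successors[OF assms]] by fastforce
  also have "\<dots> \<le> 4 ^ ((card V + 1) * k) * 4 ^ (card V + 1)" using Suc by simp
  also have "\<dots> = 4 ^ ((card V + 1) * Suc k)" by (simp add: power_add mult.commute)
  finally show ?case .
qed simp

lemma kernel_family_bounds:
  "h \<in> kernel_family V \<eta> \<rho> k \<Longrightarrow> 0 \<le> h u v \<and> h u v \<le> 1 \<and> h u v = h v u"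
proof (induction k arbitrary: h u v)
  case (Suc k)
  then obtain h' where h': "h' \<in> kernel_family V \<eta> \<rho> k" "h \<in> kernel_successors V \<eta> \<rho> h'"
    by auto
  have "h' u v = h' v u" using Suc.IH[OF h'(1)] by blast
  then show ?case using h'(2) Suc.IH[OF h'(1)] unfolding kernel_successors_def
    by (auto simp: level_update_def rect_update_def add.commute conj_commute)
qed simp

text \<open>The cut bound sees rectangles only, while the set of pairs with
  \<open>h u v < \<rho>\<close> need not be one. The second condition therefore treats this set
  directly. It is one-sided because it only has to bound the edges that a container misses.\<close>

definition kernel_approx ::
    "'a set \<Rightarrow> real \<Rightarrow> real \<Rightarrow> ('a \<Rightarrow> 'a \<Rightarrow> real) \<Rightarrow> ('a \<Rightarrow> 'a \<Rightarrow> real) \<Rightarrow> bool" where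
  "kernel_approx V \<eta> \<rho> g h \<longleftrightarrow>
    cut_bounded V (\<eta> * real (card V) ^ 2) (\<lambda>u v. g u v - h u v) \<and>
    (\<Sum>u\<in>V. \<Sum>v\<in>V. of_bool (h u v < \<rho>) * (g u v - h u v)) \<le> \<rho> * real (card V) ^ 2"

text \<open>Clamping moves a value no further from \<open>g u v\<close>, which lies in the unit
  interval; what remains is the expansion of the square.\<close>

lemma energy_update:
  fixes g h p :: "'a \<Rightarrow> 'a \<Rightarrow> real"
  assumes "\<And>u v. u \<in> V \<Longrightarrow> v \<in> V \<Longrightarrow> 0 \<le> g u v \<and> g u v \<le> 1"
  shows "(\<Sum>u\<in>V. \<Sum>v\<in>V. (g u v - clamp01 (h u v + p u v))\<^sup>2) \<le>
    (\<Sum>u\<in>V. \<Sum>v\<in>V. (g u v - h u v)\<^sup>2) - 2 * (\<Sum>u\<in>V. \<Sum>v\<in>V. p u v * (g u v - h u v))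
      + (\<Sum>u\<in>V. \<Sum>v\<in>V. (p u v)\<^sup>2)"
proof -
  have "(\<Sum>u\<in>V. \<Sum>v\<in>V. (g u v - clamp01 (h u v + p u v))\<^sup>2) \<le>
      (\<Sum>u\<in>V. \<Sum>v\<in>V. (g u v - (h u v + p u v))\<^sup>2)"
    using assms by (intro sum_mono clamp01_closer) auto
  also have "\<dots> = (\<Sum>u\<in>V. \<Sum>v\<in>V. (g u v - h u v)\<^sup>2 - 2 * (p u v * (g u v - h u v)) + (p u v)\<^sup>2)"
    by (intro sum.cong refl) (simp add: power2_eq_square algebra_simps)
  also have "\<dots> = (\<Sum>u\<in>V. \<Sum>v\<in>V. (g u v - h u v)\<^sup>2)
      - 2 * (\<Sum>u\<in>V. \<Sum>v\<in>V. p u v * (g u v - h u v)) + (\<Sum>u\<in>V. \<Sum>v\<in>V. (p u v)\<^sup>2)"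
    by (simp add: sum.distrib sum_subtractf sum_distrib_left)
  finally show ?thesis .
qed

lemma sum_of_bool_rect:
  fixes k :: "'a \<Rightarrow> 'a \<Rightarrow> real"
  assumes "finite V" "S \<subseteq> V" "T \<subseteq> V"
  shows "(\<Sum>u\<in>V. \<Sum>v\<in>V. of_bool (u \<in> S \<and> v \<in> T) * k u v) = (\<Sum>u\<in>S. \<Sum>v\<in>T. k u v)"
proof -
  have "(\<Sum>u\<in>V. \<Sum>v\<in>V. of_bool (u \<in> S \<and> v \<in> T) * k u v) =
      (\<Sum>u\<in>V. if u \<in> S then \<Sum>v\<in>V. if v \<in> T then k u v else 0 else 0)"
    by (intro sum.cong refl) (auto intro!: sum.cong)
  then show ?thesis using assms by (simp add: sum.If_cases Int_absorb1)
qed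

text \<open>An update correlates with the residual \<open>g - h\<close> by at least
  \<open>\<eta>\<^sup>2 * card V ^ 2\<close>, which enters the energy twice, while its own square
  sum costs at most that amount once. The level update gives the same balance with
  \<open>\<rho>\<close> in place of \<open>\<eta>\<close>.\<close>

lemma kernel_step:
  assumes V: "finite V" and \<eta>: "0 < \<eta>" "\<eta> \<le> \<rho>"
    and g: "\<And>u v. u \<in> V \<Longrightarrow> v \<in> V \<Longrightarrow> 0 \<le> g u v \<and> g u v \<le> (1::real)"
    and sym: "\<And>u v. g u v = g v u" "\<And>u v. h u v = h v u"
    and bad: "\<not> kernel_approx V \<eta> \<rho> g h"
  shows "\<exists>h'\<in>kernel_successors V \<eta> \<rho> h.
    (\<Sum>u\<in>V. \<Sum>v\<in>V. (g u v - h' u v)\<^sup>2) \<le>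
    (\<Sum>u\<in>V. \<Sum>v\<in>V. (g u v - h u v)\<^sup>2) - \<eta>\<^sup>2 * real (card V) ^ 2"
proof (cases "cut_bounded V (\<eta> * real (card V) ^ 2) (\<lambda>u v. g u v - h u v)")
  case False
  then obtain S T where ST: "S \<subseteq> V" "T \<subseteq> V"
    "\<bar>\<Sum>u\<in>S. \<Sum>v\<in>T. g u v - h u v\<bar> > \<eta> * real (card V) ^ 2"
    unfolding cut_bounded_def by (auto simp: not_le)
  define x where "x = (\<Sum>u\<in>S. \<Sum>v\<in>T. g u v - h u v)"
  \<comment> \<open>The sign makes the correlation with the residual positive. The half is due to
    the symmetrised rectangle: where both orientations overlap the increment doubles, and it must
    stay within \<open>\<eta>\<close>. By symmetry of the residual both orientations contribute
    \<open>x\<close>, so the correlation is still \<open>\<eta> * \<bar>x\<bar>\<close>.\<close>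
  define c where "c = (if x \<ge> 0 then \<eta>/2 else -\<eta>/2)"
  define p where "p u v = c * (of_bool (u \<in> S \<and> v \<in> T) + of_bool (u \<in> T \<and> v \<in> S))" for u v
  have x': "(\<Sum>u\<in>T. \<Sum>v\<in>S. g u v - h u v) = x"
    unfolding x_def by (subst sum.swap) (auto intro!: sum.cong simp: sym)
  have "(\<Sum>u\<in>V. \<Sum>v\<in>V. p u v * (g u v - h u v)) =
     c * ((\<Sum>u\<in>V. \<Sum>v\<in>V. of_bool (u \<in> S \<and> v \<in> T) * (g u v - h u v)) +
          (\<Sum>u\<in>V. \<Sum>v\<in>V. of_bool (u \<in> T \<and> v \<in> S) * (g u v - h u v)))"
    unfolding p_def by (simp only: mult.assoc distrib_right sum.distrib sum_distrib_left distrib_left)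
  also have "\<dots> = c * (2 * x)"
    using sum_of_bool_rect[OF V ST(1,2)] sum_of_bool_rect[OF V ST(2,1)] x' by (simp add: x_def)
  also have "\<dots> = \<eta> * \<bar>x\<bar>" by (simp add: c_def)
  finally have 1: "(\<Sum>u\<in>V. \<Sum>v\<in>V. p u v * (g u v - h u v)) \<ge> \<eta> * (\<eta> * real (card V) ^ 2)"
    using ST(3) \<eta> by (simp add: x_def mult_left_mono less_imp_le)
  have "(p u v)\<^sup>2 \<le> \<eta>\<^sup>2" for u v
    unfolding p_def c_def by (auto simp: power2_eq_square)
  then have "(\<Sum>u\<in>V. \<Sum>v\<in>V. (p u v)\<^sup>2) \<le> (\<Sum>u\<in>V. \<Sum>v\<in>V. \<eta>\<^sup>2)"
    by (intro sum_mono)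
  then have 2: "(\<Sum>u\<in>V. \<Sum>v\<in>V. (p u v)\<^sup>2) \<le> \<eta>\<^sup>2 * real (card V) ^ 2"
    by (simp add: power2_eq_square mult_ac)
  have "rect_update c S T h \<in> kernel_successors V \<eta> \<rho> h"
    unfolding kernel_successors_def using ST
    by (intro insertI2 image_eqI[of _ _ "(c, S, T)"]) (auto simp: c_def)
  moreover have "(\<Sum>u\<in>V. \<Sum>v\<in>V. (g u v - rect_update c S T h u v)\<^sup>2) \<le>
    (\<Sum>u\<in>V. \<Sum>v\<in>V. (g u v - h u v)\<^sup>2) - \<eta>\<^sup>2 * real (card V) ^ 2"
    using energy_update[of V g h p, OF g] 1 2
    by (simp add: rect_update_def p_def power2_eq_square)
  ultimately show ?thesis by blast
next
  case True
  with bad have *: "(\<Sum>u\<in>V. \<Sum>v\<in>V. of_bool (h u v < \<rho>) * (g u v - h u v)) > \<rho> * real (card V) ^ 2"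
    by (simp add: kernel_approx_def)
  define p where "p u v = \<rho> * of_bool (h u v < \<rho>)" for u v
  have "(\<Sum>u\<in>V. \<Sum>v\<in>V. p u v * (g u v - h u v)) =
     \<rho> * (\<Sum>u\<in>V. \<Sum>v\<in>V. of_bool (h u v < \<rho>) * (g u v - h u v))"
    unfolding p_def by (simp only: mult.assoc sum_distrib_left)
  then have 1: "(\<Sum>u\<in>V. \<Sum>v\<in>V. p u v * (g u v - h u v)) \<ge> \<rho> * (\<rho> * real (card V) ^ 2)"
    using * \<eta> by (simp add: mult_left_mono less_imp_le)
  have "(p u v)\<^sup>2 \<le> \<rho>\<^sup>2" for u v
    unfolding p_def by (auto simp: power2_eq_square)
  then have "(\<Sum>u\<in>V. \<Sum>v\<in>V. (p u v)\<^sup>2) \<le> (\<Sum>u\<in>V. \<Sum>v\<in>V. \<rho>\<^sup>2)"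
    by (intro sum_mono)
  then have 2: "(\<Sum>u\<in>V. \<Sum>v\<in>V. (p u v)\<^sup>2) \<le> \<rho>\<^sup>2 * real (card V) ^ 2"
    by (simp add: power2_eq_square mult_ac)
  have 3: "\<eta>\<^sup>2 * real (card V) ^ 2 \<le> \<rho>\<^sup>2 * real (card V) ^ 2"
    using \<eta> by (intro mult_right_mono power_mono) auto
  have "(\<Sum>u\<in>V. \<Sum>v\<in>V. (g u v - level_update \<rho> h u v)\<^sup>2) \<le>
    (\<Sum>u\<in>V. \<Sum>v\<in>V. (g u v - h u v)\<^sup>2) - \<eta>\<^sup>2 * real (card V) ^ 2"
    using energy_update[of V g h p, OF g] 1 2 3
    by (simp add: level_update_def p_def power2_eq_square)
  then show ?thesis by (auto simp: kernel_successors_def)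
qed

text \<open>The energy of the zero kernel is at most \<open>card V ^ 2\<close>, it cannot become
  negative, and each failure lowers it by \<open>\<eta>\<^sup>2 * card V ^ 2\<close>; so fewer than
  \<open>k\<close> failures are possible. The empty vertex set is treated apart because the
  contradiction needs a strictly negative bound.\<close>

lemma kernel_family_approx:
  assumes V: "finite V" and \<eta>: "0 < \<eta>" "\<eta> \<le> \<rho>" and k: "real k * \<eta>\<^sup>2 > 1"
    and g: "\<And>u v. u \<in> V \<Longrightarrow> v \<in> V \<Longrightarrow> 0 \<le> g u v \<and> g u v \<le> (1::real)"
    and sym: "\<And>u v. g u v = g v u"
  shows "\<exists>h\<in>kernel_family V \<eta> \<rho> k. kernel_approx V \<eta> \<rho> g h"
proof (cases "V = {}")
  case True
  have "(\<lambda>_ _. 0) \<in> kernel_family V \<eta> \<rho> k"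
    by (induction k) (auto simp: kernel_successors_def)
  then show ?thesis using True by (force simp: kernel_approx_def cut_bounded_def)
next
  case False
  then have n: "card V > 0" using V by auto
  have "(\<exists>h\<in>kernel_family V \<eta> \<rho> m. kernel_approx V \<eta> \<rho> g h) \<or>
    (\<exists>h\<in>kernel_family V \<eta> \<rho> m. (\<Sum>u\<in>V. \<Sum>v\<in>V. (g u v - h u v)\<^sup>2) \<le>
       real (card V) ^ 2 * (1 - real m * \<eta>\<^sup>2))" for m
  proof (induction m)
    case 0
    have "(\<Sum>u\<in>V. \<Sum>v\<in>V. (g u v)\<^sup>2) \<le> (\<Sum>u\<in>V. \<Sum>v\<in>V. 1)"
      using g by (intro sum_mono) (auto intro!: power_le_one)
    then show ?case by (simp add: power2_eq_square)
  next
    case (Suc m)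
    show ?case
    proof (cases "\<exists>h\<in>kernel_family V \<eta> \<rho> m. kernel_approx V \<eta> \<rho> g h")
      case True
      then show ?thesis by (auto simp: kernel_successors_def)
    next
      case False
      then obtain h where h: "h \<in> kernel_family V \<eta> \<rho> m" "(\<Sum>u\<in>V. \<Sum>v\<in>V. (g u v - h u v)\<^sup>2) \<le>
       real (card V) ^ 2 * (1 - real m * \<eta>\<^sup>2)" "\<not> kernel_approx V \<eta> \<rho> g h"
        using Suc.IH by blast
      have "h u v = h v u" for u v using kernel_family_bounds[OF h(1)] by blast
      from kernel_step[OF V \<eta> g sym this h(3)] h(1,2) show ?thesis
        by (force simp: algebra_simps)
    qed
  qed
  from this[of k] show ?thesis
  proof
    assume "\<exists>h\<in>kernel_family V \<eta> \<rho> k. (\<Sum>u\<in>V. \<Sum>v\<in>V. (g u v - h u v)\<^sup>2) \<le>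
       real (card V) ^ 2 * (1 - real k * \<eta>\<^sup>2)"
    then obtain h where "(\<Sum>u\<in>V. \<Sum>v\<in>V. (g u v - h u v)\<^sup>2) \<le> real (card V) ^ 2 * (1 - real k * \<eta>\<^sup>2)"
      by blast
    moreover have "real (card V) ^ 2 * (1 - real k * \<eta>\<^sup>2) < 0"
      using k n by (intro mult_pos_neg) auto
    moreover have "(\<Sum>u\<in>V. \<Sum>v\<in>V. (g u v - h u v)\<^sup>2) \<ge> 0" by (intro sum_nonneg) auto
    ultimately show ?thesis by linarith
  qed
qed

section \<open>Clique tuples, clique counts and homomorphism sums\<close>

definition clique_tuples :: "nat \<Rightarrow> 'a set \<Rightarrow> ('a \<Rightarrow> 'a \<Rightarrow> bool) \<Rightarrow> (nat \<Rightarrow> 'a) set" where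
  "clique_tuples r X adj = {x \<in> {..<r} \<rightarrow>\<^sub>E X. \<forall>i j. i < j \<and> j < r \<longrightarrow> adj (x i) (x j)}"

lemma finite_clique_tuples: "finite X \<Longrightarrow> finite (clique_tuples r X adj)"
  unfolding clique_tuples_def by (rule finite_subset[of _ "{..<r} \<rightarrow>\<^sub>E X"]) (auto intro: finite_PiE)

lemma prod_of_bool_pairs:
  "(\<Prod>e\<in>pairs_below r. of_bool (adj (x (fst e)) (x (snd e)))) =
   (of_bool (\<forall>i j. i < j \<and> j < r \<longrightarrow> adj (x i) (x j)) :: real)"
proof (cases "\<forall>i j. i < j \<and> j < r \<longrightarrow> adj (x i) (x j)")
  case False
  then obtain i j where "i < j" "j < r" "\<not> adj (x i) (x j)" by blast
  then have "\<exists>e\<in>pairs_below r. of_bool (adj (x (fst e)) (x (snd e))) = (0::real)"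
    by (intro bexI[of _ "(i, j)"]) (auto simp: pairs_below_def)
  then have "(\<Prod>e\<in>pairs_below r. of_bool (adj (x (fst e)) (x (snd e)))) = (0::real)"
    by (intro prod_zero) auto
  then show ?thesis using False by (simp only: of_bool_eq simp_thms)
qed (auto intro!: prod.neutral simp: pairs_below_def)

lemma hom_sum_eq_card_clique_tuples:
  assumes "finite V"
  shows "hom_sum r V (\<lambda>u v. of_bool (adj u v)) = real (card (clique_tuples r V adj))"
  unfolding hom_sum_def prod_of_bool_pairs clique_tuples_def using assms
  by (simp add: of_bool_def sum.If_cases finite_PiE Int_def)

text \<open>Every pair of a clique tuple has level at least \<open>\<rho>\<close>, so the tuple
  alone contributes \<open>\<rho>\<close> to the number of pairs. This transfers scarcity of cliques
  from a kernel to its container.\<close>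

lemma clique_tuples_le_hom_sum:
  assumes "finite V" and \<rho>: "0 \<le> \<rho>" and h: "\<And>u v. 0 \<le> h u v"
    and adj: "\<And>u v. adj u v \<Longrightarrow> \<rho> \<le> h u v"
  shows "\<rho> ^ card (pairs_below r) * real (card (clique_tuples r V adj)) \<le> hom_sum r V h"
proof -
  have "\<rho> ^ card (pairs_below r) * real (card (clique_tuples r V adj)) =
    (\<Sum>x\<in>clique_tuples r V adj. \<Prod>e\<in>pairs_below r. \<rho>)" by simp
  also have "\<dots> \<le> (\<Sum>x\<in>clique_tuples r V adj. \<Prod>e\<in>pairs_below r. h (x (fst e)) (x (snd e)))"
    using \<rho> adj by (intro sum_mono prod_mono) (auto simp: clique_tuples_def pairs_below_def)
  also have "\<dots> \<le> hom_sum r V h" unfolding hom_sum_def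
    using assms(1) h by (intro sum_mono2) (auto intro: finite_PiE prod_nonneg simp: clique_tuples_def)
  finally show ?thesis .
qed

text \<open>Edges have two distinct ends, so a clique tuple is injective and its image is a clique
  on \<open>r\<close> vertices. The factor \<open>r ^ r\<close> crudely counts all maps into that
  image; it is absorbed into \<open>\<gamma>\<close>.\<close>

lemma card_clique_tuples_le_clique_count:
  assumes G: "G \<in> graphs_on n"
  shows "card (clique_tuples r {1..n} (\<lambda>u v. {u, v} \<in> G)) \<le> r ^ r * clique_count n r G"
proof -
  define K where "K = {S. S \<subseteq> {1..n} \<and> card S = r \<and> (\<forall>u\<in>S. \<forall>v\<in>S. u \<noteq> v \<longrightarrow> {u, v} \<in> G)}"
  have finK: "finite K" unfolding K_def by (rule finite_subset[of _ "Pow {1..n}"]) auto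
  have ne: "u \<noteq> v" if "{u, v} \<in> G" for u v using that G by (auto simp: graphs_on_def)
  have "clique_tuples r {1..n} (\<lambda>u v. {u, v} \<in> G) \<subseteq> (\<Union>S\<in>K. {..<r} \<rightarrow>\<^sub>E S)"
  proof
    fix x assume x: "x \<in> clique_tuples r {1..n} (\<lambda>u v. {u, v} \<in> G)"
    have adj: "{x i, x j} \<in> G" if "i < r" "j < r" "i \<noteq> j" for i j
    proof (cases "i < j")
      case False
      then have "{x j, x i} \<in> G" using x that by (auto simp: clique_tuples_def)
      then show ?thesis by (simp add: insert_commute)
    qed (use x that in \<open>auto simp: clique_tuples_def\<close>)
    have "inj_on x {..<r}" by (rule inj_onI) (use adj ne in blast)
    then have "card (x ` {..<r}) = r" by (simp add: card_image)
    moreover have "\<forall>u\<in>x ` {..<r}. \<forall>v\<in>x ` {..<r}. u \<noteq> v \<longrightarrow> {u, v} \<in> G"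
      using adj by auto
    ultimately have "x ` {..<r} \<in> K" using x by (auto simp: K_def clique_tuples_def)
    moreover have "x \<in> {..<r} \<rightarrow>\<^sub>E x ` {..<r}" using x by (auto simp: clique_tuples_def PiE_def)
    ultimately show "x \<in> (\<Union>S\<in>K. {..<r} \<rightarrow>\<^sub>E S)" by blast
  qed
  moreover have fin: "finite S" "card S = r" if "S \<in> K" for S
    using that finite_subset by (auto simp: K_def)
  ultimately have "card (clique_tuples r {1..n} (\<lambda>u v. {u, v} \<in> G)) \<le> card (\<Union>S\<in>K. {..<r} \<rightarrow>\<^sub>E S)"
    using finK by (intro card_mono) (auto intro!: finite_PiE)
  also have "\<dots> \<le> (\<Sum>S\<in>K. card ({..<r} \<rightarrow>\<^sub>E S))" by (rule card_UN_le[OF finK])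
  also have "\<dots> = r ^ r * card K" using fin by (simp add: card_PiE)
  finally show ?thesis by (simp add: K_def clique_count_def)
qed

lemma sum_adj_eq_twice_card:
  assumes F: "F \<subseteq> {e. e \<subseteq> V \<and> card e = 2}" and V: "finite V"
  shows "(\<Sum>u\<in>V. \<Sum>v\<in>V. of_bool ({u, v} \<in> F)) = 2 * real (card F)"
proof -
  have finF: "finite F" by (rule finite_subset[OF F]) (use V in auto)
  have "(\<Sum>u\<in>V. \<Sum>v\<in>V. of_bool ({u, v} \<in> F)) = real (card {(u, v) \<in> V \<times> V. {u, v} \<in> F})"
    unfolding sum.cartesian_product using V
    by (simp add: of_bool_def sum.If_cases case_prod_unfold Int_def mem_Times_iff)
  also have "{(u, v) \<in> V \<times> V. {u, v} \<in> F} = (\<Union>e\<in>F. {(u, v). {u, v} = e})"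
    using F by auto
  also have "card \<dots> = (\<Sum>e\<in>F. card {(u, v). {u, v} = e})"
  proof (rule card_UN_disjoint[OF finF])
    show "\<forall>e\<in>F. finite {(u, v). {u, v} = e}"
    proof
      fix e assume "e \<in> F"
      then have "e \<subseteq> V" using F by blast
      then have "{(u, v). {u, v} = e} \<subseteq> V \<times> V" by blast
      then show "finite {(u, v). {u, v} = e}" by (rule finite_subset) (use V in auto)
    qed
    show "\<forall>e\<in>F. \<forall>e'\<in>F. e \<noteq> e' \<longrightarrow> {(u, v). {u, v} = e} \<inter> {(u, v). {u, v} = e'} = {}"
      by blast
  qed
  also have "\<dots> = (\<Sum>e\<in>F. 2)"
  proof (rule sum.cong[OF refl])
    fix e assume "e \<in> F"
    then have "card e = 2" using F by blast
    then obtain a b where e: "e = {a, b}" "a \<noteq> b" by (meson card_2_iff)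
    have "{(u, v). {u, v} = e} = {(a, b), (b, a)}" unfolding e(1) doubleton_eq_iff by blast
    then show "card {(u, v). {u, v} = e} = 2" using e(2) by simp
  qed
  finally show ?thesis by simp
qed

abbreviation few_cliques :: "nat \<Rightarrow> nat \<Rightarrow> real \<Rightarrow> ugraph \<Rightarrow> bool" where
  "few_cliques n r \<gamma> G \<equiv> real (clique_count n r G) \<le> \<gamma> * real n ^ r"

abbreviation containers ::
    "nat \<Rightarrow> nat \<Rightarrow> nat \<Rightarrow> real \<Rightarrow> real \<Rightarrow> ugraph set \<Rightarrow> bool" where
  "containers n k r \<delta> \<gamma> \<C> \<equiv> finite \<C> \<and> card \<C> \<le> 4 ^ ((n + 1) * k) \<and> \<C> \<subseteq> graphs_on n \<and>
    (\<forall>C\<in>\<C>. real (card (clique_tuples r {1..n} (\<lambda>u v. {u, v} \<in> C))) \<le> \<delta> * real n ^ r) \<and>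
    (\<forall>G\<in>graphs_on n. few_cliques n r \<gamma> G \<longrightarrow>
      (\<exists>C\<in>\<C>. real (card (G - C)) \<le> \<delta> * real n ^ 2))"

text \<open>The container of a graph is the set of pairs with \<open>\<rho> \<le> h u v\<close>,
  where \<open>h\<close> approximates the graph. By the counting lemma \<open>h\<close> has a small
  homomorphism sum, so its container has few cliques; by the level condition few edges of the graph
  lie where \<open>h\<close> is below \<open>\<rho>\<close>.\<close>

lemma container_family:
  fixes \<delta> :: real
  assumes \<delta>: "\<delta> > 0"
  shows "\<exists>\<gamma>>0. \<exists>k::nat. \<forall>n. \<exists>\<C>. containers n k r \<delta> \<gamma> \<C>"
proof -
  define p where "p = card (pairs_below r)"
  \<comment> \<open>\<open>\<rho>\<close> bounds the escaping edges. \<open>\<eta>\<close> and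
    \<open>\<gamma>\<close> make the counting error and the cliques of the graph each at most half
    of \<open>\<delta> * \<rho> ^ p * n ^ r\<close>; the factor \<open>\<rho> ^ p\<close> is the
    weight of one clique tuple of the container. The \<open>+ 1\<close> in \<open>\<eta>\<close>
    covers the case \<open>p = 0\<close>.\<close>
  define \<rho> where "\<rho> = min 1 \<delta>"
  define \<eta> where "\<eta> = \<rho> ^ (p + 2) / (2 * real p + 1)"
  define \<gamma> where "\<gamma> = \<delta> * \<rho> ^ p / (2 * real r ^ r + 1)"
  obtain k :: nat where k: "1 / \<eta>\<^sup>2 < real k" using reals_Archimedean2 by blast
  have \<rho>: "0 < \<rho>" "\<rho> \<le> 1" "\<rho> \<le> \<delta>" using \<delta> by (auto simp: \<rho>_def)
  have \<eta>0: "0 < \<eta>" using \<rho> by (auto simp: \<eta>_def)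
  have "\<eta> \<le> \<rho> ^ (p + 2)" using \<rho> by (simp add: \<eta>_def divide_le_eq mult_left_le)
  also have "\<dots> \<le> \<rho> ^ 1" using \<rho> by (intro power_decreasing) auto
  finally have \<eta>: "\<eta> \<le> \<rho>" by simp
  have p\<eta>: "real p * \<eta> \<le> \<delta> * \<rho> ^ p / 2"
  proof -
    have "real p * \<eta> \<le> \<rho> ^ (p + 2) / 2"
      using \<rho> unfolding \<eta>_def by (auto simp: field_simps)
    also have "\<dots> = \<rho> * \<rho> * \<rho> ^ p / 2" by (simp add: power_add power2_eq_square)
    also have "\<dots> \<le> \<delta> * 1 * \<rho> ^ p / 2"
      using \<rho> by (intro divide_right_mono mult_right_mono mult_mono) auto
    finally show ?thesis by simp
  qed
  have \<gamma>: "\<gamma> > 0" using \<delta> \<rho> by (auto simp: \<gamma>_def intro!: divide_pos_pos add_nonneg_pos)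
  have \<gamma>2: "real r ^ r * \<gamma> \<le> \<delta> * \<rho> ^ p / 2"
  proof -
    have *: "0 \<le> real r ^ r" by simp
    have "real r ^ r / (2 * real r ^ r + 1) \<le> 1 / 2" using * by (subst pos_divide_le_eq) (auto intro: add_nonneg_pos)
    then have "(\<delta> * \<rho> ^ p) * (real r ^ r / (2 * real r ^ r + 1)) \<le> (\<delta> * \<rho> ^ p) * (1 / 2)"
      using \<delta> \<rho> by (intro mult_left_mono) auto
    then show ?thesis by (simp add: \<gamma>_def mult_ac)
  qed
  have k1: "real k * \<eta>\<^sup>2 > 1" using k \<eta>0 by (simp add: field_simps)
  show ?thesis
  proof (rule exI[of _ \<gamma>], intro conjI \<gamma>, rule exI[of _ k], rule allI)
    fix n :: nat
    define V where "V = {1..n}"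
    define cont where "cont h = {e. \<exists>u\<in>V. \<exists>v\<in>V. u \<noteq> v \<and> e = {u, v} \<and> \<rho> \<le> h u v}" for h
    \<comment> \<open>Kernels in the family that approximate no graph with few cliques may have
      containers with many cliques; the condition discards those.\<close>
    define \<C> where "\<C> = {C \<in> cont ` kernel_family V \<eta> \<rho> k.
      real (card (clique_tuples r V (\<lambda>u v. {u, v} \<in> C))) \<le> \<delta> * real n ^ r}"
    have V: "finite V" "card V = n" by (auto simp: V_def)
    have finF: "finite (kernel_family V \<eta> \<rho> k)" using V by (intro finite_kernel_family)
    show "\<exists>\<C>. containers n k r \<delta> \<gamma> \<C>"
    proof (intro exI conjI ballI impI)
      show "finite \<C>" using finF by (simp add: \<C>_def)
      have "card \<C> \<le> card (kernel_family V \<eta> \<rho> k)"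
        unfolding \<C>_def using finF by (intro order_trans[OF card_mono card_image_le]) auto
      also have "\<dots> \<le> 4 ^ ((n + 1) * k)" using card_kernel_family[of V] V by simp
      finally show "card \<C> \<le> 4 ^ ((n + 1) * k)" .
      show "\<C> \<subseteq> graphs_on n" by (auto simp: \<C>_def cont_def graphs_on_def V_def)
      show "real (card (clique_tuples r {1..n} (\<lambda>u v. {u, v} \<in> C))) \<le> \<delta> * real n ^ r"
        if "C \<in> \<C>" for C using that by (auto simp: \<C>_def V_def)
      fix G assume G: "G \<in> graphs_on n" and few: "few_cliques n r \<gamma> G"
      define g where "g u v = (of_bool ({u, v} \<in> G) :: real)" for u v
      have g: "0 \<le> g u v \<and> g u v \<le> 1" "g u v = g v u" for u v
        by (auto simp: g_def insert_commute)
      obtain h where h: "h \<in> kernel_family V \<eta> \<rho> k" "kernel_approx V \<eta> \<rho> g h"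
        using kernel_family_approx[OF V(1) \<eta>0 \<eta> k1, of g] g by auto
      have hb: "0 \<le> h u v" "h u v \<le> 1" "h u v = h v u" for u v
        using kernel_family_bounds[OF h(1), of u v] by auto
      define C where "C = cont h"
      have C: "{u, v} \<in> C \<longleftrightarrow> u \<in> V \<and> v \<in> V \<and> u \<noteq> v \<and> \<rho> \<le> h u v" for u v
        unfolding C_def cont_def by (auto simp: doubleton_eq_iff hb(3))
      have "hom_sum r V g = real (card (clique_tuples r V (\<lambda>u v. {u, v} \<in> G)))"
        unfolding g_def by (rule hom_sum_eq_card_clique_tuples[OF V(1)])
      also have "\<dots> \<le> real (r ^ r * clique_count n r G)"
        unfolding V_def by (rule of_nat_mono[OF card_clique_tuples_le_clique_count[OF G]])
      also have "\<dots> \<le> real r ^ r * (\<gamma> * real n ^ r)"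
        using few by (simp add: mult_left_mono)
      also have "\<dots> \<le> \<delta> * \<rho> ^ p / 2 * real n ^ r"
        using mult_right_mono[OF \<gamma>2, of "real n ^ r"] by (simp add: mult.assoc)
      finally have 1: "hom_sum r V g \<le> \<delta> * \<rho> ^ p / 2 * real n ^ r" .
      have "\<bar>hom_sum r V g - hom_sum r V h\<bar> \<le> real p * \<eta> * real n ^ r"
        unfolding p_def V(2)[symmetric]
        using h(2) g hb by (intro counting_lemma V) (auto simp: kernel_approx_def)
      also have "\<dots> \<le> \<delta> * \<rho> ^ p / 2 * real n ^ r"
        using mult_right_mono[OF p\<eta>, of "real n ^ r"] by simp
      finally have "hom_sum r V h \<le> 2 * (\<delta> * \<rho> ^ p / 2 * real n ^ r)" using 1 by linarith
      then have 2: "hom_sum r V h \<le> \<delta> * \<rho> ^ p * real n ^ r" by simp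
      have "\<rho> ^ p * real (card (clique_tuples r V (\<lambda>u v. {u, v} \<in> C))) \<le> hom_sum r V h"
        unfolding p_def using C hb \<rho> by (intro clique_tuples_le_hom_sum V) auto
      with 2 have "\<rho> ^ p * real (card (clique_tuples r V (\<lambda>u v. {u, v} \<in> C))) \<le> \<rho> ^ p * (\<delta> * real n ^ r)"
        by (simp add: mult_ac)
      then have "real (card (clique_tuples r V (\<lambda>u v. {u, v} \<in> C))) \<le> \<delta> * real n ^ r"
        using \<rho> by simp
      then have "C \<in> \<C>" using h(1) by (auto simp: \<C>_def C_def)
      moreover have "real (card (G - C)) \<le> \<delta> * real n ^ 2"
      proof -
        have "2 * real (card (G - C)) = (\<Sum>u\<in>V. \<Sum>v\<in>V. of_bool ({u, v} \<in> G - C))"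
          by (rule sum_adj_eq_twice_card[symmetric]) (use G V in \<open>auto simp: graphs_on_def V_def\<close>)
        \<comment> \<open>At an escaping pair \<open>g\<close> is 1 and \<open>h\<close> is below
          \<open>\<rho>\<close>, so the right-hand summand is at least 1. At any other pair the
          first term is never below \<open>- \<rho>\<close>, which the added \<open>\<rho>\<close>
          compensates.\<close>
        also have "\<dots> \<le> (\<Sum>u\<in>V. \<Sum>v\<in>V. of_bool (h u v < \<rho>) * (g u v - h u v) + \<rho>)"
        proof (intro sum_mono)
          fix u v assume uv: "u \<in> V" "v \<in> V"
          have "u = v \<Longrightarrow> {u, v} \<notin> G" using G by (auto simp: graphs_on_def)
          then show "of_bool ({u, v} \<in> G - C) \<le> of_bool (h u v < \<rho>) * (g u v - h u v) + \<rho>"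
            using uv \<rho> hb[of u v] by (auto simp: C g_def not_le)
        qed
        also have "\<dots> = (\<Sum>u\<in>V. \<Sum>v\<in>V. of_bool (h u v < \<rho>) * (g u v - h u v)) + \<rho> * real n ^ 2"
          by (simp add: sum.distrib V power2_eq_square)
        also have "\<dots> \<le> \<rho> * real n ^ 2 + \<rho> * real n ^ 2"
          using h(2) V by (simp add: kernel_approx_def)
        finally have "real (card (G - C)) \<le> \<rho> * real n ^ 2" by simp
        also have "\<dots> \<le> \<delta> * real n ^ 2" using \<rho> by (intro mult_right_mono) auto
        finally show ?thesis .
      qed
      ultimately show "\<exists>C\<in>\<C>. real (card (G - C)) \<le> \<delta> * real n ^ 2" by blast
    qed
  qed
qed

section \<open>Stability for graphs with few cliques\<close>

text \<open>Ordered pairs are counted, so for a symmetric \<open>P\<close> every edge inside a set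
  appears twice.\<close>

definition adj_sum :: "('a \<Rightarrow> 'a \<Rightarrow> bool) \<Rightarrow> 'a set \<Rightarrow> 'a set \<Rightarrow> real" where
  "adj_sum P A B = (\<Sum>u\<in>A. \<Sum>v\<in>B. of_bool (P u v))"

lemma adj_sum_nonneg [simp]: "0 \<le> adj_sum P A B"
  by (simp add: adj_sum_def sum_nonneg)

lemma adj_sum_le: "finite A \<Longrightarrow> finite B \<Longrightarrow> adj_sum P A B \<le> real (card A) * real (card B)"
proof -
  have "adj_sum P A B \<le> (\<Sum>u\<in>A. \<Sum>v\<in>B. 1)" unfolding adj_sum_def by (intro sum_mono) auto
  then show ?thesis by simp
qed

lemma adj_sum_commute: "(\<And>u v. P u v = P v u) \<Longrightarrow> adj_sum P A B = adj_sum P B A"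
  unfolding adj_sum_def by (subst sum.swap) simp

lemma adj_sum_cong:
  "(\<And>u v. u \<in> A \<Longrightarrow> v \<in> B \<Longrightarrow> P u v = Q u v) \<Longrightarrow> adj_sum P A B = adj_sum Q A B"
  unfolding adj_sum_def by (intro sum.cong) auto

lemma adj_sum_Un:
  assumes "finite A" "finite B" "A \<inter> B = {}"
  shows "adj_sum P (A \<union> B) (A \<union> B) = adj_sum P A A + adj_sum P A B + adj_sum P B A + adj_sum P B B"
  unfolding adj_sum_def sum.union_disjoint[OF assms] by (simp only: sum.distrib add.assoc)

text \<open>A clique tuple in the neighbourhood of \<open>v\<close> extends by \<open>v\<close> in
  the new last place, and the extended tuple determines both \<open>v\<close> and the old
  tuple.\<close>

lemma card_clique_tuples_Suc_ge:
  assumes X: "finite X"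
  shows "(\<Sum>v\<in>X. card (clique_tuples r {u\<in>X. P u v} P)) \<le> card (clique_tuples (Suc r) X P)"
proof -
  let ?S = "SIGMA v:X. clique_tuples r {u\<in>X. P u v} P"
  let ?f = "\<lambda>(v, x). x(r := v)"
  have S: "finite ?S" using X by (auto intro!: finite_clique_tuples)
  have "inj_on ?f ?S"
  proof (rule inj_onI, clarify)
    fix v x v' x' assume x: "x \<in> clique_tuples r {u\<in>X. P u v} P" "x' \<in> clique_tuples r {u\<in>X. P u v'} P"
      and eq: "x(r := v) = x'(r := v')"
    have v: "v = v'" using fun_cong[OF eq, of r] by simp
    have "x i = x' i" for i
    proof (cases "i < r")
      case True then show ?thesis using fun_cong[OF eq, of i] by simp
    next
      case False
      then have "x i = undefined" "x' i = undefined" using x by (auto simp: clique_tuples_def PiE_def extensional_def)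
      then show ?thesis by simp
    qed
    then show "v = v' \<and> x = x'" using v by blast
  qed
  moreover have "?f ` ?S \<subseteq> clique_tuples (Suc r) X P"
  proof clarify
    fix v x assume v: "v \<in> X" and x: "x \<in> clique_tuples r {u\<in>X. P u v} P"
    have mem: "x i \<in> X \<and> P (x i) v" if "i < r" for i
      using x that by (auto simp: clique_tuples_def PiE_def Pi_def)
    have "x(r := v) \<in> {..<Suc r} \<rightarrow>\<^sub>E X"
      using x v mem by (auto simp: clique_tuples_def PiE_def extensional_def less_Suc_eq)
    moreover have "P ((x(r := v)) i) ((x(r := v)) j)" if "i < j" "j < Suc r" for i j
      using x mem that by (cases "j = r") (auto simp: clique_tuples_def)
    ultimately show "x(r := v) \<in> clique_tuples (Suc r) X P" by (simp add: clique_tuples_def)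
  qed
  ultimately have "card ?S \<le> card (clique_tuples (Suc r) X P)"
    using card_inj_on_le[of ?f ?S] finite_clique_tuples[OF X] by blast
  then show ?thesis using X by (simp add: card_SigmaI finite_clique_tuples)
qed

lemma clique_tuples_mono: "X \<subseteq> Y \<Longrightarrow> clique_tuples r X P \<subseteq> clique_tuples r Y P"
  unfolding clique_tuples_def by (auto intro: PiE_mono[THEN subsetD])

lemma adj_sum_eq_card_clique_tuples:
  assumes X: "finite X"
  shows "adj_sum P X X \<le> real (card (clique_tuples 2 X P))"
proof -
  let ?S = "{(u, v) \<in> X \<times> X. P u v}"
  let ?f = "\<lambda>(u, v). (\<lambda>i\<in>{..<2::nat}. if i = 0 then u else v)"
  have "adj_sum P X X = real (card ?S)"
    unfolding adj_sum_def sum.cartesian_product using X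
    by (simp add: of_bool_def sum.If_cases case_prod_unfold Int_def mem_Times_iff)
  also have "card ?S \<le> card (clique_tuples 2 X P)"
  proof (rule card_inj_on_le[of ?f])
    show "inj_on ?f ?S"
    proof (rule inj_onI, clarify)
      fix u v u' v' assume eq: "(\<lambda>i\<in>{..<2::nat}. if i = 0 then u else v) = (\<lambda>i\<in>{..<2::nat}. if i = 0 then u' else v')"
      show "u = u' \<and> v = v'" using fun_cong[OF eq, of 0] fun_cong[OF eq, of 1] by simp
    qed
    show "?f ` ?S \<subseteq> clique_tuples 2 X P" by (auto simp: clique_tuples_def less_2_cases_iff split: if_splits)
  qed (use X in \<open>simp add: finite_clique_tuples\<close>)
  finally show ?thesis by simp
qed

text \<open>Up to the error, edges plus inner edges are at most the edges of the complete
  multipartite graph of the colouring. The second summand turns a Turan bound into stability: a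
  nearly extremal graph has few inner edges.\<close>

abbreviation stable_colouring ::
    "nat \<Rightarrow> nat \<Rightarrow> real \<Rightarrow> ('a \<Rightarrow> 'a \<Rightarrow> bool) \<Rightarrow> 'a set \<Rightarrow> ('a \<Rightarrow> nat) \<Rightarrow> bool" where
  "stable_colouring q n \<theta> P X f \<equiv> (\<forall>v. f v \<in> {1..q}) \<and>
    adj_sum P X X + adj_sum (\<lambda>u v. P u v \<and> f u = f v) X X \<le>
    adj_sum (\<lambda>u v. f u \<noteq> f v) X X + \<theta> * real n ^ 2"

text \<open>Fueredi's argument: colour the non-neighbours of a vertex of maximal degree with one
  colour and recurse into its neighbourhood. Vertices lying in too many cliques are discarded
  first, so that this neighbourhood again contains few cliques.\<close>

lemma few_cliques_stability:
  fixes \<theta> :: real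
  assumes "\<theta> > 0"
  shows "\<exists>\<delta>>0. \<forall>(X::'a set) P n. finite X \<longrightarrow> card X \<le> n \<longrightarrow>
    (\<forall>u v. P u v = P v u) \<longrightarrow> (\<forall>u. \<not> P u u) \<longrightarrow>
    real (card (clique_tuples (r + 2) X P)) \<le> \<delta> * real n ^ (r + 2) \<longrightarrow>
    (\<exists>f::'a \<Rightarrow> nat. stable_colouring (r + 1) n \<theta> P X f)"
  using assms
proof (induction r arbitrary: \<theta>)
  case 0
  show ?case
  proof (rule exI[of _ "\<theta> / 2"], intro conjI allI impI)
    fix X :: "'a set" and P n
    assume X: "finite X" "card X \<le> n"
      and few: "real (card (clique_tuples (0 + 2) X P)) \<le> \<theta> / 2 * real n ^ (0 + 2)"
    have "adj_sum P X X \<le> \<theta> / 2 * real n ^ 2"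
      using adj_sum_eq_card_clique_tuples[OF X(1), of P] few by (simp add: numeral_2_eq_2)
    then show "\<exists>f. stable_colouring (0 + 1) n \<theta> P X f"
      by (intro exI[of _ "\<lambda>_. 1"]) (simp add: adj_sum_def)
  qed (use 0 in auto)
next
  case (Suc r)
  obtain \<delta>' where \<delta>': "\<delta>' > 0" and IH: "\<And>(X::'a set) P n. finite X \<Longrightarrow> card X \<le> n \<Longrightarrow>
    (\<forall>u v. P u v = P v u) \<Longrightarrow> (\<forall>u. \<not> P u u) \<Longrightarrow>
    real (card (clique_tuples (r + 2) X P)) \<le> \<delta>' * real n ^ (r + 2) \<Longrightarrow>
    (\<exists>f::'a \<Rightarrow> nat. stable_colouring (r + 1) n (\<theta> / 2) P X f)"
    using Suc.IH[of "\<theta> / 2"] Suc.prems by auto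
  show ?case
  \<comment> \<open>Each bad vertex extends more than \<open>\<delta>' * n ^ (r + 2)\<close> smaller
    clique tuples to larger ones, so at most \<open>\<theta> / 8 * n\<close> vertices are bad.
    Discarding them changes an \<open>adj_sum\<close> by at most
    \<open>\<theta> / 4 * n ^ 2\<close>. This loss occurs twice, for all edges and for inner edges,
    on top of \<open>\<theta> / 2\<close> from the recursion.\<close>
  proof (rule exI[of _ "\<delta>' * \<theta> / 8"], intro conjI allI impI)
    show "\<delta>' * \<theta> / 8 > 0" using \<delta>' Suc.prems by simp
    fix X :: "'a set" and P n
    assume X: "finite X" "card X \<le> n" and sym: "\<forall>u v. P u v = P v u" and irr: "\<forall>u. \<not> P u u"
      and few: "real (card (clique_tuples (Suc r + 2) X P)) \<le> \<delta>' * \<theta> / 8 * real n ^ (Suc r + 2)"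
    define Bad where "Bad = {v\<in>X. \<delta>' * real n ^ (r + 2) < real (card (clique_tuples (r + 2) {u\<in>X. P u v} P))}"
    define Y where "Y = X - Bad"
    have fin: "finite Bad" "finite Y" using X by (auto simp: Bad_def Y_def)
    have XY: "X = Y \<union> Bad" "Y \<inter> Bad = {}" by (auto simp: Y_def Bad_def)
    have Yn: "real (card Y) \<le> real n" using X card_mono[of X Y] by (auto simp: Y_def)
    have Badn: "real (card Bad) \<le> \<theta> / 8 * real n"
    proof (cases "n = 0")
      case True then show ?thesis using X by (simp add: Bad_def)
    next
      case False
      have "real (card Bad) * (\<delta>' * real n ^ (r + 2)) \<le>
          (\<Sum>v\<in>Bad. real (card (clique_tuples (r + 2) {u\<in>X. P u v} P)))"
        using sum_mono[of Bad "\<lambda>_. \<delta>' * real n ^ (r + 2)"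
            "\<lambda>v. real (card (clique_tuples (r + 2) {u\<in>X. P u v} P))"]
        by (auto simp: Bad_def less_imp_le)
      also have "\<dots> \<le> (\<Sum>v\<in>X. real (card (clique_tuples (r + 2) {u\<in>X. P u v} P)))"
        using X by (intro sum_mono2) (auto simp: Bad_def)
      also have "\<dots> \<le> real (card (clique_tuples (Suc (r + 2)) X P))"
        unfolding of_nat_sum[symmetric] of_nat_le_iff by (rule card_clique_tuples_Suc_ge[OF X(1)])
      also have "\<dots> \<le> (\<theta> / 8 * real n) * (\<delta>' * real n ^ (r + 2))"
        using few by (simp add: mult_ac)
      finally show ?thesis using \<delta>' False by simp
    qed
    have Badn2: "real (card Bad) * real (card Y) + real (card Y) * real (card Bad)
        + real (card Bad) * real (card Bad) \<le> \<theta> / 4 * real n ^ 2"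
    proof -
      have "real (card Y) + real (card Bad) = real (card X)"
        using XY fin by (metis card_Un_disjoint of_nat_add)
      then have *: "real (card Y) + real (card Bad) \<le> real n" using X by simp
      have "real (card Bad) * real (card Y) + real (card Y) * real (card Bad)
        + real (card Bad) * real (card Bad) \<le> real (card Bad) * (2 * (real (card Y) + real (card Bad)))"
        by (simp add: algebra_simps)
      also have "\<dots> \<le> (\<theta> / 8 * real n) * (2 * real n)"
        using * Badn Suc.prems by (intro mult_mono) auto
      finally show ?thesis by (simp add: power2_eq_square)
    qed
    have reduce: "adj_sum Q X X \<le> adj_sum Q Y Y + \<theta> / 4 * real n ^ 2" for Q
    proof -
      have "adj_sum Q X X = adj_sum Q Y Y + adj_sum Q Y Bad + adj_sum Q Bad Y + adj_sum Q Bad Bad"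
        unfolding XY(1) by (rule adj_sum_Un) (use fin XY in auto)
      also have "\<dots> \<le> adj_sum Q Y Y + real (card Y) * real (card Bad)
          + real (card Bad) * real (card Y) + real (card Bad) * real (card Bad)"
        by (intro add_mono order_refl adj_sum_le fin)
      finally show ?thesis using Badn2 by linarith
    qed
    have mono_Y: "adj_sum Q Y Y \<le> adj_sum Q X X" for Q
      unfolding XY(1) by (subst adj_sum_Un) (use fin XY in auto)
    have "\<exists>f. stable_colouring (Suc r + 1) n (\<theta> / 2) P Y f"
    proof (cases "Y = {}")
      case True
      then show ?thesis using Suc.prems by (intro exI[of _ "\<lambda>_. 1"]) (simp add: adj_sum_def)
    next
      case False
      define d where "d v = card {u\<in>Y. P u v}" for v
      obtain x where x0: "x \<in> Y" "Max (d ` Y) = d x"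
        using fin(2) False by (auto intro: obtains_MAX[of Y d])
      have x: "x \<in> Y" "d v \<le> d x" if "v \<in> Y" for v
        unfolding x0(2)[symmetric] using x0(1) that fin by auto
      define N where "N = {u\<in>Y. P u x}"
      define W where "W = Y - N"
      have NW: "Y = W \<union> N" "W \<inter> N = {}" "finite N" "finite W"
        using fin by (auto simp: W_def N_def)
      have "clique_tuples (r + 2) N P \<subseteq> clique_tuples (r + 2) {u\<in>X. P u x} P"
        by (rule clique_tuples_mono) (auto simp: N_def Y_def)
      then have "card (clique_tuples (r + 2) N P) \<le> card (clique_tuples (r + 2) {u\<in>X. P u x} P)"
        using X by (intro card_mono finite_clique_tuples) auto
      moreover have "real (card (clique_tuples (r + 2) {u\<in>X. P u x} P)) \<le> \<delta>' * real n ^ (r + 2)"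
        using x0(1) by (auto simp: Y_def Bad_def)
      ultimately have "real (card (clique_tuples (r + 2) N P)) \<le> \<delta>' * real n ^ (r + 2)"
        by linarith
      moreover have "card N \<le> n" using Yn card_mono[OF fin(2), of N] by (auto simp: N_def)
      ultimately obtain f where f: "\<forall>v. f v \<in> {1..r + 1}"
        "adj_sum P N N + adj_sum (\<lambda>u v. P u v \<and> f u = f v) N N \<le>
         adj_sum (\<lambda>u v. f u \<noteq> f v) N N + \<theta> / 2 * real n ^ 2"
        using IH[OF NW(3) _ sym irr, of n] by auto
      define F where "F v = (if v \<in> N then f v else r + 2)" for v
      have F: "F u = f u" if "u \<in> N" for u using that by (simp add: F_def)
      have F': "F u = r + 2" if "u \<in> W" for u using that by (simp add: F_def W_def)
      have fr: "f u \<noteq> r + 2" "r + 2 \<noteq> f u" for u using f(1)[rule_format, of u] by auto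
      \<comment> \<open>Vertices of \<open>W\<close> have degree at most that of \<open>x\<close>,
        which is \<open>card N\<close>. Doubled, this bounds all pairs meeting \<open>W\<close>
        together with the second copy of the pairs inside \<open>W\<close> that comes from the inner
        edges; the bound \<open>2 * card W * card N\<close> is exactly what \<open>W\<close> adds to
        the multipartite count.\<close>
      have deg: "adj_sum P W W + adj_sum P W N \<le> real (card W) * real (card N)"
      proof -
        have "adj_sum P W W + adj_sum P W N = (\<Sum>u\<in>W. \<Sum>v\<in>Y. of_bool (P u v))"
          unfolding adj_sum_def NW(1) sum.union_disjoint[OF NW(4,3,2)] by (simp only: sum.distrib)
        also have "\<dots> = (\<Sum>u\<in>W. real (d u))"
          unfolding d_def using fin sym by (simp add: of_bool_def sum.If_cases Int_def)
        also have "\<dots> \<le> (\<Sum>u\<in>W. real (card N))"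
          using x(2) by (intro sum_mono) (auto simp: N_def d_def W_def)
        finally show ?thesis by simp
      qed
      have P: "adj_sum P Y Y = adj_sum P W W + 2 * adj_sum P W N + adj_sum P N N"
        unfolding NW(1) using adj_sum_Un[OF NW(4,3,2), of P] adj_sum_commute[of P N W] sym by simp
      have inner: "adj_sum (\<lambda>u v. P u v \<and> F u = F v) Y Y = adj_sum P W W +
          adj_sum (\<lambda>u v. P u v \<and> f u = f v) N N"
      proof -
        have "adj_sum (\<lambda>u v. P u v \<and> F u = F v) W W = adj_sum P W W"
          by (rule adj_sum_cong) (simp add: F')
        moreover have "adj_sum (\<lambda>u v. P u v \<and> F u = F v) N N = adj_sum (\<lambda>u v. P u v \<and> f u = f v) N N"
          by (rule adj_sum_cong) (simp add: F)
        moreover have "adj_sum (\<lambda>u v. P u v \<and> F u = F v) N W = adj_sum (\<lambda>_ _. False) N W"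
          by (rule adj_sum_cong) (use fr in \<open>simp add: F F'\<close>)
        moreover have "adj_sum (\<lambda>u v. P u v \<and> F u = F v) W N = adj_sum (\<lambda>_ _. False) W N"
          by (rule adj_sum_cong) (use fr in \<open>simp add: F F'\<close>)
        ultimately show ?thesis unfolding NW(1) adj_sum_Un[OF NW(4,3,2)] by (simp add: adj_sum_def)
      qed
      have cross: "adj_sum (\<lambda>u v. F u \<noteq> F v) Y Y = 2 * (real (card W) * real (card N)) +
          adj_sum (\<lambda>u v. f u \<noteq> f v) N N"
      proof -
        have "adj_sum (\<lambda>u v. F u \<noteq> F v) W W = adj_sum (\<lambda>_ _. False) W W"
          by (rule adj_sum_cong) (simp add: F')
        moreover have "adj_sum (\<lambda>u v. F u \<noteq> F v) N N = adj_sum (\<lambda>u v. f u \<noteq> f v) N N"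
          by (rule adj_sum_cong) (simp add: F)
        moreover have "adj_sum (\<lambda>u v. F u \<noteq> F v) N W = adj_sum (\<lambda>_ _. True) N W"
          by (rule adj_sum_cong) (use fr in \<open>simp add: F F'\<close>)
        moreover have "adj_sum (\<lambda>u v. F u \<noteq> F v) W N = adj_sum (\<lambda>_ _. True) W N"
          by (rule adj_sum_cong) (use fr in \<open>simp add: F F'\<close>)
        ultimately show ?thesis unfolding NW(1) adj_sum_Un[OF NW(4,3,2)] by (simp add: adj_sum_def)
      qed
      have "adj_sum P Y Y + adj_sum (\<lambda>u v. P u v \<and> F u = F v) Y Y \<le>
        adj_sum (\<lambda>u v. F u \<noteq> F v) Y Y + \<theta> / 2 * real n ^ 2"
        using P inner cross deg f(2) by linarith
      moreover have "\<forall>v. F v \<in> {1..Suc r + 1}" using f(1) by (auto simp: F_def intro: le_SucI)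
      ultimately show ?thesis by blast
    qed
    then obtain f where f: "\<forall>v. f v \<in> {1..Suc r + 1}" "adj_sum P Y Y + adj_sum (\<lambda>u v. P u v \<and> f u = f v) Y Y \<le>
      adj_sum (\<lambda>u v. f u \<noteq> (f v :: nat)) Y Y + \<theta> / 2 * real n ^ 2" by blast
    have "adj_sum P X X + adj_sum (\<lambda>u v. P u v \<and> f u = f v) X X \<le>
      adj_sum (\<lambda>u v. f u \<noteq> f v) X X + \<theta> * real n ^ 2"
      using f(2) reduce[of P] reduce[of "\<lambda>u v. P u v \<and> f u = f v"] mono_Y[of "\<lambda>u v. f u \<noteq> f v"]
      by linarith
    with f(1) show "\<exists>f. stable_colouring (Suc r + 1) n \<theta> P X f" by blast
  qed
qed

section \<open>Counting subsets\<close>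

lemma sum_Pow_prod:
  fixes f :: "'a \<Rightarrow> real"
  assumes "finite X"
  shows "(\<Sum>A\<in>Pow X. \<Prod>x\<in>A. f x) = (\<Prod>x\<in>X. f x + 1)"
  using prod_add[OF assms, of f "\<lambda>_. 1"] by simp

text \<open>Exponential weights replace an estimate of binomial sums: a set \<open>A\<close> gets
  weight \<open>exp (- a) ^ card A\<close>, the total weight is
  \<open>(exp (- a) + 1) ^ card X\<close>, and small sets have weight close to 1.\<close>

lemma card_small_subsets_le_exp:
  fixes \<theta> :: real
  assumes \<theta>: "\<theta> > 0"
  shows "\<exists>\<kappa>>0. \<forall>(X::'a set) m. finite X \<longrightarrow> real (card X) \<le> m \<longrightarrow>
    real (card {A. A \<subseteq> X \<and> real (card A) \<le> \<kappa> * m}) \<le> exp (\<theta> * m)"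
proof -
  \<comment> \<open>With this \<open>a\<close> the total weight is at most
    \<open>exp (\<theta> / 2 * m)\<close>. The choice \<open>\<theta> / (2 * a)\<close> for the size
    bound then makes every small set weigh at least \<open>exp (- \<theta> / 2 * m)\<close>. The
    maximum keeps \<open>a\<close> positive.\<close>
  define a where "a = max 1 (- ln (\<theta> / 2))"
  have a: "a > 0" "exp (- a) \<le> \<theta> / 2"
  proof -
    have "- a \<le> ln (\<theta> / 2)" by (simp add: a_def)
    then have "exp (- a) \<le> exp (ln (\<theta> / 2))" by (simp only: exp_le_cancel_iff)
    then show "exp (- a) \<le> \<theta> / 2" using \<theta> by simp
  qed (simp add: a_def)
  show ?thesis
  proof (rule exI[of _ "\<theta> / (2 * a)"], intro conjI allI impI)
    fix X :: "'a set" and m assume X: "finite X" "real (card X) \<le> m"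
    let ?F = "{A. A \<subseteq> X \<and> real (card A) \<le> \<theta> / (2 * a) * m}"
    have fin: "finite ?F" using X by (intro finite_subset[of ?F "Pow X"]) auto
    have "real (card ?F) * exp (- (\<theta> / 2 * m)) \<le> (\<Sum>A\<in>?F. exp (- a) ^ card A)"
    proof -
      have "exp (- (\<theta> / 2 * m)) \<le> exp (- a) ^ card A" if "A \<in> ?F" for A
      proof -
        have "a * real (card A) \<le> a * (\<theta> / (2 * a) * m)" using that a by (intro mult_left_mono) auto
        also have "\<dots> = \<theta> / 2 * m" using a by simp
        finally show ?thesis by (simp flip: exp_of_nat_mult add: mult.commute)
      qed
      then have "(\<Sum>A\<in>?F. exp (- (\<theta> / 2 * m))) \<le> (\<Sum>A\<in>?F. exp (- a) ^ card A)"
        by (rule sum_mono)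
      then show ?thesis by simp
    qed
    also have "\<dots> \<le> (\<Sum>A\<in>Pow X. exp (- a) ^ card A)"
      using X by (intro sum_mono2) auto
    also have "\<dots> = (exp (- a) + 1) ^ card X"
      using sum_Pow_prod[OF X(1), of "\<lambda>_. exp (- a)"] by simp
    also have "\<dots> \<le> exp (\<theta> / 2) ^ card X"
    proof (rule power_mono)
      show "exp (- a) + 1 \<le> exp (\<theta> / 2)" using exp_ge_add_one_self[of "\<theta> / 2"] a by linarith
    qed (simp add: add_nonneg_nonneg)
    also have "\<dots> = exp (real (card X) * (\<theta> / 2))" by (rule exp_of_nat_mult[symmetric])
    also have "\<dots> \<le> exp (\<theta> / 2 * m)" using mult_right_mono[OF X(2), of "\<theta> / 2"] \<theta> by (simp add: mult.commute)
    finally have "real (card ?F) * exp (- (\<theta> / 2 * m)) * exp (\<theta> / 2 * m) \<le> exp (\<theta> / 2 * m) * exp (\<theta> / 2 * m)"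
      by (intro mult_right_mono) auto
    then show "real (card ?F) \<le> exp (\<theta> * m)"
      by (simp add: mult.assoc flip: exp_add)
  qed (use \<theta> a in auto)
qed

text \<open>Up to the factor 2 this bounds the moment generating function of a fair bit. Negative
  \<open>t\<close> reduces to \<open>- t\<close> by taking out \<open>exp t\<close>.\<close>

lemma one_plus_exp_le:
  fixes t :: real
  assumes "\<bar>t\<bar> \<le> 1"
  shows "exp t + 1 \<le> 2 * exp (t / 2 + t\<^sup>2 / 2)"
proof -
  have pos: "exp s + 1 \<le> 2 * exp (s / 2 + s\<^sup>2 / 2)" if "0 \<le> s" "s \<le> 1" for s :: real
    using exp_bound[OF that] exp_ge_add_one_self[of "s / 2 + s\<^sup>2 / 2"] by linarith
  show ?thesis
  proof (cases "t \<ge> 0")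
    case False
    have "exp t + 1 = exp t * (exp (- t) + 1)" by (simp add: distrib_left flip: exp_add)
    also have "\<dots> \<le> exp t * (2 * exp (- t / 2 + t\<^sup>2 / 2))"
      using pos[of "- t"] False assms by (intro mult_left_mono) auto
    also have "\<dots> = 2 * exp (t / 2 + t\<^sup>2 / 2)"
      by (simp add: field_simps flip: exp_add)
    finally show ?thesis .
  qed (use pos[of t] assms in auto)
qed

text \<open>Chernoff's argument with parameter \<open>\<sigma> * \<epsilon>\<close>. The deviation
  is measured against \<open>m\<close> instead of \<open>card Y\<close>, so that one bound serves
  all rectangles at once, including thin ones.\<close>

lemma card_subsets_deviation_one_sided:
  fixes \<epsilon> m \<sigma> :: real
  assumes X: "finite X" and Y: "Y \<subseteq> X" "real (card Y) \<le> m"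
    and \<epsilon>: "0 < \<epsilon>" "\<epsilon> \<le> 1" and \<sigma>: "\<bar>\<sigma>\<bar> = 1"
  shows "real (card {A. A \<subseteq> X \<and> \<sigma> * (real (card (A \<inter> Y)) - real (card Y) / 2) \<ge> \<epsilon> * m}) \<le>
    2 ^ card X * exp (- (\<epsilon>\<^sup>2 * m / 2))"
proof -
  define t where "t = \<sigma> * \<epsilon>"
  define y where "y = real (card Y)"
  let ?F = "{A. A \<subseteq> X \<and> \<sigma> * (real (card (A \<inter> Y)) - y / 2) \<ge> \<epsilon> * m}"
  have finY: "finite Y" using X Y finite_subset by blast
  have t: "\<bar>t\<bar> \<le> 1" "t\<^sup>2 = \<epsilon>\<^sup>2" using \<epsilon> \<sigma> by (auto simp: t_def abs_mult power_mult_distrib) (metis \<sigma> power2_abs one_power2)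
  have "real (card ?F) * exp (\<epsilon>\<^sup>2 * m + t * y / 2) \<le> (\<Sum>A\<in>?F. \<Prod>x\<in>A. if x \<in> Y then exp t else 1)"
  proof -
    have "exp (\<epsilon>\<^sup>2 * m + t * y / 2) \<le> (\<Prod>x\<in>A. if x \<in> Y then exp t else 1)" if A: "A \<in> ?F" for A
    proof -
      have finA: "finite A" using A X finite_subset by auto
      have "\<epsilon> * (\<epsilon> * m) \<le> \<epsilon> * (\<sigma> * (real (card (A \<inter> Y)) - y / 2))"
        using A \<epsilon> by (intro mult_left_mono) auto
      then have "\<epsilon>\<^sup>2 * m + t * y / 2 \<le> real (card (A \<inter> Y)) * t"
        by (simp add: t_def power2_eq_square algebra_simps)
      then have "exp (\<epsilon>\<^sup>2 * m + t * y / 2) \<le> exp t ^ card (A \<inter> Y)"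
        by (simp flip: exp_of_nat_mult)
      also have "\<dots> = (\<Prod>x\<in>A. if x \<in> Y then exp t else 1)"
        using finA by (simp add: prod.If_cases Int_def)
      finally show ?thesis .
    qed
    then have "(\<Sum>A\<in>?F. exp (\<epsilon>\<^sup>2 * m + t * y / 2)) \<le> (\<Sum>A\<in>?F. \<Prod>x\<in>A. if x \<in> Y then exp t else 1)"
      by (rule sum_mono)
    then show ?thesis by simp
  qed
  also have "\<dots> \<le> (\<Sum>A\<in>Pow X. \<Prod>x\<in>A. if x \<in> Y then exp t else 1)"
    using X by (intro sum_mono2) (auto intro!: prod_nonneg)
  also have "\<dots> = (\<Prod>x\<in>X. (if x \<in> Y then exp t else 1) + 1)" by (rule sum_Pow_prod[OF X])
  also have "\<dots> \<le> (\<Prod>x\<in>X. 2 * (if x \<in> Y then exp (t / 2 + t\<^sup>2 / 2) else 1))"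
    using one_plus_exp_le[OF t(1)] by (intro prod_mono) (auto intro: add_nonneg_nonneg)
  also have "\<dots> = 2 ^ card X * exp (t / 2 + t\<^sup>2 / 2) ^ card Y"
    using X Y by (simp add: prod.distrib prod.If_cases Int_absorb1)
  also have "exp (t / 2 + t\<^sup>2 / 2) ^ card Y = exp (t * y / 2 + \<epsilon>\<^sup>2 * y / 2)"
    unfolding y_def t(2) exp_of_nat_mult[symmetric] by (simp add: algebra_simps)
  also have "\<dots> \<le> exp (t * y / 2 + \<epsilon>\<^sup>2 * m / 2)"
    using Y(2) \<epsilon> by (auto simp: y_def intro!: mult_left_mono)
  finally have "real (card ?F) * exp (\<epsilon>\<^sup>2 * m + t * y / 2) \<le> 2 ^ card X * exp (t * y / 2 + \<epsilon>\<^sup>2 * m / 2)"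
    by simp
  then have "real (card ?F) * exp (\<epsilon>\<^sup>2 * m + t * y / 2) * exp (- (\<epsilon>\<^sup>2 * m + t * y / 2)) \<le>
      2 ^ card X * exp (t * y / 2 + \<epsilon>\<^sup>2 * m / 2) * exp (- (\<epsilon>\<^sup>2 * m + t * y / 2))"
    by (intro mult_right_mono) auto
  then show ?thesis by (simp add: mult.assoc mult.commute[of m] y_def flip: exp_add)
qed

lemma card_subsets_deviation:
  fixes \<epsilon> m :: real
  assumes X: "finite X" and Y: "Y \<subseteq> X" "real (card Y) \<le> m" and \<epsilon>: "0 < \<epsilon>" "\<epsilon> \<le> 1"
  shows "real (card {A. A \<subseteq> X \<and> \<bar>real (card (A \<inter> Y)) - real (card Y) / 2\<bar> \<ge> \<epsilon> * m}) \<le>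
    2 * 2 ^ card X * exp (- (\<epsilon>\<^sup>2 * m / 2))"
proof -
  let ?F = "\<lambda>\<sigma>. {A. A \<subseteq> X \<and> \<sigma> * (real (card (A \<inter> Y)) - real (card Y) / 2) \<ge> \<epsilon> * m}"
  have fin: "finite (?F \<sigma>)" for \<sigma> using X by (intro finite_subset[of "?F \<sigma>" "Pow X"]) auto
  have "{A. A \<subseteq> X \<and> \<bar>real (card (A \<inter> Y)) - real (card Y) / 2\<bar> \<ge> \<epsilon> * m} \<subseteq> ?F 1 \<union> ?F (-1)"
    by (auto simp: abs_if split: if_splits)
  then have "card {A. A \<subseteq> X \<and> \<bar>real (card (A \<inter> Y)) - real (card Y) / 2\<bar> \<ge> \<epsilon> * m} \<le> card (?F 1 \<union> ?F (-1))"
    using finite_UnI[OF fin[of 1] fin[of "-1"]] by (intro card_mono)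
  also have "\<dots> \<le> card (?F 1) + card (?F (-1))" by (rule card_Un_le)
  finally have "real (card {A. A \<subseteq> X \<and> \<bar>real (card (A \<inter> Y)) - real (card Y) / 2\<bar> \<ge> \<epsilon> * m}) \<le>
    real (card (?F 1)) + real (card (?F (-1)))" by linarith
  also have "\<dots> \<le> 2 ^ card X * exp (- (\<epsilon>\<^sup>2 * m / 2)) + 2 ^ card X * exp (- (\<epsilon>\<^sup>2 * m / 2))"
    by (intro add_mono card_subsets_deviation_one_sided assms) auto
  finally show ?thesis by simp
qed


section \<open>Vertex colourings\<close>

definition all_edges :: "nat \<Rightarrow> ugraph" where
  "all_edges n = {e. e \<subseteq> {1..n} \<and> card e = 2}"

definition inner_edges :: "nat \<Rightarrow> (nat \<Rightarrow> nat) \<Rightarrow> ugraph" where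
  "inner_edges n f = {e \<in> all_edges n. \<exists>i. \<forall>v\<in>e. f v = i}"

definition cross_edges :: "nat \<Rightarrow> (nat \<Rightarrow> nat) \<Rightarrow> ugraph" where
  "cross_edges n f = all_edges n - inner_edges n f"

definition colour_class :: "nat \<Rightarrow> (nat \<Rightarrow> nat) \<Rightarrow> nat \<Rightarrow> nat set" where
  "colour_class n f i = {v \<in> {1..n}. f v = i}"

lemma graphs_on_iff: "G \<in> graphs_on n \<longleftrightarrow> G \<subseteq> all_edges n"
  by (simp add: graphs_on_def all_edges_def)

lemma finite_all_edges [simp]: "finite (all_edges n)"
  by (rule finite_subset[of _ "Pow {1..n}"]) (auto simp: all_edges_def)

lemma finite_graph: "G \<in> graphs_on n \<Longrightarrow> finite G"
  unfolding graphs_on_iff by (rule finite_subset) auto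

lemma finite_inner_edges [simp]: "finite (inner_edges n f)"
  by (rule finite_subset[OF _ finite_all_edges[of n]]) (auto simp: inner_edges_def)

lemma finite_cross_edges [simp]: "finite (cross_edges n f)"
  by (simp add: cross_edges_def)

lemma doubleton_in_all_edges: "{u, v} \<in> all_edges n \<longleftrightarrow> u \<in> {1..n} \<and> v \<in> {1..n} \<and> u \<noteq> v"
  by (auto simp: all_edges_def card_2_iff')

lemma doubleton_in_inner_edges:
  "{u, v} \<in> inner_edges n f \<longleftrightarrow> u \<in> {1..n} \<and> v \<in> {1..n} \<and> u \<noteq> v \<and> f u = f v"
  by (auto simp: inner_edges_def doubleton_in_all_edges)

lemma doubleton_in_cross_edges:
  "{u, v} \<in> cross_edges n f \<longleftrightarrow> u \<in> {1..n} \<and> v \<in> {1..n} \<and> f u \<noteq> f v"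
  by (auto simp: cross_edges_def doubleton_in_inner_edges doubleton_in_all_edges)

section \<open>Edge counts of complete multipartite graphs\<close>

lemma twice_card_edges:
  assumes "F \<subseteq> all_edges n"
  shows "2 * real (card F) = adj_sum (\<lambda>u v. {u, v} \<in> F) {1..n} {1..n}"
  unfolding adj_sum_def using assms by (subst sum_adj_eq_twice_card) (auto simp: all_edges_def)

lemma card_all_edges_le: "real (card (all_edges n)) \<le> real n ^ 2"
proof -
  have "2 * real (card (all_edges n)) \<le> real (card {1..n}) * real (card {1..n})"
    unfolding twice_card_edges[OF order_refl] by (rule adj_sum_le) auto
  then show ?thesis by (simp add: power2_eq_square)
qed

lemma twice_card_cross_edges:
  "2 * real (card (cross_edges n f)) = (\<Sum>u\<in>{1..n}. real n - real (card (colour_class n f (f u))))"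
proof -
  have "2 * real (card (cross_edges n f)) = adj_sum (\<lambda>u v. {u, v} \<in> cross_edges n f) {1..n} {1..n}"
    by (rule twice_card_edges) (auto simp: cross_edges_def)
  also have "\<dots> = adj_sum (\<lambda>u v. f u \<noteq> f v) {1..n} {1..n}"
    by (rule adj_sum_cong) (auto simp: doubleton_in_cross_edges)
  also have "\<dots> = (\<Sum>u\<in>{1..n}. real n - real (card (colour_class n f (f u))))"
    unfolding adj_sum_def
  proof (rule sum.cong[OF refl])
    fix u
    have "(\<Sum>v\<in>{1..n}. of_bool (f u \<noteq> f v)) = (\<Sum>v\<in>{1..n}. 1 - (if f v = f u then 1 else (0::real)))"
      by (rule sum.cong) auto
    also have "\<dots> = real n - real (card (colour_class n f (f u)))"
      by (simp add: sum_subtractf sum.If_cases colour_class_def Int_def)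
    finally show "(\<Sum>v\<in>{1..n}. of_bool (f u \<noteq> f v)) = real n - real (card (colour_class n f (f u)))" .
  qed
  finally show ?thesis .
qed

text \<open>An identity and not just Turan's bound: the subtracted squares measure how unbalanced
  the colouring is, and this deficit is used quantitatively when unstructured graphs are
  counted.\<close>

lemma card_cross_edges:
  assumes f: "\<forall>v. f v \<in> {1..q}" and q: "q > 0"
  shows "2 * real (card (cross_edges n f)) = real n ^ 2 * (1 - 1 / real q)
    - (\<Sum>i\<in>{1..q}. (real (card (colour_class n f i)) - real n / real q)\<^sup>2)"
proof -
  let ?a = "\<lambda>i. real (card (colour_class n f i))"
  have "2 * real (card (cross_edges n f)) = (\<Sum>u\<in>{1..n}. real n - ?a (f u))"
    by (rule twice_card_cross_edges)
  also have "\<dots> = (\<Sum>i\<in>{1..q}. \<Sum>u\<in>{u\<in>{1..n}. f u = i}. real n - ?a (f u))"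
    by (rule sum.group[symmetric]) (use f in auto)
  also have "\<dots> = (\<Sum>i\<in>{1..q}. \<Sum>u\<in>colour_class n f i. real n - ?a i)"
    by (intro sum.cong) (auto simp: colour_class_def)
  also have "\<dots> = (\<Sum>i\<in>{1..q}. real n * ?a i - (?a i)\<^sup>2)"
    by (simp add: power2_eq_square algebra_simps)
  finally have 1: "2 * real (card (cross_edges n f)) = (\<Sum>i\<in>{1..q}. real n * ?a i - (?a i)\<^sup>2)" .
  have tot: "(\<Sum>i\<in>{1..q}. ?a i) = real n"
  proof -
    have "(\<Sum>i\<in>{1..q}. ?a i) = (\<Sum>i\<in>{1..q}. \<Sum>u\<in>{u\<in>{1..n}. f u = i}. 1)"
      by (simp add: colour_class_def)
    also have "\<dots> = (\<Sum>u\<in>{1..n}. 1)" by (rule sum.group) (use f in auto)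
    finally show ?thesis by simp
  qed
  have "(\<Sum>i\<in>{1..q}. (?a i - real n / real q)\<^sup>2) =
    (\<Sum>i\<in>{1..q}. (?a i)\<^sup>2 - 2 * (real n / real q) * ?a i + (real n / real q)\<^sup>2)"
    by (intro sum.cong) (auto simp: power2_diff)
  also have "\<dots> = (\<Sum>i\<in>{1..q}. (?a i)\<^sup>2) - 2 * (real n / real q) * real n + real q * (real n / real q)\<^sup>2"
    by (simp only: sum.distrib sum_subtractf sum_distrib_left[symmetric] tot) simp
  also have "\<dots> = (\<Sum>i\<in>{1..q}. (?a i)\<^sup>2) - real n ^ 2 / real q"
    using q by (simp add: power2_eq_square)
  finally show ?thesis
    unfolding 1 sum_subtractf sum_distrib_left[symmetric] tot using q
    by (simp add: power2_eq_square algebra_simps)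
qed

abbreviation coloured_containers ::
    "nat \<Rightarrow> nat \<Rightarrow> nat \<Rightarrow> real \<Rightarrow> real \<Rightarrow> ugraph set \<Rightarrow> bool" where
  "coloured_containers n k q \<delta> \<gamma> \<C> \<equiv> finite \<C> \<and> card \<C> \<le> 4 ^ ((n + 1) * k) \<and> \<C> \<subseteq> graphs_on n \<and>
    (\<forall>C\<in>\<C>. \<exists>f. (\<forall>v. f v \<in> {1..q}) \<and>
      real (card C) + real (card (C \<inter> inner_edges n f)) \<le> real (card (cross_edges n f)) + \<delta> * real n ^ 2) \<and>
    (\<forall>G\<in>graphs_on n. few_cliques n (q + 1) \<gamma> G \<longrightarrow>
      (\<exists>C\<in>\<C>. real (card (G - C)) \<le> \<delta> * real n ^ 2))"

text \<open>The stability lemma is applied to the containers, not to the graphs, so every graph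
  assigned to a container inherits the same colouring.\<close>

lemma coloured_container_family:
  fixes \<delta> :: real
  assumes \<delta>: "\<delta> > 0" and q: "q \<ge> 1"
  shows "\<exists>\<gamma>>0. \<exists>k::nat. \<forall>n. \<exists>\<C>. coloured_containers n k q \<delta> \<gamma> \<C>"
proof -
  have q2: "q - 1 + 2 = q + 1" "q - 1 + 1 = q" using q by auto
  \<comment> \<open>Twice \<open>\<delta>\<close>, because \<open>adj_sum\<close> counts each edge
    in both orders.\<close>
  have d2: "2 * \<delta> > 0" using \<delta> by simp
  obtain \<delta>' where \<delta>': "\<delta>' > 0" and stab: "\<And>(X::nat set) P n. finite X \<Longrightarrow> card X \<le> n \<Longrightarrow>
    (\<forall>u v. P u v = P v u) \<Longrightarrow> (\<forall>u. \<not> P u u) \<Longrightarrow>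
    real (card (clique_tuples (q + 1) X P)) \<le> \<delta>' * real n ^ (q + 1) \<Longrightarrow>
    (\<exists>f::nat \<Rightarrow> nat. stable_colouring q n (2 * \<delta>) P X f)"
    using few_cliques_stability[OF d2, of "q - 1", where ?'a = nat, unfolded q2] by auto
  \<comment> \<open>One parameter has to bound both the escaping edges, by \<open>\<delta>\<close>,
    and the cliques of the container, by the \<open>\<delta>'\<close> that stability
    requires.\<close>
  define d where "d = min \<delta> \<delta>'"
  have d: "d > 0" using \<delta> \<delta>' by (simp add: d_def)
  obtain \<gamma> k where \<gamma>: "\<gamma> > 0" and fam: "\<And>n. \<exists>\<C>. containers n k (q + 1) d \<gamma> \<C>"
    using container_family[OF d, of "q + 1"] by blast
  show ?thesis
  proof (rule exI[of _ \<gamma>], intro conjI \<gamma>, rule exI[of _ k], rule allI)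
    fix n
    obtain \<C> where C: "finite \<C>" "card \<C> \<le> 4 ^ ((n + 1) * k)" "\<C> \<subseteq> graphs_on n"
      "\<And>C. C \<in> \<C> \<Longrightarrow> real (card (clique_tuples (q + 1) {1..n} (\<lambda>u v. {u, v} \<in> C))) \<le> d * real n ^ (q + 1)"
      "\<And>G. G\<in>graphs_on n \<Longrightarrow> few_cliques n (q + 1) \<gamma> G \<Longrightarrow>
      (\<exists>C\<in>\<C>. real (card (G - C)) \<le> d * real n ^ 2)"
      using fam[of n] by blast
    have col: "\<exists>f. (\<forall>v. f v \<in> {1..q}) \<and>
      real (card C) + real (card (C \<inter> inner_edges n f)) \<le> real (card (cross_edges n f)) + \<delta> * real n ^ 2"
      if "C \<in> \<C>" for C
    proof -
      have Cn: "C \<subseteq> all_edges n" using that C(3) graphs_on_iff by auto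
      have "d * real n ^ (q + 1) \<le> \<delta>' * real n ^ (q + 1)" by (intro mult_right_mono) (auto simp: d_def)
      then have few: "real (card (clique_tuples (q + 1) {1..n} (\<lambda>u v. {u, v} \<in> C))) \<le> \<delta>' * real n ^ (q + 1)"
        using C(4)[OF that] by linarith
      have sym: "\<forall>u v. ({u, v} \<in> C) = ({v, u} \<in> C)" by (simp add: insert_commute)
      have irr: "\<forall>u. {u, u} \<notin> C" using Cn by (auto simp: all_edges_def)
      obtain f where f: "\<forall>v. f v \<in> {1..q}"
        "adj_sum (\<lambda>u v. {u, v} \<in> C) {1..n} {1..n} + adj_sum (\<lambda>u v. {u, v} \<in> C \<and> f u = f v) {1..n} {1..n} \<le>
         adj_sum (\<lambda>u v. f u \<noteq> f v) {1..n} {1..n} + 2 * \<delta> * real n ^ 2"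
        using stab[OF _ _ sym irr few] by auto
      have "adj_sum (\<lambda>u v. {u, v} \<in> C) {1..n} {1..n} = 2 * real (card C)"
        by (rule twice_card_edges[OF Cn, symmetric])
      moreover have "adj_sum (\<lambda>u v. {u, v} \<in> C \<and> f u = f v) {1..n} {1..n} = 2 * real (card (C \<inter> inner_edges n f))"
      proof -
        have "2 * real (card (C \<inter> inner_edges n f)) = adj_sum (\<lambda>u v. {u, v} \<in> C \<inter> inner_edges n f) {1..n} {1..n}"
          using Cn by (intro twice_card_edges) auto
        also have "\<dots> = adj_sum (\<lambda>u v. {u, v} \<in> C \<and> f u = f v) {1..n} {1..n}"
          by (rule adj_sum_cong) (use irr in \<open>auto simp: doubleton_in_inner_edges\<close>)
        finally show ?thesis by simp
      qed
      moreover have "adj_sum (\<lambda>u v. f u \<noteq> f v) {1..n} {1..n} = 2 * real (card (cross_edges n f))"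
      proof -
        have "2 * real (card (cross_edges n f)) = adj_sum (\<lambda>u v. {u, v} \<in> cross_edges n f) {1..n} {1..n}"
          by (intro twice_card_edges) (auto simp: cross_edges_def)
        also have "\<dots> = adj_sum (\<lambda>u v. f u \<noteq> f v) {1..n} {1..n}"
          by (rule adj_sum_cong) (auto simp: doubleton_in_cross_edges)
        finally show ?thesis by simp
      qed
      ultimately show ?thesis using f by (intro exI[of _ f]) auto
    qed
    have appr: "\<exists>C\<in>\<C>. real (card (G - C)) \<le> \<delta> * real n ^ 2"
      if G: "G \<in> graphs_on n" "few_cliques n (q + 1) \<gamma> G" for G
    proof -
      have "d * real n ^ 2 \<le> \<delta> * real n ^ 2" by (intro mult_right_mono) (auto simp: d_def)
      then show ?thesis using C(5)[OF G] by (meson order_trans)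
    qed
    show "\<exists>\<C>. coloured_containers n k q \<delta> \<gamma> \<C>"
      by (rule exI[of _ \<C>]) (use C(1-3) col appr in blast)
  qed
qed

section \<open>Counting graphs with few cliques\<close>

text \<open>The discrepancy condition quantifies over all subsets of the colour classes, because
  closeness in cut norm is needed, not only the densities between the classes.\<close>

definition structured :: "real \<Rightarrow> nat \<Rightarrow> nat \<Rightarrow> (nat \<Rightarrow> nat) \<Rightarrow> ugraph \<Rightarrow> bool" where
  "structured \<epsilon> n q f G \<longleftrightarrow> (\<forall>v. f v \<in> {1..q}) \<and>
    (\<forall>i\<in>{1..q}. \<bar>real (card (colour_class n f i)) - real n / real q\<bar> \<le> \<epsilon> * real n) \<and>
    real (card (G \<inter> inner_edges n f)) \<le> \<epsilon> * real n ^ 2 \<and>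
    (\<forall>S T. S \<subseteq> {1..n} \<longrightarrow> T \<subseteq> {1..n} \<longrightarrow> (\<forall>u\<in>S. \<forall>v\<in>T. f u \<noteq> f v) \<longrightarrow>
      \<bar>real (edges_between G S T) - real (card S) * real (card T) / 2\<bar> \<le> \<epsilon> * real n ^ 2)"

text \<open>The balanced complete \<open>q\<close>-partite graph has about
  \<open>(1 - 1 / q) * n ^ 2 / 2\<close> edges; this is the logarithm of the number of its
  subgraphs, divided by \<open>n ^ 2\<close>.\<close>

definition max_entropy :: "nat \<Rightarrow> real" where
  "max_entropy q = ln 2 / 2 * (1 - 1 / real q)"

lemma two_power_eq_exp: "(2::real) ^ m = exp (real m * ln 2)"
  by (simp add: exp_of_nat_mult)

lemma card_small_graphs_le_exp:
  fixes \<theta> :: real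
  assumes "\<theta> > 0"
  shows "\<exists>\<kappa>>0. \<forall>n. real (card {A. A \<subseteq> all_edges n \<and> real (card A) \<le> \<kappa> * real n ^ 2}) \<le> exp (\<theta> * real n ^ 2)"
proof -
  obtain \<kappa> where \<kappa>: "\<kappa> > 0" "\<forall>(X :: nat set set) m. finite X \<longrightarrow> real (card X) \<le> m \<longrightarrow>
    real (card {A. A \<subseteq> X \<and> real (card A) \<le> \<kappa> * m}) \<le> exp (\<theta> * m)"
    using card_small_subsets_le_exp[OF assms, where ?'a = "nat set"] by blast
  show ?thesis
    by (intro exI[of _ \<kappa>] conjI allI \<kappa>(1))
      (rule \<kappa>(2)[rule_format, OF finite_all_edges card_all_edges_le])
qed

lemma le_twice_power_mult: "0 \<le> x \<Longrightarrow> x \<le> 2 * 4 ^ n * (x::real)"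
proof -
  have "1 \<le> (4::real) ^ n" by (rule one_le_power) simp
  then have "1 \<le> 2 * (4::real) ^ n" by linarith
  then show "0 \<le> x \<Longrightarrow> ?thesis" using mult_right_mono[of 1 "2 * 4 ^ n" x] by simp
qed

text \<open>A graph is determined by its trace on \<open>C\<close>, with \<open>2 ^ card C\<close>
  choices, and by its few edges outside \<open>C\<close>.\<close>

lemma card_approximable_graphs_le:
  assumes C: "C \<in> graphs_on n"
    and \<kappa>: "real (card {A. A \<subseteq> all_edges n \<and> real (card A) \<le> \<kappa> * real n ^ 2}) \<le> exp (\<theta> * real n ^ 2)"
    and \<delta>: "\<delta> \<le> \<kappa>"
  shows "real (card {G \<in> graphs_on n. real (card (G - C)) \<le> \<delta> * real n ^ 2})
    \<le> exp (real (card C) * ln 2 + \<theta> * real n ^ 2)"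
proof -
  let ?B = "{A. A \<subseteq> all_edges n \<and> real (card A) \<le> \<kappa> * real n ^ 2}"
  let ?F = "{G \<in> graphs_on n. real (card (G - C)) \<le> \<delta> * real n ^ 2}"
  have finC: "finite C" by (rule finite_graph[OF C])
  have finB: "finite ?B" by (rule finite_subset[of _ "Pow (all_edges n)"]) auto
  have "card ?F \<le> card (Pow C \<times> ?B)"
  proof (rule card_inj_on_le[of "\<lambda>G. (G \<inter> C, G - C)"])
    show "inj_on (\<lambda>G. (G \<inter> C, G - C)) ?F" by (rule inj_onI) blast
    have "\<delta> * real n ^ 2 \<le> \<kappa> * real n ^ 2" using \<delta> by (intro mult_right_mono) auto
    then show "(\<lambda>G. (G \<inter> C, G - C)) ` ?F \<subseteq> Pow C \<times> ?B" by (auto simp: graphs_on_iff)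
  qed (use finC finB in auto)
  also have "\<dots> = 2 ^ card C * card ?B" using finC by (simp add: card_cartesian_product card_Pow)
  finally have "real (card ?F) \<le> real (2 ^ card C * card ?B)" by (rule of_nat_mono)
  also have "\<dots> = 2 ^ card C * real (card ?B)" by simp
  also have "\<dots> \<le> 2 ^ card C * exp (\<theta> * real n ^ 2)" using \<kappa> by (intro mult_left_mono) auto
  finally show ?thesis by (simp add: exp_add two_power_eq_exp)
qed

lemma edges_between_eq: "edges_between G S T = card (G \<inter> (\<lambda>(a, b). {a, b}) ` (S \<times> T))"
  unfolding edges_between_def by (rule arg_cong[where f = card]) auto

text \<open>The assumption makes \<open>S\<close> and \<open>T\<close> disjoint (take
  \<open>u = v\<close>), so a pair is recovered from its doubleton.\<close>

lemma inj_on_doubleton: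
  assumes "\<forall>u\<in>S. \<forall>v\<in>T. f u \<noteq> f v"
  shows "inj_on (\<lambda>(a, b). {a, b}) (S \<times> T)"
  using assms by (auto simp: inj_on_def doubleton_eq_iff)

text \<open>For fixed \<open>S\<close> and \<open>T\<close> a graph splits into its inner part,
  which is small and has at most \<open>exp (\<theta> * n ^ 2)\<close> choices, and its cross part,
  to which Chernoff's bound applies. The union over \<open>S\<close> and \<open>T\<close> costs the
  factor \<open>4 ^ n\<close>.\<close>

lemma card_discrepant_graphs_le:
  assumes \<kappa>: "real (card {A. A \<subseteq> all_edges n \<and> real (card A) \<le> \<kappa> * real n ^ 2}) \<le> exp (\<theta> * real n ^ 2)"
    and \<epsilon>: "0 < \<epsilon>" "\<epsilon> \<le> 1"
  shows "real (card {G \<in> graphs_on n. real (card (G \<inter> inner_edges n f)) \<le> \<kappa> * real n ^ 2 \<and>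
    (\<exists>S T. S \<subseteq> {1..n} \<and> T \<subseteq> {1..n} \<and> (\<forall>u\<in>S. \<forall>v\<in>T. f u \<noteq> f v) \<and>
      \<bar>real (edges_between G S T) - real (card S) * real (card T) / 2\<bar> > \<epsilon> * real n ^ 2)})
    \<le> 4 ^ n * (2 * exp (real (card (cross_edges n f)) * ln 2 + \<theta> * real n ^ 2 - \<epsilon>\<^sup>2 / 2 * real n ^ 2))"
    (is "real (card ?F) \<le> 4 ^ n * ?b")
proof -
  let ?X = "cross_edges n f"
  let ?I = "{(S, T) \<in> Pow {1..n} \<times> Pow {1..n}. \<forall>u\<in>S. \<forall>v\<in>T. f u \<noteq> f v}"
  define H where "H S T = {G \<in> graphs_on n. real (card (G \<inter> inner_edges n f)) \<le> \<kappa> * real n ^ 2 \<and>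
    \<bar>real (edges_between G S T) - real (card S) * real (card T) / 2\<bar> > \<epsilon> * real n ^ 2}" for S T
  have finI: "finite ?I" by (rule finite_subset[of _ "Pow {1..n} \<times> Pow {1..n}"]) auto
  have one: "real (card (H S T)) \<le> ?b" if ST: "(S, T) \<in> ?I" for S T
  proof -
    define Y where "Y = (\<lambda>(a, b). {a, b}) ` (S \<times> T)"
    have ST': "S \<subseteq> {1..n}" "T \<subseteq> {1..n}" "\<forall>u\<in>S. \<forall>v\<in>T. f u \<noteq> f v" using ST by auto
    have YX: "Y \<subseteq> ?X" using ST' by (auto simp: Y_def doubleton_in_cross_edges subset_iff)
    have cY: "card Y = card S * card T"
      unfolding Y_def using inj_on_doubleton[OF ST'(3)] by (simp add: card_image card_cartesian_product)
    have "card S * card T \<le> n * n"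
      using card_mono[OF _ ST'(1)] card_mono[OF _ ST'(2)] by (intro mult_mono) auto
    then have Yn: "real (card Y) \<le> real n ^ 2"
      unfolding cY power2_eq_square of_nat_mult[symmetric] by (rule of_nat_mono)
    let ?A = "{A. A \<subseteq> all_edges n \<and> real (card A) \<le> \<kappa> * real n ^ 2}"
    let ?B = "{A. A \<subseteq> ?X \<and> \<bar>real (card (A \<inter> Y)) - real (card Y) / 2\<bar> \<ge> \<epsilon> * real n ^ 2}"
    have finA: "finite ?A" by (rule finite_subset[of _ "Pow (all_edges n)"]) auto
    have finB: "finite ?B" by (rule finite_subset[of _ "Pow ?X"]) auto
    have "card (H S T) \<le> card (?A \<times> ?B)"
    proof (rule card_inj_on_le[of "\<lambda>G. (G \<inter> inner_edges n f, G \<inter> ?X)"])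
      show "inj_on (\<lambda>G. (G \<inter> inner_edges n f, G \<inter> ?X)) (H S T)"
        by (rule inj_onI) (unfold H_def graphs_on_iff cross_edges_def, blast)
      show "(\<lambda>G. (G \<inter> inner_edges n f, G \<inter> ?X)) ` H S T \<subseteq> ?A \<times> ?B"
      proof (rule image_subsetI)
        fix G assume G: "G \<in> H S T"
        \<comment> \<open>All doubletons between \<open>S\<close> and \<open>T\<close> are cross
          edges, so the discrepancy is a property of the cross part alone.\<close>
        have "G \<inter> ?X \<inter> Y = G \<inter> Y" using YX by blast
        moreover have "edges_between G S T = card (G \<inter> Y)" by (simp add: edges_between_eq Y_def)
        ultimately show "(G \<inter> inner_edges n f, G \<inter> ?X) \<in> ?A \<times> ?B"
          using G by (auto simp: H_def inner_edges_def cY)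
      qed
    qed (use finA finB in auto)
    also have "\<dots> = card ?A * card ?B" by (rule card_cartesian_product)
    finally have "real (card (H S T)) \<le> real (card ?A * card ?B)" by (rule of_nat_mono)
    also have "\<dots> = real (card ?A) * real (card ?B)" by (rule of_nat_mult)
    also have "\<dots> \<le> exp (\<theta> * real n ^ 2) * (2 * 2 ^ card ?X * exp (- (\<epsilon>\<^sup>2 * real n ^ 2 / 2)))"
      by (intro mult_mono \<kappa> card_subsets_deviation YX Yn \<epsilon>) auto
    also have "\<dots> = ?b" by (simp add: two_power_eq_exp algebra_simps flip: exp_add)
    finally show ?thesis .
  qed
  have fin: "finite (H S T)" for S T
    by (rule finite_subset[OF _ finite_graphs_on[of n]]) (auto simp: H_def)
  have "card ?F \<le> card (\<Union>(S, T)\<in>?I. H S T)"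
    using finI fin by (intro card_mono) (auto simp: H_def)
  also have "\<dots> \<le> (\<Sum>(S, T)\<in>?I. card (H S T))"
    using card_UN_le[OF finI, of "\<lambda>(S, T). H S T"] by (simp add: case_prod_unfold)
  finally have "real (card ?F) \<le> (\<Sum>(S, T)\<in>?I. real (card (H S T)))"
    by (simp add: case_prod_unfold flip: of_nat_sum)
  also have "\<dots> \<le> (\<Sum>(S, T)\<in>?I. ?b)" using one by (intro sum_mono) auto
  also have "\<dots> = real (card ?I) * ?b" by simp
  also have "\<dots> \<le> 4 ^ n * ?b"
  proof (rule mult_right_mono)
    have "card ?I \<le> card (Pow {1..n} \<times> Pow {1..n})" by (rule card_mono) auto
    also have "\<dots> = 4 ^ n" by (simp add: card_cartesian_product card_Pow flip: power_mult_distrib)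
    finally have "real (card ?I) \<le> real (4 ^ n)" by (rule of_nat_mono)
    then show "real (card ?I) \<le> 4 ^ n" by simp
  qed simp
  finally show ?thesis .
qed

section \<open>Summing over the containers\<close>

lemma eventually_exponential_le_exp_square:
  fixes c :: real
  assumes "c > 0"
  shows "\<exists>N. \<forall>n\<ge>N. 4 ^ ((n + 1) * k) * (2 * 4 ^ n) \<le> exp (c * real n ^ 2)"
proof -
  define M where "M = 2 * real k * ln 4 + ln 4 + ln 2"
  have l: "ln (4::real) > 0" "ln (2::real) > 0" by auto
  obtain N :: nat where N: "M / c < real N" using reals_Archimedean2 by blast
  show ?thesis
  proof (intro exI[of _ "max 1 N"] allI impI)
    fix n assume n: "n \<ge> max 1 N"
    have "(4::real) ^ ((n + 1) * k) * (2 * 4 ^ n) = exp (ln 4) ^ ((n + 1) * k) * (exp (ln 2) * exp (ln 4) ^ n)"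
      by simp
    also have "\<dots> = exp (real ((n + 1) * k) * ln 4 + (ln 2 + real n * ln 4))"
      by (simp only: exp_add exp_of_nat_mult)
    also have "\<dots> \<le> exp (c * real n ^ 2)"
    proof -
      have "real ((n + 1) * k) * ln 4 + (ln 2 + real n * ln 4) \<le> (2 * real n) * (real k * ln 4) + (real n * ln 2 + real n * ln 4)"
        using n l mult_right_mono[of "real n + 1" "2 * real n" "real k * ln 4"]
        by (intro add_mono) (auto simp: algebra_simps)
      also have "\<dots> = M * real n" by (simp add: M_def algebra_simps)
      also have "\<dots> \<le> (c * real n) * real n"
      proof (rule mult_right_mono)
        have "M / c \<le> real n" using N n by linarith
        then show "M \<le> c * real n" using assms by (simp add: field_simps)
      qed simp
      finally show ?thesis by (simp add: power2_eq_square mult.assoc)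
    qed
    finally show "(4::real) ^ ((n + 1) * k) * (2 * 4 ^ n) \<le> exp (c * real n ^ 2)" .
  qed
qed

lemma card_graphs_by_container_le:
  assumes "finite \<C>" "card \<C> \<le> 4 ^ ((n + 1) * k)"
    and cover: "\<And>G. G \<in> \<F> \<Longrightarrow> \<exists>C\<in>\<C>. G \<in> H C"
    and H: "\<And>C. C \<in> \<C> \<Longrightarrow> finite (H C) \<and> real (card (H C)) \<le> 2 * 4 ^ n * exp (a * real n ^ 2)"
    and grow: "4 ^ ((n + 1) * k) * (2 * 4 ^ n) \<le> exp (c * real n ^ 2)"
  shows "real (card \<F>) \<le> exp ((a + c) * real n ^ 2)"
proof -
  have "card \<F> \<le> card (\<Union>C\<in>\<C>. H C)"
    using assms(1) H cover by (intro card_mono) auto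
  also have "\<dots> \<le> (\<Sum>C\<in>\<C>. card (H C))" by (rule card_UN_le[OF assms(1)])
  finally have "real (card \<F>) \<le> (\<Sum>C\<in>\<C>. real (card (H C)))" by (simp flip: of_nat_sum)
  also have "\<dots> \<le> (\<Sum>C\<in>\<C>. 2 * 4 ^ n * exp (a * real n ^ 2))" using H by (intro sum_mono) auto
  also have "\<dots> = real (card \<C>) * (2 * 4 ^ n * exp (a * real n ^ 2))" by simp
  also have "\<dots> \<le> 4 ^ ((n + 1) * k) * (2 * 4 ^ n * exp (a * real n ^ 2))"
    using of_nat_mono[OF assms(2), where ?'a = real] by (intro mult_right_mono) auto
  also have "\<dots> = 4 ^ ((n + 1) * k) * (2 * 4 ^ n) * exp (a * real n ^ 2)" by simp
  also have "\<dots> \<le> exp (c * real n ^ 2) * exp (a * real n ^ 2)"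
    using grow by (intro mult_right_mono) auto
  finally show ?thesis by (simp add: algebra_simps flip: exp_add)
qed

lemma card_cross_edges_le:
  assumes "\<forall>v. f v \<in> {1..q}" "q \<ge> 1"
  shows "real (card (cross_edges n f)) * ln 2 \<le> max_entropy q * real n ^ 2"
proof -
  have "(\<Sum>i\<in>{1..q}. (real (card (colour_class n f i)) - real n / real q)\<^sup>2) \<ge> 0"
    by (intro sum_nonneg) auto
  then have "real (card (cross_edges n f)) \<le> real n ^ 2 * (1 - 1 / real q) / 2"
    using card_cross_edges[OF assms(1), of n] assms(2) by simp
  then have "real (card (cross_edges n f)) * ln 2 \<le> real n ^ 2 * (1 - 1 / real q) / 2 * ln 2"
    by (intro mult_right_mono) auto
  then show ?thesis by (simp add: max_entropy_def mult_ac)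
qed

text \<open>Without its inner term the colouring inequality still bounds a container by the Turan
  number, up to \<open>\<delta> * n ^ 2\<close>; this suffices for the upper bound on the free
  energy.\<close>

lemma card_few_cliques_le:
  assumes \<theta>: "\<theta> > 0" and q: "q \<ge> 1"
  shows "\<exists>\<gamma>>0. \<exists>N. \<forall>n\<ge>N.
    real (card {G \<in> graphs_on n. few_cliques n (q + 1) \<gamma> G})
    \<le> exp ((max_entropy q + \<theta>) * real n ^ 2)"
proof -
  have \<theta>3: "\<theta> / 3 > 0" using \<theta> by simp
  obtain \<kappa> where \<kappa>: "\<kappa> > 0" "\<And>n. real (card {A. A \<subseteq> all_edges n \<and> real (card A) \<le> \<kappa> * real n ^ 2}) \<le> exp (\<theta> / 3 * real n ^ 2)"
    using card_small_graphs_le_exp[OF \<theta>3] by blast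
  \<comment> \<open>One third of \<open>\<theta>\<close> each pays for the surplus edges of a
    container, for the escaping edges of the graph, and for the number of containers.\<close>
  define \<delta> where "\<delta> = min \<kappa> (\<theta> / 3)"
  have \<delta>: "\<delta> > 0" "\<delta> \<le> \<kappa>" "\<delta> \<le> \<theta> / 3" using \<kappa>(1) \<theta> by (auto simp: \<delta>_def)
  obtain \<gamma> k where \<gamma>: "\<gamma> > 0" and fam: "\<And>n. \<exists>\<C>. coloured_containers n k q \<delta> \<gamma> \<C>"
    using coloured_container_family[OF \<delta>(1) q] by blast
  obtain N where N: "\<And>n. n \<ge> N \<Longrightarrow> 4 ^ ((n + 1) * k) * (2 * 4 ^ n) \<le> exp (\<theta> / 3 * real n ^ 2)"
    using eventually_exponential_le_exp_square[OF \<theta>3, of k] by blast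
  show ?thesis
  proof (rule exI[of _ \<gamma>], intro conjI \<gamma>, rule exI[of _ N], intro allI impI)
    fix n assume n: "n \<ge> N"
    obtain \<C> where C: "finite \<C>" "card \<C> \<le> 4 ^ ((n + 1) * k)" "\<C> \<subseteq> graphs_on n"
      "\<And>C. C \<in> \<C> \<Longrightarrow> \<exists>f. (\<forall>v. f v \<in> {1..q}) \<and>
      real (card C) + real (card (C \<inter> inner_edges n f)) \<le> real (card (cross_edges n f)) + \<delta> * real n ^ 2"
      "\<And>G. G\<in>graphs_on n \<Longrightarrow> few_cliques n (q + 1) \<gamma> G \<Longrightarrow>
      (\<exists>C\<in>\<C>. real (card (G - C)) \<le> \<delta> * real n ^ 2)"
      using fam[of n] by blast
    have "real (card {G \<in> graphs_on n. few_cliques n (q + 1) \<gamma> G})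
      \<le> exp (((max_entropy q + 2 * \<theta> / 3) + \<theta> / 3) * real n ^ 2)"
    proof (rule card_graphs_by_container_le[OF C(1,2) _ _ N[OF n],
          where H = "\<lambda>C. {G \<in> graphs_on n. real (card (G - C)) \<le> \<delta> * real n ^ 2}"])
      fix C assume CC: "C \<in> \<C>"
      then have Cg: "C \<in> graphs_on n" using C(3) by blast
      obtain f where f: "\<forall>v. f v \<in> {1..q}"
        "real (card C) + real (card (C \<inter> inner_edges n f)) \<le> real (card (cross_edges n f)) + \<delta> * real n ^ 2"
        using C(4)[OF CC] by blast
      have "real (card C) \<le> real (card (cross_edges n f)) + \<delta> * real n ^ 2" using f(2) by linarith
      then have "real (card C) * ln 2 \<le> (real (card (cross_edges n f)) + \<delta> * real n ^ 2) * ln 2"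
        by (intro mult_right_mono) auto
      also have "\<dots> \<le> max_entropy q * real n ^ 2 + \<delta> * real n ^ 2 * ln 2"
        using card_cross_edges_le[OF f(1) q, of n] by (simp add: distrib_right)
      also have "\<delta> * real n ^ 2 * ln 2 \<le> \<theta> / 3 * real n ^ 2 * 1"
        using \<delta> ln2_le_25_over_36 by (intro mult_mono) auto
      finally have "real (card C) * ln 2 + \<theta> / 3 * real n ^ 2 \<le> (max_entropy q + 2 * \<theta> / 3) * real n ^ 2"
        by (simp add: algebra_simps)
      then have "exp (real (card C) * ln 2 + \<theta> / 3 * real n ^ 2) \<le> exp ((max_entropy q + 2 * \<theta> / 3) * real n ^ 2)"
        by simp
      also have "\<dots> \<le> 2 * 4 ^ n * exp ((max_entropy q + 2 * \<theta> / 3) * real n ^ 2)"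
        by (intro le_twice_power_mult) simp
      finally have "real (card {G \<in> graphs_on n. real (card (G - C)) \<le> \<delta> * real n ^ 2}) \<le>
        2 * 4 ^ n * exp ((max_entropy q + 2 * \<theta> / 3) * real n ^ 2)"
        using card_approximable_graphs_le[OF Cg \<kappa>(2) \<delta>(2)] by linarith
      then show "finite {G \<in> graphs_on n. real (card (G - C)) \<le> \<delta> * real n ^ 2} \<and>
         real (card {G \<in> graphs_on n. real (card (G - C)) \<le> \<delta> * real n ^ 2}) \<le>
        2 * 4 ^ n * exp ((max_entropy q + 2 * \<theta> / 3) * real n ^ 2)"
        using finite_graphs_on by simp
    qed (use C(5) in auto)
    then show "real (card {G \<in> graphs_on n. few_cliques n (q + 1) \<gamma> G})
      \<le> exp ((max_entropy q + \<theta>) * real n ^ 2)" by (simp add: algebra_simps)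
  qed
qed

text \<open>Each container falls into one of two cases. If its colouring is unbalanced or it has
  many inner edges, it is too small to contribute. Otherwise its colouring nearly witnesses
  \<open>structured\<close> for every graph assigned to it, and an unstructured graph must be
  discrepant.\<close>

lemma card_unstructured_le:
  assumes \<epsilon>: "0 < \<epsilon>" "\<epsilon> \<le> 1" and q: "q \<ge> 1"
  shows "\<exists>c>0. \<exists>\<gamma>>0. \<exists>N. \<forall>n\<ge>N.
    real (card {G \<in> graphs_on n. few_cliques n (q + 1) \<gamma> G \<and>
      (\<nexists>f. structured \<epsilon> n q f G)})
    \<le> exp ((max_entropy q - c) * real n ^ 2)"
proof -
  have "\<epsilon>\<^sup>2 / 4 > 0" using \<epsilon> by simp
  from card_small_graphs_le_exp[OF this] obtain \<kappa>2 where \<kappa>2: "\<kappa>2 > 0"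
    "\<And>n. real (card {A. A \<subseteq> all_edges n \<and> real (card A) \<le> \<kappa>2 * real n ^ 2}) \<le> exp (\<epsilon>\<^sup>2 / 4 * real n ^ 2)"
    by blast
  \<comment> \<open>The constants are chosen backwards. \<open>\<kappa>2\<close> lets the inner
    edges of a graph use half of Chernoff's gain \<open>\<epsilon>\<^sup>2 / 2\<close>. Containers
    below \<open>\<tau>\<close> leave graphs with at most \<open>2 * \<tau> * n ^ 2\<close> inner
    edges, within both \<open>\<epsilon>\<close> and \<open>\<kappa>2\<close>. \<open>\<mu>\<close>
    is the deficit guaranteed in the other case; surplus and escaping edges each take a quarter of
    it, leaving \<open>\<mu> / 2\<close>. Finally \<open>c\<close> is half of the smaller gain,
    since the number of containers consumes the other half.\<close>
  define \<tau> where "\<tau> = min \<epsilon> \<kappa>2 / 2"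
  have \<tau>: "\<tau> > 0" "2 * \<tau> \<le> \<epsilon>" "2 * \<tau> \<le> \<kappa>2" using \<epsilon> \<kappa>2 by (auto simp: \<tau>_def)
  define \<mu> where "\<mu> = min \<tau> (\<epsilon>\<^sup>2 / 2)"
  have \<mu>: "\<mu> > 0" "\<mu> \<le> \<tau>" "\<mu> \<le> \<epsilon>\<^sup>2 / 2" using \<tau> \<epsilon> by (auto simp: \<mu>_def)
  have "\<mu> / 4 * ln 2 > 0" using \<mu> by simp
  from card_small_graphs_le_exp[OF this] obtain \<kappa>1 where \<kappa>1: "\<kappa>1 > 0"
    "\<And>n. real (card {A. A \<subseteq> all_edges n \<and> real (card A) \<le> \<kappa>1 * real n ^ 2}) \<le> exp (\<mu> / 4 * ln 2 * real n ^ 2)"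
    by blast
  define \<delta> where "\<delta> = min \<kappa>1 (\<mu> / 4)"
  have \<delta>: "\<delta> > 0" "\<delta> \<le> \<kappa>1" "\<delta> \<le> \<mu> / 4" using \<kappa>1 \<mu> by (auto simp: \<delta>_def)
  define c where "c = min (\<epsilon>\<^sup>2 / 4) (\<mu> / 2 * ln 2) / 2"
  have c: "c > 0" "2 * c \<le> \<epsilon>\<^sup>2 / 4" "2 * c \<le> \<mu> / 2 * ln 2" using \<epsilon> \<mu> by (auto simp: c_def)
  obtain \<gamma> k where \<gamma>: "\<gamma> > 0" and fam: "\<And>n. \<exists>\<C>. coloured_containers n k q \<delta> \<gamma> \<C>"
    using coloured_container_family[OF \<delta>(1) q] by blast
  obtain N where N: "\<And>n. n \<ge> N \<Longrightarrow> 4 ^ ((n + 1) * k) * (2 * 4 ^ n) \<le> exp (c * real n ^ 2)"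
    using eventually_exponential_le_exp_square[OF c(1), of k] by blast
  show ?thesis
  proof (rule exI[of _ c], intro conjI c(1), rule exI[of _ \<gamma>], intro conjI \<gamma>, rule exI[of _ N], intro allI impI)
    fix n assume n: "n \<ge> N"
    obtain \<C> where C: "finite \<C>" "card \<C> \<le> 4 ^ ((n + 1) * k)" "\<C> \<subseteq> graphs_on n"
      "\<And>C. C \<in> \<C> \<Longrightarrow> \<exists>f. (\<forall>v. f v \<in> {1..q}) \<and>
      real (card C) + real (card (C \<inter> inner_edges n f)) \<le> real (card (cross_edges n f)) + \<delta> * real n ^ 2"
      "\<And>G. G\<in>graphs_on n \<Longrightarrow> few_cliques n (q + 1) \<gamma> G \<Longrightarrow>
      (\<exists>C\<in>\<C>. real (card (G - C)) \<le> \<delta> * real n ^ 2)"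
      using fam[of n] by blast
    let ?H = "\<lambda>C. {G \<in> graphs_on n. real (card (G - C)) \<le> \<delta> * real n ^ 2 \<and> (\<nexists>f. structured \<epsilon> n q f G)}"
    have finH: "finite (?H C)" for C by (rule finite_subset[OF _ finite_graphs_on[of n]]) auto
    have "real (card {G \<in> graphs_on n. few_cliques n (q + 1) \<gamma> G \<and>
      (\<nexists>f. structured \<epsilon> n q f G)}) \<le> exp (((max_entropy q - 2 * c) + c) * real n ^ 2)"
    proof (rule card_graphs_by_container_le[OF C(1,2) _ _ N[OF n], where H = ?H])
      fix C assume CC: "C \<in> \<C>"
      then have Cg: "C \<in> graphs_on n" using C(3) by blast
      obtain f where f: "\<forall>v. f v \<in> {1..q}"
        "real (card C) + real (card (C \<inter> inner_edges n f)) \<le> real (card (cross_edges n f)) + \<delta> * real n ^ 2"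
        using C(4)[OF CC] by blast
      let ?a = "\<lambda>i. real (card (colour_class n f i))"
      have "real (card (?H C)) \<le> 2 * 4 ^ n * exp ((max_entropy q - 2 * c) * real n ^ 2)"
      proof (cases "real (card (C \<inter> inner_edges n f)) \<le> \<tau> * real n ^ 2 \<and>
          (\<forall>i\<in>{1..q}. \<bar>?a i - real n / real q\<bar> \<le> \<epsilon> * real n)")
        case False
        define M where "M = real n ^ 2 * (1 - 1 / real q)"
        let ?s = "\<Sum>i\<in>{1..q}. (?a i - real n / real q)\<^sup>2"
        have s0: "?s \<ge> 0" by (intro sum_nonneg) auto
        \<comment> \<open>Either the inner edges exceed \<open>\<tau> * n ^ 2\<close>, or a single
          class off by more than \<open>\<epsilon> * n\<close> already contributes
          \<open>\<epsilon>\<^sup>2 / 2 * n ^ 2\<close>. Both terms are subtracted from the Turan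
          bound for \<open>card C\<close>.\<close>
        have "?s / 2 + real (card (C \<inter> inner_edges n f)) \<ge> \<mu> * real n ^ 2"
        proof (cases "real (card (C \<inter> inner_edges n f)) \<le> \<tau> * real n ^ 2")
          case True
          then obtain i where i: "i \<in> {1..q}" "\<bar>?a i - real n / real q\<bar> > \<epsilon> * real n" using False by (auto simp: not_le)
          have "\<epsilon>\<^sup>2 * real n ^ 2 = (\<epsilon> * real n)\<^sup>2" by (simp add: power_mult_distrib)
          also have "\<dots> \<le> \<bar>?a i - real n / real q\<bar>\<^sup>2" using i \<epsilon> by (intro power_mono) auto
          also have "\<dots> = (?a i - real n / real q)\<^sup>2" by simp
          also have "\<dots> \<le> ?s" using i by (intro member_le_sum) auto
          finally have "\<epsilon>\<^sup>2 / 2 * real n ^ 2 \<le> ?s / 2" by simp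
          moreover have "\<mu> * real n ^ 2 \<le> \<epsilon>\<^sup>2 / 2 * real n ^ 2" using \<mu> by (intro mult_right_mono) auto
          ultimately show ?thesis by linarith
        next
          case False
          moreover have "\<mu> * real n ^ 2 \<le> \<tau> * real n ^ 2" using \<mu> by (intro mult_right_mono) auto
          ultimately show ?thesis using s0 by linarith
        qed
        moreover have "2 * real (card (cross_edges n f)) = M - ?s"
          using card_cross_edges[OF f(1), of n] q by (simp add: M_def)
        moreover have "\<delta> * real n ^ 2 \<le> \<mu> / 4 * real n ^ 2" using \<delta> by (intro mult_right_mono) auto
        ultimately have "real (card C) \<le> M / 2 - 3 / 4 * \<mu> * real n ^ 2"
          using f(2) by linarith
        then have "real (card C) \<le> real n ^ 2 * (1 - 1 / real q) / 2 - 3 / 4 * \<mu> * real n ^ 2"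
          by (simp only: M_def)
        then have "real (card C) * ln 2 \<le> (real n ^ 2 * (1 - 1 / real q) / 2 - 3 / 4 * \<mu> * real n ^ 2) * ln 2"
          by (intro mult_right_mono) auto
        also have "\<dots> = (max_entropy q - 3 / 4 * \<mu> * ln 2) * real n ^ 2"
          by (simp add: max_entropy_def algebra_simps)
        finally have "real (card C) * ln 2 + \<mu> / 4 * ln 2 * real n ^ 2 \<le> (max_entropy q - \<mu> / 2 * ln 2) * real n ^ 2"
          by (simp add: algebra_simps)
        also have "\<dots> \<le> (max_entropy q - 2 * c) * real n ^ 2" using c by (intro mult_right_mono) auto
        finally have "exp (real (card C) * ln 2 + \<mu> / 4 * ln 2 * real n ^ 2) \<le> exp ((max_entropy q - 2 * c) * real n ^ 2)"
          by simp
        also have "\<dots> \<le> 2 * 4 ^ n * exp ((max_entropy q - 2 * c) * real n ^ 2)"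
          by (intro le_twice_power_mult) simp
        finally have "real (card {G \<in> graphs_on n. real (card (G - C)) \<le> \<delta> * real n ^ 2}) \<le>
          2 * 4 ^ n * exp ((max_entropy q - 2 * c) * real n ^ 2)"
          using card_approximable_graphs_le[OF Cg \<kappa>1(2) \<delta>(2)] by linarith
        moreover have "card (?H C) \<le> card {G \<in> graphs_on n. real (card (G - C)) \<le> \<delta> * real n ^ 2}"
          using finite_graphs_on by (intro card_mono) auto
        ultimately show ?thesis by linarith
      next
        case True
        let ?F = "{G \<in> graphs_on n. real (card (G \<inter> inner_edges n f)) \<le> \<kappa>2 * real n ^ 2 \<and>
          (\<exists>S T. S \<subseteq> {1..n} \<and> T \<subseteq> {1..n} \<and> (\<forall>u\<in>S. \<forall>v\<in>T. f u \<noteq> f v) \<and>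
          \<bar>real (edges_between G S T) - real (card S) * real (card T) / 2\<bar> > \<epsilon> * real n ^ 2)}"
        \<comment> \<open>Here the colouring is balanced, and a graph has at most the inner edges of
          \<open>C\<close> plus its escaping edges inside the classes. The only clause of
          \<open>structured\<close> left to fail for \<open>f\<close> is the discrepancy.\<close>
        have "?H C \<subseteq> ?F"
        proof clarify
          fix G assume G: "G \<in> graphs_on n" "real (card (G - C)) \<le> \<delta> * real n ^ 2" "\<nexists>f. structured \<epsilon> n q f G"
          have "card (G \<inter> inner_edges n f) \<le> card ((C \<inter> inner_edges n f) \<union> (G - C))"
            using finite_graph[OF G(1)] by (intro card_mono) auto
          also have "\<dots> \<le> card (C \<inter> inner_edges n f) + card (G - C)" by (rule card_Un_le)
          finally have "real (card (G \<inter> inner_edges n f)) \<le> \<tau> * real n ^ 2 + \<delta> * real n ^ 2"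
            using True G(2) by linarith
          also have "\<dots> \<le> \<tau> * real n ^ 2 + \<tau> * real n ^ 2"
            using \<delta> \<mu> by (intro add_mono mult_right_mono) auto
          finally have in_le: "real (card (G \<inter> inner_edges n f)) \<le> 2 * \<tau> * real n ^ 2" by simp
          have "2 * \<tau> * real n ^ 2 \<le> \<epsilon> * real n ^ 2" using \<tau> by (intro mult_right_mono) auto
          moreover have "2 * \<tau> * real n ^ 2 \<le> \<kappa>2 * real n ^ 2" using \<tau> by (intro mult_right_mono) auto
          ultimately have in_le': "real (card (G \<inter> inner_edges n f)) \<le> \<epsilon> * real n ^ 2"
            "real (card (G \<inter> inner_edges n f)) \<le> \<kappa>2 * real n ^ 2" using in_le by linarith+
          have "\<not> structured \<epsilon> n q f G" using G(3) by blast
          moreover have "(\<forall>v. f v \<in> {1..q}) = True" using f(1) by simp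
          ultimately have "\<exists>S T. S \<subseteq> {1..n} \<and> T \<subseteq> {1..n} \<and> (\<forall>u\<in>S. \<forall>v\<in>T. f u \<noteq> f v) \<and>
            \<bar>real (edges_between G S T) - real (card S) * real (card T) / 2\<bar> > \<epsilon> * real n ^ 2"
            using True in_le'(1) by (simp only: structured_def) (simp add: not_le)
          with in_le'(2) show "real (card (G \<inter> inner_edges n f)) \<le> \<kappa>2 * real n ^ 2 \<and>
          (\<exists>S T. S \<subseteq> {1..n} \<and> T \<subseteq> {1..n} \<and> (\<forall>u\<in>S. \<forall>v\<in>T. f u \<noteq> f v) \<and>
          \<bar>real (edges_between G S T) - real (card S) * real (card T) / 2\<bar> > \<epsilon> * real n ^ 2)" by blast
        qed
        then have "card (?H C) \<le> card ?F"
          using finite_graphs_on by (intro card_mono) auto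
        then have "real (card (?H C)) \<le> real (card ?F)" by simp
        also have "\<dots> \<le> 4 ^ n * (2 * exp (real (card (cross_edges n f)) * ln 2 + \<epsilon>\<^sup>2 / 4 * real n ^ 2 - \<epsilon>\<^sup>2 / 2 * real n ^ 2))"
          by (rule card_discrepant_graphs_le[OF \<kappa>2(2) \<epsilon>])
        also have "\<dots> \<le> 4 ^ n * (2 * exp ((max_entropy q - 2 * c) * real n ^ 2))"
        proof -
          have "real (card (cross_edges n f)) * ln 2 + \<epsilon>\<^sup>2 / 4 * real n ^ 2 - \<epsilon>\<^sup>2 / 2 * real n ^ 2
            \<le> (max_entropy q - \<epsilon>\<^sup>2 / 4) * real n ^ 2"
            using card_cross_edges_le[OF f(1) q, of n] by (simp add: algebra_simps)
          also have "\<dots> \<le> (max_entropy q - 2 * c) * real n ^ 2" using c by (intro mult_right_mono) auto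
          finally show ?thesis by simp
        qed
        finally show ?thesis by (simp add: mult_ac)
      qed
      with finH show "finite (?H C) \<and> real (card (?H C)) \<le> 2 * 4 ^ n * exp ((max_entropy q - 2 * c) * real n ^ 2)"
        by blast
    next
      fix G assume "G \<in> {G \<in> graphs_on n. few_cliques n (q + 1) \<gamma> G \<and>
        (\<nexists>f. structured \<epsilon> n q f G)}"
      then show "\<exists>C\<in>\<C>. G \<in> ?H C" using C(5)[of G] by blast
    qed
    then show "real (card {G \<in> graphs_on n. few_cliques n (q + 1) \<gamma> G \<and>
      (\<nexists>f. structured \<epsilon> n q f G)}) \<le> exp ((max_entropy q - c) * real n ^ 2)" by simp
  qed
qed

section \<open>The Gibbs measure\<close>

lemma max_entropy_nonneg: "q \<ge> 1 \<Longrightarrow> max_entropy q \<ge> 0"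
  by (simp add: max_entropy_def)

lemma card_residue_class_le:
  assumes "q \<ge> 1"
  shows "real (card {v \<in> {1..n}. v mod q = j}) \<le> real n / real q + 1"
proof -
  have "card {v \<in> {1..n}. v mod q = j} \<le> card {0..n div q}"
  proof (rule card_inj_on_le[of "\<lambda>v. v div q"])
    show "inj_on (\<lambda>v. v div q) {v \<in> {1..n}. v mod q = j}"
    proof (rule inj_onI)
      fix x y assume "x \<in> {v \<in> {1..n}. v mod q = j}" "y \<in> {v \<in> {1..n}. v mod q = j}" "x div q = y div q"
      then show "x = y" using div_mult_mod_eq[of x q] div_mult_mod_eq[of y q] by simp
    qed
  qed (auto simp: div_le_mono)
  also have "\<dots> = n div q + 1" by simp
  finally have "real (card {v \<in> {1..n}. v mod q = j}) \<le> real (n div q) + 1" by linarith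
  also have "real (n div q) \<le> real n / real q" by (rule of_nat_div_le_of_nat)
  finally show ?thesis by simp
qed

text \<open>Residues modulo \<open>q\<close> give classes of size at most \<open>n / q + 1\<close>;
  the \<open>+ 1\<close> is the origin of the linear loss.\<close>

lemma balanced_colouring_exists:
  assumes q: "q \<ge> 1"
  shows "\<exists>f. (\<forall>v. f v \<in> {1..q}) \<and>
    max_entropy q * real n ^ 2 - real n * ln 2 / 2 \<le> real (card (cross_edges n f)) * ln 2"
proof (intro exI conjI)
  let ?f = "\<lambda>v. v mod q + 1"
  show "\<forall>v. ?f v \<in> {1..q}" using q by (auto simp: Suc_le_eq)
  have "real n * (real n - (real n / real q + 1)) = (\<Sum>u\<in>{1..n}. real n - (real n / real q + 1))" by simp
  also have "\<dots> \<le> (\<Sum>u\<in>{1..n}. real n - real (card (colour_class n ?f (?f u))))"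
    by (intro sum_mono diff_left_mono) (use card_residue_class_le[OF q] in \<open>simp add: colour_class_def\<close>)
  also have "\<dots> = 2 * real (card (cross_edges n ?f))" by (rule twice_card_cross_edges[symmetric])
  finally have "real n * (real n - (real n / real q + 1)) / 2 \<le> real (card (cross_edges n ?f))" by simp
  then have "real n * (real n - (real n / real q + 1)) / 2 * ln 2 \<le> real (card (cross_edges n ?f)) * ln 2"
    by (intro mult_right_mono) auto
  also have "real n * (real n - (real n / real q + 1)) / 2 * ln 2 = max_entropy q * real n ^ 2 - real n * ln 2 / 2"
    using q by (simp add: max_entropy_def power2_eq_square field_simps)
  finally show "max_entropy q * real n ^ 2 - real n * ln 2 / 2 \<le> real (card (cross_edges n ?f)) * ln 2" .
qed

lemma clique_count_eq_0:
  assumes f: "\<forall>v. f v \<in> {1..q}" and G: "G \<subseteq> cross_edges n f"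
  shows "clique_count n (q + 1) G = 0"
proof -
  have "\<not> (S \<subseteq> {1..n} \<and> card S = q + 1 \<and> (\<forall>u\<in>S. \<forall>v\<in>S. u \<noteq> v \<longrightarrow> {u, v} \<in> G))" for S
  proof (intro notI, elim conjE)
    assume S: "S \<subseteq> {1..n}" "card S = q + 1" "\<forall>u\<in>S. \<forall>v\<in>S. u \<noteq> v \<longrightarrow> {u, v} \<in> G"
    have "card (f ` S) \<le> card {1..q}" using f by (intro card_mono) auto
    then have "\<not> inj_on f S" using S(2) by (intro pigeonhole) simp
    then obtain u v where uv: "u \<in> S" "v \<in> S" "u \<noteq> v" "f u = f v" by (auto simp: inj_on_def)
    then have "{u, v} \<in> cross_edges n f" using S(3) G by blast
    then show False using uv by (simp add: doubleton_in_cross_edges)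
  qed
  then show ?thesis by (simp add: clique_count_def)
qed

lemma reduced_partition_function_ge:
  assumes q: "q \<ge> 1"
  shows "exp (max_entropy q * real n ^ 2 - real n * ln 2 / 2) \<le> reduced_partition_function n (q + 1) w"
proof -
  obtain f where f: "\<forall>v. f v \<in> {1..q}"
    "max_entropy q * real n ^ 2 - real n * ln 2 / 2 \<le> real (card (cross_edges n f)) * ln 2"
    using balanced_colouring_exists[OF q] by blast
  have "exp (max_entropy q * real n ^ 2 - real n * ln 2 / 2) \<le> exp (real (card (cross_edges n f)) * ln 2)"
    using f(2) by simp
  also have "\<dots> = real (card (Pow (cross_edges n f)))"
    by (simp add: card_Pow two_power_eq_exp)
  also have "\<dots> = (\<Sum>G\<in>Pow (cross_edges n f). exp (- (fact (q + 1) * w * real (clique_count n (q + 1) G))))"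
    using clique_count_eq_0[OF f(1)] by simp
  also have "\<dots> \<le> reduced_partition_function n (q + 1) w"
    unfolding reduced_partition_function_def
    by (intro sum_mono2 finite_graphs_on) (auto simp: graphs_on_iff cross_edges_def)
  finally show ?thesis .
qed

lemma card_graphs_on_le: "real (card (graphs_on n)) \<le> exp (ln 2 * real n ^ 2)"
proof -
  have "graphs_on n = Pow (all_edges n)" by (auto simp: graphs_on_iff)
  then have "real (card (graphs_on n)) = exp (real (card (all_edges n)) * ln 2)"
    by (simp add: card_Pow two_power_eq_exp)
  also have "\<dots> \<le> exp (ln 2 * real n ^ 2)"
    using mult_right_mono[OF card_all_edges_le, of "ln 2" n] by (simp add: mult.commute)
  finally show ?thesis .
qed

text \<open>Graphs with few cliques have weight at most 1 and are merely counted, so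
  \<open>w\<close> appears in the second summand only. This is what keeps the rate \<open>c\<close>
  independent of \<open>w\<close>.\<close>

lemma gibbs_weight_sum_le:
  assumes B: "B \<subseteq> graphs_on n" and w: "w > 0" and \<gamma>: "\<gamma> > 0"
  shows "(\<Sum>G\<in>B. exp (- (fact r * w * real (clique_count n r G)))) \<le>
    real (card {G \<in> B. few_cliques n r \<gamma> G})
    + exp (ln 2 * real n ^ 2 - w * \<gamma> * real n ^ r)"
proof -
  let ?K = "\<lambda>G. real (clique_count n r G)"
  let ?A = "{G \<in> B. ?K G \<le> \<gamma> * real n ^ r}"
  have finB: "finite B" using B finite_graphs_on finite_subset by blast
  have "exp (- (fact r * w * ?K G)) \<le> (if ?K G \<le> \<gamma> * real n ^ r then 1 else 0) + exp (- (w * \<gamma> * real n ^ r))" for G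
  proof (cases "?K G \<le> \<gamma> * real n ^ r")
    case True
    have "exp (- (fact r * w * ?K G)) \<le> 1" using w by simp
    then show ?thesis using True by (simp add: add_increasing2)
  next
    case False
    have "w * \<gamma> * real n ^ r \<le> w * ?K G" using False w by simp
    also have "\<dots> \<le> fact r * (w * ?K G)"
      using w mult_right_mono[OF fact_ge_1[of r, where ?'a = real], of "w * ?K G"] by simp
    finally show ?thesis using False by (simp add: mult.assoc)
  qed
  then have "(\<Sum>G\<in>B. exp (- (fact r * w * ?K G))) \<le>
    (\<Sum>G\<in>B. (if ?K G \<le> \<gamma> * real n ^ r then 1 else 0) + exp (- (w * \<gamma> * real n ^ r)))"
    by (rule sum_mono)
  also have "\<dots> = real (card ?A) + real (card B) * exp (- (w * \<gamma> * real n ^ r))"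
    using finB by (simp add: sum.distrib sum.If_cases Int_def)
  also have "real (card B) \<le> exp (ln 2 * real n ^ 2)"
    using card_graphs_on_le[of n] of_nat_mono[OF card_mono[OF finite_graphs_on B], where ?'a = real] by linarith
  finally show ?thesis by (simp add: exp_diff exp_minus field_simps)
qed

text \<open>For \<open>r \<ge> 3\<close> the power \<open>n ^ r\<close> exceeds \<open>n ^ 2\<close>
  by a factor of at least \<open>n\<close>. The threshold \<open>2 / (w * \<gamma>)\<close> for this
  factor is where the bound on \<open>n\<close> comes to depend on \<open>w\<close>.\<close>

lemma heavy_weight_negligible:
  assumes w: "(w::real) > 0" and \<gamma>: "\<gamma> > 0" and r: "r \<ge> 3"
  shows "\<exists>N. \<forall>n\<ge>N. exp (ln 2 * real n ^ 2 - w * \<gamma> * real n ^ r) \<le> exp (- (real n ^ 2))"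
proof -
  obtain N :: nat where N: "2 / (w * \<gamma>) < real N" using reals_Archimedean2 by blast
  show ?thesis
  proof (intro exI[of _ "max 1 N"] allI impI)
    fix n assume n: "n \<ge> max 1 N"
    have "2 / (w * \<gamma>) \<le> real n" using N n by linarith
    then have "2 \<le> w * \<gamma> * real n" using w \<gamma> by (simp add: field_simps)
    then have "2 * real n ^ 2 \<le> w * \<gamma> * real n * real n ^ 2" by (intro mult_right_mono) auto
    also have "\<dots> = w * \<gamma> * real n ^ 3" by (simp add: power2_eq_square power3_eq_cube)
    also have "\<dots> \<le> w * \<gamma> * real n ^ r" using n w \<gamma> r by (intro mult_left_mono power_increasing) auto
    finally have "2 * real n ^ 2 \<le> w * \<gamma> * real n ^ r" .
    moreover have "ln 2 * real n ^ 2 \<le> 1 * real n ^ 2"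
      using ln2_le_25_over_36 by (intro mult_right_mono) auto
    ultimately have "ln 2 * real n ^ 2 - w * \<gamma> * real n ^ r \<le> - (real n ^ 2)" by linarith
    then show "exp (ln 2 * real n ^ 2 - w * \<gamma> * real n ^ r) \<le> exp (- (real n ^ 2))" by simp
  qed
qed

lemma reduced_partition_function_pos: "reduced_partition_function n r w > 0"
proof -
  have "{} \<in> graphs_on n" by (simp add: graphs_on_def)
  then show ?thesis unfolding reduced_partition_function_def
    by (intro sum_pos) (auto simp: finite_graphs_on)
qed

text \<open>Heavy graphs at most double the bound obtained by counting, and the balanced colouring
  loses a term linear in \<open>n\<close>. Both errors vanish after division by
  \<open>n ^ 2\<close>.\<close>

theorem reduced_free_energy_limit:
  assumes w: "w > 0" and q: "q \<ge> 2"
  shows "(\<lambda>n. reduced_free_energy n (q + 1) w) \<longlonglongrightarrow> max_entropy q"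
proof (rule LIMSEQ_I)
  fix e :: real assume e: "e > 0"
  then have e3: "e / 3 > 0" by simp
  have q1: "q \<ge> 1" using q by simp
  obtain \<gamma> N1 where \<gamma>: "\<gamma> > 0" and N1: "\<And>n. n \<ge> N1 \<Longrightarrow>
    real (card {G \<in> graphs_on n. few_cliques n (q + 1) \<gamma> G})
    \<le> exp ((max_entropy q + e / 3) * real n ^ 2)"
    using card_few_cliques_le[OF e3 q1] by blast
  have q3: "q + 1 \<ge> 3" using q by simp
  obtain N2 where N2: "\<And>n. n \<ge> N2 \<Longrightarrow> exp (ln 2 * real n ^ 2 - w * \<gamma> * real n ^ (q + 1)) \<le> exp (- (real n ^ 2))"
    using heavy_weight_negligible[OF w \<gamma> q3] by blast
  obtain N3 :: nat where N3: "3 / e < real N3" using reals_Archimedean2 by blast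
  show "\<exists>no. \<forall>n\<ge>no. norm (reduced_free_energy n (q + 1) w - max_entropy q) < e"
  proof (intro exI[of _ "max 1 (max N1 (max N2 N3))"] allI impI)
    fix n assume n: "n \<ge> max 1 (max N1 (max N2 N3))"
    let ?Z = "reduced_partition_function n (q + 1) w"
    have n0: "real n > 0" "real n \<ge> 1" using n by auto
    have n3: "1 / real n < e / 3"
    proof -
      have "3 / e < real n" using N3 n by linarith
      then show ?thesis using e n0 by (simp add: field_simps)
    qed
    have n3': "1 / real n ^ 2 \<le> 1 / real n" using n0 by (simp add: power2_eq_square field_simps)
    have "?Z \<le> exp ((max_entropy q + e / 3) * real n ^ 2) + exp (- (real n ^ 2))"
      using gibbs_weight_sum_le[OF order_refl w \<gamma>, where n = n and r = "q + 1"] N1[of n] N2[of n] n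
      unfolding reduced_partition_function_def by linarith
    also have "\<dots> \<le> 2 * exp ((max_entropy q + e / 3) * real n ^ 2)"
    proof -
      have "- (real n ^ 2) \<le> (max_entropy q + e / 3) * real n ^ 2"
        using max_entropy_nonneg[OF q1] e by (auto intro!: order_trans[of "- (real n ^ 2)" 0 "(max_entropy q + e / 3) * real n ^ 2"])
      then have "exp (- (real n ^ 2)) \<le> exp ((max_entropy q + e / 3) * real n ^ 2)"
        by (simp only: exp_le_cancel_iff)
      then show ?thesis by linarith
    qed
    finally have Z: "?Z \<le> 2 * exp ((max_entropy q + e / 3) * real n ^ 2)" .
    have "ln ?Z \<le> ln (2 * exp ((max_entropy q + e / 3) * real n ^ 2))"
      by (rule ln_mono[OF Z reduced_partition_function_pos])
    also have "\<dots> = ln 2 + (max_entropy q + e / 3) * real n ^ 2"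
      by (subst ln_mult_pos) (simp_all only: ln_exp exp_gt_zero zero_less_numeral)
    finally have up: "ln ?Z \<le> ln 2 + (max_entropy q + e / 3) * real n ^ 2" .
    have lo: "max_entropy q * real n ^ 2 - real n * ln 2 / 2 \<le> ln ?Z"
      unfolding ln_ge_iff[OF reduced_partition_function_pos] by (rule reduced_partition_function_ge[OF q1])
    have "reduced_free_energy n (q + 1) w \<le> (ln 2 + (max_entropy q + e / 3) * real n ^ 2) / real n ^ 2"
      unfolding reduced_free_energy_def using up by (intro divide_right_mono) auto
    also have "\<dots> = ln 2 * (1 / real n ^ 2) + max_entropy q + e / 3" using n0 by (simp add: field_simps)
    also have "ln 2 * (1 / real n ^ 2) \<le> 1 * (1 / real n ^ 2)"
      using ln2_le_25_over_36 by (intro mult_right_mono) auto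
    finally have 1: "reduced_free_energy n (q + 1) w < max_entropy q + e" using n3 n3' e by linarith
    have "reduced_free_energy n (q + 1) w \<ge> (max_entropy q * real n ^ 2 - real n * ln 2 / 2) / real n ^ 2"
      unfolding reduced_free_energy_def using lo by (intro divide_right_mono) auto
    also have "(max_entropy q * real n ^ 2 - real n * ln 2 / 2) / real n ^ 2 = max_entropy q - ln 2 / 2 * (1 / real n)"
      using n0 by (simp add: field_simps power2_eq_square)
    finally have 2: "max_entropy q - ln 2 / 2 * (1 / real n) \<le> reduced_free_energy n (q + 1) w" .
    have "ln 2 / 2 * (1 / real n) \<le> 1 * (1 / real n)"
      using ln2_le_25_over_36 n0 by (intro mult_right_mono) auto
    then show "norm (reduced_free_energy n (q + 1) w - max_entropy q) < e"
      using 1 2 n3 e by (simp add: abs_less_iff)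
  qed
qed

text \<open>The factor \<open>exp (w * n ^ r)\<close> is common to all graphs and cancels in the
  quotient.\<close>

lemma measure_gibbs:
  assumes B: "B \<subseteq> graphs_on n"
  shows "measure (gibbs_measure n r w) B =
    (\<Sum>G\<in>B. exp (- (fact r * w * real (clique_count n r G)))) / reduced_partition_function n r w"
proof -
  let ?g = "\<lambda>G. exp (- (fact r * w * real (clique_count n r G)))"
  let ?f = "\<lambda>G. exp (w * nonclique_count n r G)"
  let ?S = "\<Sum>J\<in>graphs_on n. ?f J"
  have f: "?f G = exp (w * real n ^ r) * ?g G" for G
    by (simp add: nonclique_count_def algebra_simps flip: exp_add)
  have S: "?S = exp (w * real n ^ r) * reduced_partition_function n r w"
    unfolding f reduced_partition_function_def by (rule sum_distrib_left[symmetric])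
  have "emeasure (gibbs_measure n r w) B = (\<Sum>G\<in>B. ennreal (?f G / ?S))"
    unfolding gibbs_measure_def by (rule emeasure_point_measure_finite[OF finite_graphs_on B])
  also have "\<dots> = ennreal (\<Sum>G\<in>B. ?f G / ?S)"
    by (intro sum_ennreal) (auto intro!: divide_nonneg_nonneg sum_nonneg)
  also have "(\<Sum>G\<in>B. ?f G / ?S) = (\<Sum>G\<in>B. ?g G / reduced_partition_function n r w)"
    by (intro sum.cong refl, subst S, subst f) simp
  also have "\<dots> = (\<Sum>G\<in>B. ?g G) / reduced_partition_function n r w" by (rule sum_divide_distrib[symmetric])
  finally show ?thesis
    using reduced_partition_function_pos[of n r w]
    by (simp add: measure_def sum_nonneg)
qed

abbreviation unstructured :: "real \<Rightarrow> nat \<Rightarrow> nat \<Rightarrow> ugraph set" where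
  "unstructured \<epsilon> n q \<equiv> {G \<in> graphs_on n. \<nexists>f. structured \<epsilon> n q f G}"

text \<open>The rate and \<open>\<gamma>\<close> are obtained before \<open>w\<close> is fixed;
  afterwards \<open>w\<close> affects only the threshold for \<open>n\<close>.\<close>

lemma gibbs_unstructured:
  assumes \<epsilon>: "0 < \<epsilon>" "\<epsilon> \<le> 1" and q: "q \<ge> 2"
  shows "\<exists>c>0. \<forall>w>0. \<exists>N. \<forall>n\<ge>N.
    measure (gibbs_measure n (q + 1) w) (unstructured \<epsilon> n q) \<le> exp (- c * real n ^ 2)"
proof -
  have q1: "q \<ge> 1" and q3: "q + 1 \<ge> 3" using q by auto
  obtain c \<gamma> N1 where c: "c > 0" and \<gamma>: "\<gamma> > 0" and N1: "\<And>n. n \<ge> N1 \<Longrightarrow>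
    real (card {G \<in> graphs_on n. few_cliques n (q + 1) \<gamma> G \<and>
      (\<nexists>f. structured \<epsilon> n q f G)}) \<le> exp ((max_entropy q - c) * real n ^ 2)"
    using card_unstructured_le[OF \<epsilon> q1] by blast
  \<comment> \<open>Both summands of the numerator lie below
    \<open>exp ((max_entropy q - 2 * d) * n ^ 2)\<close>: the first as \<open>2 * d \<le> c\<close>,
    the second as \<open>2 * d \<le> 1\<close> and the entropy is nonnegative. One of the two
    \<open>d\<close> absorbs the factor 2 and the linear loss in the lower bound for the partition
    function.\<close>
  define d where "d = min c 1 / 2"
  have d: "d > 0" "2 * d \<le> c" "2 * d \<le> 1" using c by (auto simp: d_def)
  obtain N3 where N3: "\<And>n. n \<ge> N3 \<Longrightarrow> 4 ^ ((n + 1) * 0) * (2 * 4 ^ n) \<le> exp (d * real n ^ 2)"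
    using eventually_exponential_le_exp_square[OF d(1), of 0] by blast
  show ?thesis
  proof (rule exI[of _ d], intro conjI d(1) allI impI)
    fix w :: real assume w: "w > 0"
    obtain N2 where N2: "\<And>n. n \<ge> N2 \<Longrightarrow> exp (ln 2 * real n ^ 2 - w * \<gamma> * real n ^ (q + 1)) \<le> exp (- (real n ^ 2))"
      using heavy_weight_negligible[OF w \<gamma> q3] by blast
    show "\<exists>N. \<forall>n\<ge>N. measure (gibbs_measure n (q + 1) w) (unstructured \<epsilon> n q) \<le> exp (- d * real n ^ 2)"
    proof (intro exI[of _ "max N1 (max N2 N3)"] allI impI)
      fix n assume n: "n \<ge> max N1 (max N2 N3)"
      let ?Z = "reduced_partition_function n (q + 1) w"
      let ?B = "unstructured \<epsilon> n q"
      let ?K = "\<lambda>G. real (clique_count n (q + 1) G)"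
      have eq: "{G \<in> ?B. ?K G \<le> \<gamma> * real n ^ (q + 1)} =
        {G \<in> graphs_on n. ?K G \<le> \<gamma> * real n ^ (q + 1) \<and> (\<nexists>f. structured \<epsilon> n q f G)}" by blast
      have BB: "?B \<subseteq> graphs_on n" by blast
      have "(\<Sum>G\<in>?B. exp (- (fact (q + 1) * w * ?K G))) \<le>
        exp ((max_entropy q - c) * real n ^ 2) + exp (- (real n ^ 2))"
        using gibbs_weight_sum_le[OF BB w \<gamma>, of "q + 1"] N1[of n] N2[of n] n unfolding eq by linarith
      also have "\<dots> \<le> exp ((max_entropy q - 2 * d) * real n ^ 2) + exp ((max_entropy q - 2 * d) * real n ^ 2)"
      proof (intro add_mono)
        show "exp ((max_entropy q - c) * real n ^ 2) \<le> exp ((max_entropy q - 2 * d) * real n ^ 2)"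
          using d by (simp add: mult_right_mono)
        have "(-1) * real n ^ 2 \<le> (max_entropy q - 2 * d) * real n ^ 2"
          using d max_entropy_nonneg[OF q1] by (intro mult_right_mono) auto
        then show "exp (- (real n ^ 2)) \<le> exp ((max_entropy q - 2 * d) * real n ^ 2)" by simp
      qed
      finally have S: "(\<Sum>G\<in>?B. exp (- (fact (q + 1) * w * ?K G))) \<le> 2 * exp ((max_entropy q - 2 * d) * real n ^ 2)"
        by simp
      have "2 * exp (real n * ln 2 / 2) \<le> exp (d * real n ^ 2)"
      proof -
        have "exp (real n * ln 2 / 2) \<le> exp (real n * ln 4)"
        proof -
          have "ln (2::real) \<le> ln 4" "0 \<le> ln (2::real)" by auto
          then have "ln (2::real) / 2 \<le> ln 4" by linarith
          from mult_left_mono[OF this, of "real n"] show ?thesis by simp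
        qed
        also have "\<dots> = 4 ^ n" by (simp add: exp_of_nat_mult)
        finally show ?thesis using N3[of n] n by simp
      qed
      then have "2 * exp (real n * ln 2 / 2) * exp ((max_entropy q - 2 * d) * real n ^ 2 - real n * ln 2 / 2) \<le>
        exp (d * real n ^ 2) * exp ((max_entropy q - 2 * d) * real n ^ 2 - real n * ln 2 / 2)"
        by (intro mult_right_mono) auto
      then have "2 * exp ((max_entropy q - 2 * d) * real n ^ 2) \<le>
        exp (- d * real n ^ 2) * exp (max_entropy q * real n ^ 2 - real n * ln 2 / 2)"
        by (simp add: algebra_simps flip: exp_add)
      also have "\<dots> \<le> exp (- d * real n ^ 2) * ?Z"
        by (intro mult_left_mono reduced_partition_function_ge q1) auto
      finally have "(\<Sum>G\<in>?B. exp (- (fact (q + 1) * w * ?K G))) \<le> exp (- d * real n ^ 2) * ?Z"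
        using S by linarith
      then show "measure (gibbs_measure n (q + 1) w) ?B \<le> exp (- d * real n ^ 2)"
        unfolding measure_gibbs[OF BB]
        using reduced_partition_function_pos[of n "q + 1" w] by (simp add: pos_divide_le_eq)
    qed
  qed
qed

section \<open>Partitions of structured graphs\<close>

lemma vertex_partition_colour_class:
  assumes "\<forall>v. f v \<in> {1..q}"
  shows "vertex_partition n q (colour_class n f)"
  using assms by (auto simp: vertex_partition_def colour_class_def disjoint_family_on_def)

lemma subset_colour_class_iff:
  assumes "e \<in> all_edges n" and f: "\<forall>v. f v \<in> {1..q}"
  shows "(\<exists>i\<in>{1..q}. e \<subseteq> colour_class n f i) \<longleftrightarrow> e \<in> inner_edges n f"
proof
  assume "e \<in> inner_edges n f"
  then obtain i where i: "\<forall>v\<in>e. f v = i" by (auto simp: inner_edges_def)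
  obtain v where "v \<in> e" using assms(1) by (force simp: all_edges_def)
  then have "i \<in> {1..q}" using f i by auto
  moreover have "e \<subseteq> colour_class n f i" using i assms(1) by (auto simp: colour_class_def all_edges_def)
  ultimately show "\<exists>i\<in>{1..q}. e \<subseteq> colour_class n f i" by blast
qed (use assms(1) in \<open>auto simp: inner_edges_def colour_class_def\<close>)

lemma delete_inner_edges_colour_class:
  assumes G: "G \<in> graphs_on n" and f: "\<forall>v. f v \<in> {1..q}"
  shows "delete_inner_edges q (colour_class n f) G = G - inner_edges n f"
  using G subset_colour_class_iff[OF _ f] unfolding delete_inner_edges_def graphs_on_iff by blast

lemma sum_edges_within_colour_class:
  assumes G: "G \<in> graphs_on n" and f: "\<forall>v. f v \<in> {1..q}"
  shows "(\<Sum>i\<in>{1..q}. edges_within G (colour_class n f i)) = card (G \<inter> inner_edges n f)"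
proof -
  have ne: "e \<noteq> {}" if "e \<in> G" for e using that G by (auto simp: graphs_on_def)
  have "G \<inter> inner_edges n f = (\<Union>i\<in>{1..q}. {e \<in> G. e \<subseteq> colour_class n f i})"
    using G subset_colour_class_iff[OF _ f] unfolding graphs_on_iff by blast
  also have "card \<dots> = (\<Sum>i\<in>{1..q}. card {e \<in> G. e \<subseteq> colour_class n f i})"
  proof (rule card_UN_disjoint)
    show "\<forall>i\<in>{1..q}. finite {e \<in> G. e \<subseteq> colour_class n f i}" using finite_graph[OF G] by simp
    show "\<forall>i\<in>{1..q}. \<forall>j\<in>{1..q}. i \<noteq> j \<longrightarrow>
        {e \<in> G. e \<subseteq> colour_class n f i} \<inter> {e \<in> G. e \<subseteq> colour_class n f j} = {}"
    proof (intro ballI impI)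
      fix i j :: nat assume "i \<noteq> j"
      then have "colour_class n f i \<inter> colour_class n f j = {}" by (auto simp: colour_class_def)
      then show "{e \<in> G. e \<subseteq> colour_class n f i} \<inter> {e \<in> G. e \<subseteq> colour_class n f j} = {}"
        using ne by blast
    qed
  qed simp
  finally show ?thesis by (simp add: edges_within_def)
qed

text \<open>Literally the condition in the theorem, so that the theorem follows by unfolding.
  Nonempty parts exclude densities that are 0 only through division by zero.\<close>

abbreviation (input) good_partition :: "real \<Rightarrow> nat \<Rightarrow> nat \<Rightarrow> ugraph \<Rightarrow> (nat \<Rightarrow> nat set) \<Rightarrow> bool" where
  "good_partition \<epsilon> n q G V \<equiv> vertex_partition n q V \<and> (\<forall>i\<in>{1..q}. V i \<noteq> {}) \<and>
    (\<forall>i\<in>{1..q}. \<bar>real (card (V i)) - real n / real q\<bar> \<le> \<epsilon> * real n) \<and>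
    (\<forall>i\<in>{1..q}. \<forall>j\<in>{1..q}. i \<noteq> j \<longrightarrow>
      \<bar>real (edges_between G (V i) (V j)) / (real (card (V i)) * real (card (V j))) - 1 / 2\<bar> \<le> \<epsilon>) \<and>
    real (\<Sum>i\<in>{1..q}. edges_within G (V i)) \<le> \<epsilon> * (real n)\<^sup>2 / (10 * real q) \<and>
    real (\<Sum>i\<in>{1..q}. edges_within G (V i)) / real (\<Sum>i\<in>{1..q}. card (V i) choose 2) \<le> \<epsilon> \<and>
    q_partite n q (delete_inner_edges q V G) \<and>
    edit_dist n G (delete_inner_edges q V G) \<le> \<epsilon> / (10 * real q) \<and>
    \<epsilon> / (10 * real q) \<le> \<epsilon> / 2"

text \<open>All classes have size at least \<open>n / (2 * q)\<close>, which is at least 2. Every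
  normalisation in the conclusion therefore loses at most the factor \<open>16 * q ^ 2\<close>, and
  \<open>\<epsilon>'\<close> is smaller than \<open>\<epsilon>\<close> by that factor.\<close>

lemma structured_imp_partition:
  assumes st: "structured \<epsilon>' n q f G" and G: "G \<in> graphs_on n" and q: "q \<ge> 2"
    and n: "n \<ge> 4 * q" and \<epsilon>': "0 < \<epsilon>'" "\<epsilon>' \<le> 1 / (16 * real q ^ 2)" "\<epsilon>' \<le> \<epsilon> / (16 * real q ^ 2)"
  defines "V \<equiv> colour_class n f"
  shows "good_partition \<epsilon> n q G V"
proof -
  have f: "\<forall>v. f v \<in> {1..q}"
    and bal: "\<And>i. i \<in> {1..q} \<Longrightarrow> \<bar>real (card (V i)) - real n / real q\<bar> \<le> \<epsilon>' * real n"
    and inner: "real (card (G \<inter> inner_edges n f)) \<le> \<epsilon>' * real n ^ 2"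
    and disc: "\<And>S T. S \<subseteq> {1..n} \<Longrightarrow> T \<subseteq> {1..n} \<Longrightarrow> (\<forall>u\<in>S. \<forall>v\<in>T. f u \<noteq> f v) \<Longrightarrow>
      \<bar>real (edges_between G S T) - real (card S) * real (card T) / 2\<bar> \<le> \<epsilon>' * real n ^ 2"
    using st unfolding structured_def V_def by auto
  have q2: "real q \<ge> 2" and n4: "real n \<ge> 4 * real q" using q n by linarith+
  have n0: "real n > 0" using q2 n4 by linarith
  have \<epsilon>0: "\<epsilon> > 0"
  proof -
    have "0 < \<epsilon> / (16 * real q ^ 2)" using \<epsilon>'(1,3) by linarith
    then show ?thesis using q2 by (simp add: zero_less_divide_iff)
  qed
  have e16: "\<epsilon>' * (16 * real q ^ 2) \<le> \<epsilon>" using \<epsilon>'(3) q2 by (simp add: pos_le_divide_eq)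
  have qq: "real q \<le> real q ^ 2" using q2 by (simp add: power2_eq_square)
  have le_eps: "\<epsilon>' * c \<le> \<epsilon>" if "c \<le> 16 * real q ^ 2" for c
    using e16 mult_left_mono[OF that, of \<epsilon>'] \<epsilon>'(1) by linarith
  have e10: "\<epsilon>' \<le> \<epsilon> / (10 * real q)"
    using le_eps[of "10 * real q"] qq q2 by (simp add: pos_le_divide_eq)
  have small: "\<epsilon>' \<le> 1 / (2 * real q)"
  proof -
    have "2 * real q \<le> 16 * real q ^ 2" using qq q2 by linarith
    then have "1 / (16 * real q ^ 2) \<le> 1 / (2 * real q)" using q2 by (intro divide_left_mono) auto
    then show ?thesis using \<epsilon>'(2) by linarith
  qed
  have size: "real (card (V i)) \<ge> real n / (2 * real q)" if "i \<in> {1..q}" for i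
  proof -
    have "\<epsilon>' * real n \<le> 1 / (2 * real q) * real n" using small by (intro mult_right_mono) auto
    then have "\<epsilon>' * real n \<le> real n / (2 * real q)" by simp
    moreover have "real n / real q - real n / (2 * real q) = real n / (2 * real q)" by (simp add: field_simps)
    ultimately show ?thesis using bal[OF that] by linarith
  qed
  have size2: "real n / (2 * real q) \<ge> 2" using n4 q2 by (simp add: field_simps)
  have part: "vertex_partition n q V" unfolding V_def by (rule vertex_partition_colour_class[OF f])
  have nonempty: "V i \<noteq> {}" if "i \<in> {1..q}" for i using size[OF that] size2 by auto
  have balanced: "\<bar>real (card (V i)) - real n / real q\<bar> \<le> \<epsilon> * real n" if "i \<in> {1..q}" for i
  proof -
    have "\<epsilon>' * real n \<le> \<epsilon> * real n" using le_eps[of 1] qq q2 by (intro mult_right_mono) auto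
    then show ?thesis using bal[OF that] by linarith
  qed
  have density: "\<bar>real (edges_between G (V i) (V j)) / (real (card (V i)) * real (card (V j))) - 1 / 2\<bar> \<le> \<epsilon>"
    if ij: "i \<in> {1..q}" "j \<in> {1..q}" "i \<noteq> j" for i j
  proof -
    define P where "P = real (card (V i)) * real (card (V j))"
    have "(real n / (2 * real q)) * (real n / (2 * real q)) \<le> P"
      unfolding P_def using size[OF ij(1)] size[OF ij(2)] n0 q2 by (intro mult_mono) auto
    then have P: "real n ^ 2 \<le> P * (4 * real q ^ 2)" using q2 by (simp add: power2_eq_square field_simps)
    have P0: "P > 0"
      unfolding P_def using size[OF ij(1)] size[OF ij(2)] size2 by (intro mult_pos_pos) linarith+
    have "\<bar>real (edges_between G (V i) (V j)) - P / 2\<bar> \<le> \<epsilon>' * real n ^ 2"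
      unfolding P_def by (rule disc) (use ij in \<open>auto simp: V_def colour_class_def\<close>)
    also have "\<dots> \<le> \<epsilon>' * (P * (4 * real q ^ 2))" using P \<epsilon>'(1) by simp
    also have "\<dots> = \<epsilon>' * (4 * real q ^ 2) * P" by simp
    also have "\<dots> \<le> \<epsilon> * P" using le_eps[of "4 * real q ^ 2"] P0 by (intro mult_right_mono) auto
    finally have *: "\<bar>real (edges_between G (V i) (V j)) - P / 2\<bar> \<le> \<epsilon> * P" .
    have "real (edges_between G (V i) (V j)) / P - 1 / 2 = (real (edges_between G (V i) (V j)) - P / 2) / P"
      using P0 by (simp add: field_simps)
    then have "\<bar>real (edges_between G (V i) (V j)) / P - 1 / 2\<bar> = \<bar>real (edges_between G (V i) (V j)) - P / 2\<bar> / P"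
      using P0 by simp
    also have "\<dots> \<le> \<epsilon>" using * P0 by (simp add: pos_divide_le_eq)
    finally show ?thesis by (simp add: P_def)
  qed
  have within: "(\<Sum>i\<in>{1..q}. edges_within G (V i)) = card (G \<inter> inner_edges n f)"
    unfolding V_def by (rule sum_edges_within_colour_class[OF G f])
  have c: "real (card (G \<inter> inner_edges n f)) \<le> \<epsilon> * (real n)\<^sup>2 / (10 * real q)"
    using inner mult_right_mono[OF e10, of "real n ^ 2"] by simp
  \<comment> \<open>A single class already makes the denominator at least
    \<open>n ^ 2 / (16 * q ^ 2)\<close>, which is where the 16 comes from.\<close>
  have d: "real (card (G \<inter> inner_edges n f)) / real (\<Sum>i\<in>{1..q}. card (V i) choose 2) \<le> \<epsilon>"
  proof -
    have one: "1 \<in> {1..q}" using q by simp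
    define a where "a = card (V 1)"
    have a: "real a \<ge> real n / (2 * real q)" "real a \<ge> 2" using size[OF one] size2 by (auto simp: a_def)
    have "real n ^ 2 / (16 * real q ^ 2) = (real n / (2 * real q)) * (real n / (2 * real q)) / 4"
      by (simp add: power2_eq_square)
    also have "\<dots> \<le> real a * real a / 4"
      using a n0 q2 by (intro divide_right_mono mult_mono) auto
    \<comment> \<open>Because \<open>a \<ge> 2\<close>, half of \<open>a\<close> is at most
      \<open>a - 1\<close>; this is the reason for \<open>n \<ge> 4 * q\<close>.\<close>
    also have "\<dots> \<le> real a * (real a - 1) / 2"
      using mult_left_mono[OF a(2), of "real a"] by (simp add: algebra_simps)
    also have "\<dots> = real (a choose 2)"
    proof -
      have "even (a * (a - 1))" by auto
      then have "real (a choose 2) = real (a * (a - 1)) / 2"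
        using real_of_nat_div[of 2 "a * (a - 1)"] unfolding choose_two by simp
      then show ?thesis using a(2) by (simp add: of_nat_diff)
    qed
    also have "\<dots> \<le> real (\<Sum>i\<in>{1..q}. card (V i) choose 2)"
      unfolding of_nat_le_iff a_def by (rule member_le_sum[OF one]) auto
    finally have S: "real n ^ 2 / (16 * real q ^ 2) \<le> real (\<Sum>i\<in>{1..q}. card (V i) choose 2)" .
    have S0: "0 < real (\<Sum>i\<in>{1..q}. card (V i) choose 2)"
      by (rule less_le_trans[OF _ S]) (use n0 q2 in simp)
    have "real (card (G \<inter> inner_edges n f)) \<le> \<epsilon>' * (16 * real q ^ 2) * (real n ^ 2 / (16 * real q ^ 2))"
      using inner q2 by simp
    also have "\<dots> \<le> \<epsilon> * real (\<Sum>i\<in>{1..q}. card (V i) choose 2)"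
      using e16 S \<epsilon>0 by (intro mult_mono) auto
    finally show ?thesis using S0 by (simp only: pos_divide_le_eq)
  qed
  have del: "delete_inner_edges q V G = G - inner_edges n f"
    unfolding V_def by (rule delete_inner_edges_colour_class[OF G f])
  have qp: "q_partite n q (delete_inner_edges q V G)"
    unfolding q_partite_def by (rule exI[of _ V]) (use part in \<open>auto simp: delete_inner_edges_def\<close>)
  have "G - delete_inner_edges q V G \<union> (delete_inner_edges q V G - G) = G \<inter> inner_edges n f"
    unfolding del by blast
  then have ed: "edit_dist n G (delete_inner_edges q V G) \<le> \<epsilon> / (10 * real q)"
    unfolding edit_dist_def using c n0 by (simp add: pos_divide_le_eq)
  have "\<epsilon> / (10 * real q) \<le> \<epsilon> / 2" using \<epsilon>0 q2 by (intro divide_left_mono) auto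
  then show ?thesis using part nonempty balanced density c d qp ed unfolding within by blast
qed

lemma gibbs_partition:
  assumes \<epsilon>: "\<epsilon> > 0" and q: "q \<ge> 2"
  shows "\<exists>c>0. \<forall>w>0. \<exists>N. \<forall>n\<ge>N.
    measure (gibbs_measure n (q + 1) w)
      {G \<in> graphs_on n. \<exists>V. good_partition \<epsilon> n q G V} \<ge> 1 - exp (- c * (real n)\<^sup>2)"
proof -
  define \<epsilon>' where "\<epsilon>' = min 1 \<epsilon> / (16 * real q ^ 2)"
  have q2: "real q \<ge> 2" using q by simp
  have "1 \<le> real q ^ 2" using q2 by (intro one_le_power) simp
  then have "1 \<le> 16 * real q ^ 2" by linarith
  then have "min 1 \<epsilon> / (16 * real q ^ 2) \<le> 1" using \<epsilon> q2 by (subst pos_divide_le_eq) auto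
  then have \<epsilon>': "0 < \<epsilon>'" "\<epsilon>' \<le> 1" "\<epsilon>' \<le> 1 / (16 * real q ^ 2)" "\<epsilon>' \<le> \<epsilon> / (16 * real q ^ 2)"
    using \<epsilon> q2 unfolding \<epsilon>'_def by (auto intro!: divide_right_mono divide_pos_pos)
  obtain c where c: "c > 0" and st: "\<And>w. w > 0 \<Longrightarrow> \<exists>N. \<forall>n\<ge>N.
    measure (gibbs_measure n (q + 1) w) (unstructured \<epsilon>' n q) \<le> exp (- c * real n ^ 2)"
    using gibbs_unstructured[OF \<epsilon>'(1,2) q] by blast
  show ?thesis
  proof (rule exI[of _ c], intro conjI c allI impI)
    fix w :: real assume "w > 0"
    then obtain N where N: "\<And>n. n \<ge> N \<Longrightarrow> measure (gibbs_measure n (q + 1) w)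
      (unstructured \<epsilon>' n q) \<le> exp (- c * real n ^ 2)"
      using st by blast
    show "\<exists>N. \<forall>n\<ge>N. measure (gibbs_measure n (q + 1) w) {G \<in> graphs_on n. \<exists>V. good_partition \<epsilon> n q G V} \<ge> 1 - exp (- c * (real n)\<^sup>2)"
    proof (intro exI[of _ "max N (4 * q)"] allI impI)
      fix n assume n: "n \<ge> max N (4 * q)"
      let ?M = "gibbs_measure n (q + 1) w"
      let ?A = "{G \<in> graphs_on n. \<exists>V. good_partition \<epsilon> n q G V}"
      let ?B = "unstructured \<epsilon>' n q"
      interpret prob_space ?M by (rule prob_space_gibbs_measure)
      have sets: "sets ?M = Pow (graphs_on n)" "space ?M = graphs_on n"
        by (auto simp: gibbs_measure_def sets_point_measure space_point_measure)
      have "graphs_on n - ?A \<subseteq> ?B"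
      proof (rule subsetI)
        fix G assume "G \<in> graphs_on n - ?A"
        then have G: "G \<in> graphs_on n" "\<nexists>V. good_partition \<epsilon> n q G V" by blast+
        have "\<not> structured \<epsilon>' n q f G" for f
        proof
          assume "structured \<epsilon>' n q f G"
          then have "good_partition \<epsilon> n q G (colour_class n f)"
            by (rule structured_imp_partition[OF _ G(1) q _ \<epsilon>'(1,3,4)]) (use n in simp)
          then show False using G(2) by blast
        qed
        then show "G \<in> ?B" using G(1) by blast
      qed
      then have "measure ?M (space ?M - ?A) \<le> measure ?M ?B"
        unfolding sets(2) by (rule finite_measure_mono) (unfold sets, blast)
      also have "\<dots> \<le> exp (- c * real n ^ 2)" using N n by simp
      also have "measure ?M (space ?M - ?A) = 1 - measure ?M ?A"
        by (rule prob_compl) (unfold sets, blast)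
      finally show "measure ?M ?A \<ge> 1 - exp (- c * (real n)\<^sup>2)" by simp
    qed
  qed
qed

section \<open>Lebesgue measure on the unit square\<close>

text \<open>Lebesgue measure on the plane is the completion of a product of Borel measures, not a
  product of completions. Each factor is split into a Borel set and a null part; what the product of
  the Borel parts misses lies in strips \<open>N \<times> UNIV\<close> and
  \<open>UNIV \<times> N'\<close>, which are null because zero times infinity is zero.\<close>

lemma lebesgue_Times:
  fixes S T :: "real set"
  assumes S: "S \<in> sets lebesgue" and T: "T \<in> sets lebesgue"
  shows sets_lebesgue_Times: "S \<times> T \<in> sets lebesgue"
    and emeasure_lebesgue_Times: "emeasure lebesgue (S \<times> T) = emeasure lebesgue S * emeasure lebesgue T"
proof -
  let ?mS = "main_part lborel S" and ?mT = "main_part lborel T"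
  obtain N where N: "N \<in> null_sets lborel" "null_part lborel S \<subseteq> N" using null_part[OF S] by blast
  obtain N' where N': "N' \<in> null_sets lborel" "null_part lborel T \<subseteq> N'" using null_part[OF T] by blast
  define R where "R = S \<times> T - ?mS \<times> ?mT"
  have SS: "S = ?mS \<union> null_part lborel S" and TT: "T = ?mT \<union> null_part lborel T"
    using main_part_null_part_Un[OF S] main_part_null_part_Un[OF T] by auto
  have R: "R \<subseteq> N \<times> UNIV \<union> UNIV \<times> N'" using SS TT N(2) N'(2) by (auto simp: R_def)
  have borelN: "N \<in> sets lborel" "N' \<in> sets lborel" using N N' by auto
  have e: "emeasure lborel (A \<times> B) = emeasure lborel A * emeasure lborel B"
    if "A \<in> sets lborel" "B \<in> sets lborel" for A B :: "real set"
    unfolding lborel_prod[symmetric] using that by (rule lborel.emeasure_pair_measure_Times)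
  have s: "A \<times> B \<in> sets lborel" if "A \<in> sets lborel" "B \<in> sets lborel" for A B :: "real set"
    unfolding lborel_prod[symmetric] using that by simp
  have "N \<times> (UNIV :: real set) \<in> null_sets lborel" "(UNIV :: real set) \<times> N' \<in> null_sets lborel"
    using N N' e[OF borelN(1), of UNIV] e[OF _ borelN(2), of UNIV] s[OF borelN(1), of UNIV] s[OF _ borelN(2), of UNIV]
    by (auto simp: null_sets_def)
  then have "N \<times> UNIV \<union> UNIV \<times> N' \<in> null_sets lborel" by (rule null_sets.Un)
  then have R0: "R \<in> null_sets lebesgue"
    by (rule null_sets_completion_subset[OF R null_sets_completionI])
  have m: "?mS \<times> ?mT \<in> sets lborel" by (rule s[OF main_part_sets[OF S] main_part_sets[OF T]])
  then have m': "?mS \<times> ?mT \<in> sets lebesgue" by (rule sets_completionI_sets)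
  have ST: "S \<times> T = ?mS \<times> ?mT \<union> R" using SS TT by (auto simp: R_def)
  show "S \<times> T \<in> sets lebesgue" unfolding ST using m' null_setsD2[OF R0] by (rule sets.Un)
  have "emeasure lebesgue (S \<times> T) = emeasure lebesgue (?mS \<times> ?mT)"
    unfolding ST using m' R0 by (rule emeasure_Un_null_set)
  also have "\<dots> = emeasure lborel (?mS \<times> ?mT)" using m' m by simp
  also have "\<dots> = emeasure lborel ?mS * emeasure lborel ?mT" by (rule e[OF main_part_sets[OF S] main_part_sets[OF T]])
  finally show "emeasure lebesgue (S \<times> T) = emeasure lebesgue S * emeasure lebesgue T"
    using S T by (simp add: emeasure_completion)
qed

lemma measure_lebesgue_Times:
  fixes S T :: "real set"
  assumes "S \<in> sets lebesgue" "T \<in> sets lebesgue"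
  shows "measure lebesgue (S \<times> T) = measure lebesgue S * measure lebesgue T"
  by (simp add: measure_def emeasure_lebesgue_Times[OF assms] enn2real_mult)

lemma lmeasurable_subset_unit:
  assumes "S \<in> sets lebesgue" "S \<subseteq> {0..1::real}"
  shows "S \<in> lmeasurable"
  by (rule fmeasurableI2[of "{0..1}"]) (use assms in auto)

lemma lmeasurable_Times_unit:
  assumes "S \<in> sets lebesgue" "S \<subseteq> {0..1::real}" "T \<in> sets lebesgue" "T \<subseteq> {0..1::real}"
  shows "S \<times> T \<in> lmeasurable"
proof (rule fmeasurableI)
  have "emeasure lebesgue S < \<infinity>" "emeasure lebesgue T < \<infinity>"
    using lmeasurable_subset_unit[OF assms(1,2)] lmeasurable_subset_unit[OF assms(3,4)]
    by (auto simp: fmeasurable_def)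
  then show "emeasure lebesgue (S \<times> T) < \<infinity>"
    by (simp add: emeasure_lebesgue_Times[OF assms(1,3)] ennreal_mult_less_top)
qed (rule sets_lebesgue_Times[OF assms(1,3)])

lemma measure_subset_unit_le:
  assumes "S \<in> sets lebesgue" "S \<subseteq> {0..1::real}"
  shows "measure lebesgue S \<le> 1"
  using measure_mono_fmeasurable[OF assms(2,1)] by simp

section \<open>Splitting a set of reals into parts of prescribed measure\<close>

lemma subset_of_measure_exists:
  fixes X :: "real set"
  assumes X: "X \<in> sets lebesgue" "X \<subseteq> {0..1}" and m: "0 \<le> m" "m \<le> measure lebesgue X"
  shows "\<exists>Y\<subseteq>X. Y \<in> sets lebesgue \<and> measure lebesgue Y = m"
proof -
  \<comment> \<open>This function of the cutting point \<open>t\<close> increases with slope at most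
    1, so it is continuous and takes the value \<open>m\<close>.\<close>
  define g where "g t = measure lebesgue (X \<inter> {0..t})" for t
  have XI: "X \<inter> {0..t} \<in> lmeasurable" for t
    using X by (intro lmeasurable_subset_unit) auto
  have step: "g s \<le> g t \<and> g t \<le> g s + (t - s)" if "s \<le> t" for s t
  proof
    show "g s \<le> g t" unfolding g_def
      using that by (intro measure_mono_fmeasurable XI fmeasurableD) auto
    have "g t \<le> measure lebesgue ((X \<inter> {0..s}) \<union> {s..t})"
      unfolding g_def using that XI by (intro measure_mono_fmeasurable fmeasurableD fmeasurable.Un) auto
    also have "\<dots> \<le> g s + measure lebesgue {s..t}"
      unfolding g_def by (rule measure_Un_le) (use XI in \<open>auto intro: fmeasurableD\<close>)
    finally show "g t \<le> g s + (t - s)" using that by simp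
  qed
  have "continuous_on {0..1} g"
  proof (rule continuous_onI)
    fix s e :: real assume "e > 0"
    have "dist (g t) (g s) \<le> e" if "dist t s < e" for t
      using step[of s t] step[of t s] that by (cases "s \<le> t") (auto simp: dist_real_def)
    then show "\<exists>d>0. \<forall>t\<in>{0..1}. dist t s < d \<longrightarrow> dist (g t) (g s) \<le> e" using \<open>e > 0\<close> by blast
  qed
  moreover have "g 0 \<le> m"
  proof -
    have "negligible (X \<inter> {0..0})" by (rule negligible_subset[OF negligible_sing[of 0]]) auto
    then show ?thesis using m by (simp add: g_def negligible_imp_measure0)
  qed
  moreover have "g 1 = measure lebesgue X" unfolding g_def using X(2) by (simp add: Int_absorb2)
  ultimately obtain t where "0 \<le> t" "t \<le> 1" "g t = m"
    using IVT'[of g 0 m 1] m by auto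
  then show ?thesis using XI[of t] by (intro exI[of _ "X \<inter> {0..t}"]) (auto simp: g_def fmeasurableD)
qed

text \<open>Pieces are cut off one index at a time. The last index receives the whole remainder,
  whose measure is right because the prescribed measures add up to that of \<open>X\<close>.\<close>

lemma colouring_of_measures_exists:
  fixes X :: "real set" and m :: "'i \<Rightarrow> real"
  assumes "finite I" "I \<noteq> {}" "X \<in> sets lebesgue" "X \<subseteq> {0..1}"
    and "\<And>i. i \<in> I \<Longrightarrow> 0 \<le> m i" "(\<Sum>i\<in>I. m i) = measure lebesgue X"
  shows "\<exists>h. (\<forall>x. h x \<in> I) \<and>
    (\<forall>i\<in>I. {x\<in>X. h x = i} \<in> sets lebesgue \<and> measure lebesgue {x\<in>X. h x = i} = m i)"
  using assms
proof (induction I arbitrary: X rule: finite_ne_induct)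
  case (singleton i)
  then show ?case by (intro exI[of _ "\<lambda>_. i"]) auto
next
  case (insert i I)
  have "0 \<le> (\<Sum>i\<in>I. m i)" using insert.prems by (intro sum_nonneg) auto
  moreover have sum: "m i + (\<Sum>i\<in>I. m i) = measure lebesgue X" using insert by simp
  ultimately have "m i \<le> measure lebesgue X" by linarith
  then obtain Y where Y: "Y \<subseteq> X" "Y \<in> sets lebesgue" "measure lebesgue Y = m i"
    using subset_of_measure_exists[OF insert.prems(1,2), of "m i"] insert.prems(3) by auto
  have "measure lebesgue (X - Y) = measure lebesgue X - measure lebesgue Y"
  proof (rule measure_Diff)
    show "emeasure lebesgue X \<noteq> \<infinity>"
      using fmeasurableD2[OF lmeasurable_subset_unit[OF insert.prems(1,2)]] by simp
  qed (fact insert.prems Y)+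
  then have rest: "(\<Sum>i\<in>I. m i) = measure lebesgue (X - Y)" using sum Y(3) by linarith
  have XY: "X - Y \<in> sets lebesgue" using Y(2) insert.prems(1) by (rule sets.Diff[rotated])
  have XY': "X - Y \<subseteq> {0..1}" using insert.prems(2) by (rule order_trans[OF Diff_subset])
  have nonneg: "0 \<le> m k" if "k \<in> I" for k using insert.prems(3) that by simp
  have "\<exists>h. (\<forall>x. h x \<in> I) \<and>
    (\<forall>i\<in>I. {x\<in>X - Y. h x = i} \<in> sets lebesgue \<and> measure lebesgue {x\<in>X - Y. h x = i} = m i)"
    by (rule insert.IH[OF XY XY' _ rest]) (rule nonneg)
  then obtain h where h: "\<forall>x. h x \<in> I"
    "\<forall>i\<in>I. {x\<in>X - Y. h x = i} \<in> sets lebesgue \<and> measure lebesgue {x\<in>X - Y. h x = i} = m i"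
    by (elim exE conjE) (rule that)
  let ?h = "\<lambda>x. if x \<in> Y then i else h x"
  have ne: "h x \<noteq> i" for x using h(1)[rule_format, of x] insert.hyps(3) by metis
  have i: "{x\<in>X. ?h x = i} = Y" using Y(1) ne by auto
  have j: "{x\<in>X. ?h x = j} = {x\<in>X - Y. h x = j}" if "j \<in> I" for j
    using that insert.hyps(3) by auto
  show ?case
  proof (intro exI[of _ ?h] conjI allI ballI)
    fix x show "?h x \<in> insert i I" using h(1) by simp
  next
    fix k assume "k \<in> insert i I"
    then consider "k = i" | "k \<in> I" by blast
    then show "{x\<in>X. ?h x = k} \<in> sets lebesgue" "measure lebesgue {x\<in>X. ?h x = k} = m k"
      by (cases; simp only: i j Y h(2)[rule_format])+
  qed
qed

text \<open>From each class a part of measure at most \<open>1 / q\<close> keeps its colour; the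
  rest of the unit interval is recoloured so as to fill up the classes that are too small.\<close>

lemma rebalance_colouring:
  fixes j :: "real \<Rightarrow> nat"
  assumes q: "q \<ge> 1" and j: "\<And>x. j x \<in> {1..q}"
    and sets: "\<And>i. i \<in> {1..q} \<Longrightarrow> {x\<in>{0..1}. j x = i} \<in> sets lebesgue"
    and meas: "\<And>i. i \<in> {1..q} \<Longrightarrow> \<bar>measure lebesgue {x\<in>{0..1}. j x = i} - 1 / real q\<bar> \<le> \<epsilon>"
  shows "\<exists>col L. (\<forall>x. col x \<in> {1..q}) \<and>
    (\<forall>i\<in>{1..q}. {x\<in>{0..1}. col x = i} \<in> sets lebesgue \<and> measure lebesgue {x\<in>{0..1}. col x = i} = 1 / real q) \<and>
    L \<in> sets lebesgue \<and> L \<subseteq> {0..1} \<and> measure lebesgue L \<le> real q * \<epsilon> \<and> (\<forall>x\<in>{0..1} - L. col x = j x)"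
proof -
  let ?J = "\<lambda>i. {x\<in>{0..1}. j x = i}"
  have "\<forall>i\<in>{1..q}. \<exists>Y. Y \<subseteq> ?J i \<and> Y \<in> sets lebesgue \<and>
      measure lebesgue Y = min (measure lebesgue (?J i)) (1 / real q)"
  proof
    fix i assume i: "i \<in> {1..q}"
    show "\<exists>Y. Y \<subseteq> ?J i \<and> Y \<in> sets lebesgue \<and>
      measure lebesgue Y = min (measure lebesgue (?J i)) (1 / real q)"
    proof -
      have "?J i \<subseteq> {0..1}" by (rule Collect_subset)
      moreover have "0 \<le> min (measure lebesgue (?J i)) (1 / real q)" by simp
      ultimately show ?thesis by (rule subset_of_measure_exists[OF sets[OF i] _ _ min.cobounded1])
    qed
  qed
  from bchoice[OF this] obtain B where B0: "\<forall>i\<in>{1..q}. B i \<subseteq> ?J i \<and> B i \<in> sets lebesgue \<and>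
      measure lebesgue (B i) = min (measure lebesgue (?J i)) (1 / real q)" by (rule exE)
  have B1: "B i \<subseteq> ?J i" if "i \<in> {1..q}" for i
    using bspec[OF B0 that] by (rule conjunct1)
  have B2: "B i \<in> sets lebesgue" if "i \<in> {1..q}" for i
    using bspec[OF B0 that] by (elim conjE)
  have B3: "measure lebesgue (B i) = min (measure lebesgue (?J i)) (1 / real q)" if "i \<in> {1..q}" for i
    using bspec[OF B0 that] by (elim conjE)
  \<comment> \<open>The measure of \<open>L\<close> is the sum of the deficits
    \<open>1 / q - measure lebesgue (B i)\<close>. Each is at most \<open>\<epsilon>\<close>, and
    since they add up exactly, \<open>L\<close> can be distributed among the classes.\<close>
  define L where "L = {0..1} - (\<Union>i\<in>{1..q}. B i)"
  have UB: "(\<Union>i\<in>{1..q}. B i) \<in> sets lebesgue" using B2 by auto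
  have Bsub: "(\<Union>i\<in>{1..q}. B i) \<subseteq> {0..1}" using B1 by blast
  have L: "L \<in> sets lebesgue" "L \<subseteq> {0..1}" using UB by (auto simp: L_def)
  have Bfin: "emeasure lebesgue (B i) \<noteq> \<infinity>" if "i \<in> {1..q}" for i
  proof -
    have "B i \<subseteq> {0..1}" using B1[OF that] by blast
    then show ?thesis using fmeasurableD2[OF lmeasurable_subset_unit[OF B2[OF that]]] by simp
  qed
  have disj: "disjoint_family_on B {1..q}"
    unfolding disjoint_family_on_def using B1 by blast
  have "measure lebesgue L = measure lebesgue {0..1::real} - measure lebesgue (\<Union>i\<in>{1..q}. B i)"
    unfolding L_def by (rule measure_Diff) (use UB Bsub in auto)
  also have "measure lebesgue (\<Union>i\<in>{1..q}. B i) = (\<Sum>i\<in>{1..q}. measure lebesgue (B i))"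
    by (rule measure_finite_Union) (use B2 Bfin disj in auto)
  finally have mL: "measure lebesgue L = (\<Sum>i\<in>{1..q}. 1 / real q - measure lebesgue (B i))"
    using q by (simp add: sum_subtractf)
  have "measure lebesgue L \<le> (\<Sum>i\<in>{1..q}. \<epsilon>)"
    unfolding mL
  proof (rule sum_mono)
    fix i assume i: "i \<in> {1..q}"
    show "1 / real q - measure lebesgue (B i) \<le> \<epsilon>"
      unfolding B3[OF i] min_def using meas[OF i] by (simp only: split: if_split) linarith
  qed
  then have mL': "measure lebesgue L \<le> real q * \<epsilon>" by simp
  have "\<exists>h. (\<forall>x. h x \<in> {1..q}) \<and> (\<forall>i\<in>{1..q}. {x\<in>L. h x = i} \<in> sets lebesgue \<and>
      measure lebesgue {x\<in>L. h x = i} = 1 / real q - measure lebesgue (B i))"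
  proof (rule colouring_of_measures_exists[OF _ _ L])
    show "0 \<le> 1 / real q - measure lebesgue (B i)" if "i \<in> {1..q}" for i
      unfolding B3[OF that] by simp
    show "(\<Sum>i\<in>{1..q}. 1 / real q - measure lebesgue (B i)) = measure lebesgue L"
      by (rule mL[symmetric])
  qed (use q in simp_all)
  then obtain h where h: "\<forall>x. h x \<in> {1..q}" "\<forall>i\<in>{1..q}. {x\<in>L. h x = i} \<in> sets lebesgue \<and>
      measure lebesgue {x\<in>L. h x = i} = 1 / real q - measure lebesgue (B i)" by (elim exE conjE) (rule that)
  let ?col = "\<lambda>x. if x \<in> L then h x else j x"
  have col: "{x\<in>{0..1}. ?col x = i} \<in> sets lebesgue \<and> measure lebesgue {x\<in>{0..1}. ?col x = i} = 1 / real q"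
    if i: "i \<in> {1..q}" for i
  proof -
    have Bi: "x \<notin> L" "j x = i" "x \<in> {0..1}" if "x \<in> B i" for x
    proof -
      show "x \<notin> L" using that i unfolding L_def by blast
      show "j x = i" "x \<in> {0..1}" using subsetD[OF B1[OF i] that] by simp_all
    qed
    have jB: "x \<in> B (j x)" if x: "x \<in> {0..1}" "x \<notin> L" for x
    proof -
      obtain k where k: "k \<in> {1..q}" "x \<in> B k" using x unfolding L_def by blast
      have "j x = k" using subsetD[OF B1[OF k(1)] k(2)] by simp
      then show ?thesis using k(2) by simp
    qed
    have eq: "{x\<in>{0..1}. ?col x = i} = B i \<union> {x\<in>L. h x = i}"
    proof (rule set_eqI)
      fix x
      show "x \<in> {x\<in>{0..1}. ?col x = i} \<longleftrightarrow> x \<in> B i \<union> {x\<in>L. h x = i}"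
      proof (cases "x \<in> L")
        case True
        then have "x \<notin> B i" "x \<in> {0..1}" using Bi(1) L(2) by blast+
        then show ?thesis using True by simp
      next
        case False
        then show ?thesis using jB Bi(2,3) by auto
      qed
    qed
    have hi: "{x\<in>L. h x = i} \<in> sets lebesgue"
      "measure lebesgue {x\<in>L. h x = i} = 1 / real q - measure lebesgue (B i)"
      using h(2) i by blast+
    have "{x\<in>L. h x = i} \<subseteq> {0..1}" using L(2) by blast
    then have "emeasure lebesgue {x\<in>L. h x = i} \<noteq> \<infinity>"
      using fmeasurableD2[OF lmeasurable_subset_unit[OF hi(1)]] by simp
    moreover have "B i \<inter> {x\<in>L. h x = i} = {}" using Bi(1) by blast
    ultimately have "measure lebesgue (B i \<union> {x\<in>L. h x = i}) = measure lebesgue (B i) + measure lebesgue {x\<in>L. h x = i}"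
      using B2[OF i] hi(1) Bfin[OF i] by (intro measure_Union)
    then show ?thesis unfolding eq using hi B2[OF i] by simp
  qed
  show ?thesis
  proof (intro exI[of _ ?col] exI[of _ L] conjI ballI allI)
    fix x show "?col x \<in> {1..q}" using h(1) j by simp
  next
    fix x assume "x \<in> {0..1} - L" then show "?col x = j x" by simp
  qed (use col L mL' in blast)+
qed

section \<open>Cut distance to the limit family\<close>

text \<open>The minimum only matters at the right end: for \<open>x = 1\<close> the floor gives
  \<open>n + 1\<close>, while the last vertex interval is closed.\<close>

definition vertex_of :: "nat \<Rightarrow> real \<Rightarrow> nat" where
  "vertex_of n x = min n (nat \<lfloor>real n * x\<rfloor> + 1)"

lemma vertex_of_range: "n \<ge> 1 \<Longrightarrow> vertex_of n x \<in> {1..n}"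
  by (auto simp: vertex_of_def)

lemma in_vertex_interval_iff:
  assumes n: "n \<ge> 1" and x: "x \<in> {0..1}" and v: "v \<in> {1..n}"
  shows "x \<in> vertex_interval n v \<longleftrightarrow> v = vertex_of n x"
proof -
  define k where "k = nat \<lfloor>real n * x\<rfloor>"
  have n0: "real n > 0" using n by simp
  have k: "real k \<le> real n * x" "real n * x < real k + 1"
    using x n0 by (auto simp: k_def)
  show ?thesis
  proof (cases "v < n")
    case True
    have "x \<in> vertex_interval n v \<longleftrightarrow> real v - 1 \<le> real n * x \<and> real n * x < real v"
      using True n0 by (simp add: vertex_interval_def field_simps)
    also have "\<dots> \<longleftrightarrow> v = k + 1"
    proof
      assume "real v - 1 \<le> real n * x \<and> real n * x < real v"
      then have "real v < real k + 2" "real k < real v" using k by linarith+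
      then show "v = k + 1" by linarith
    qed (use k in simp)
    also have "\<dots> \<longleftrightarrow> v = vertex_of n x" using True by (auto simp: vertex_of_def k_def[symmetric])
    finally show ?thesis .
  next
    case False
    then have vn: "v = n" using v by simp
    have "x \<in> vertex_interval n v \<longleftrightarrow> real n - 1 \<le> real n * x"
      using x n0 vn by (simp add: vertex_interval_def field_simps)
    also have "\<dots> \<longleftrightarrow> n \<le> k + 1"
    proof
      assume "real n - 1 \<le> real n * x"
      then have "real n < real k + 2" using k by linarith
      then show "n \<le> k + 1" by linarith
    next
      assume "n \<le> k + 1"
      then have "real n \<le> real k + 1" by linarith
      then show "real n - 1 \<le> real n * x" using k by linarith
    qed
    also have "\<dots> \<longleftrightarrow> v = vertex_of n x" using vn by (auto simp: vertex_of_def k_def[symmetric])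
    finally show ?thesis .
  qed
qed

lemma vertex_interval_subset:
  assumes "n \<ge> 1" "v \<in> {1..n}"
  shows "vertex_interval n v \<subseteq> {0..1}"
proof
  fix x assume x: "x \<in> vertex_interval n v"
  have n0: "real n > 0" using assms by simp
  have v: "1 \<le> real v" "real v \<le> real n" using assms by auto
  have lo: "0 \<le> (real v - 1) / real n" using v n0 by simp
  show "x \<in> {0..1}"
  proof (cases "v < n")
    case True
    then have "(real v - 1) / real n \<le> x" "x < real v / real n" using x by (auto simp: vertex_interval_def)
    moreover have "real v / real n \<le> 1" using v n0 by simp
    ultimately show ?thesis using lo by simp
  next
    case False
    then have "v = n" using assms by simp
    then have "(real v - 1) / real n \<le> x" "x \<le> 1" using x by (auto simp: vertex_interval_def)
    then show ?thesis using lo by simp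
  qed
qed

lemma sets_vertex_interval [simp]: "vertex_interval n v \<in> sets lebesgue"
  by (simp add: vertex_interval_def)

lemma measure_vertex_interval:
  assumes "n \<ge> 1"
  shows "measure lebesgue (vertex_interval n v) = 1 / real n"
proof -
  have n0: "real n > 0" using assms by simp
  have 1: "real v / real n - (real v - 1) / real n = 1 / real n"
    by (simp flip: diff_divide_distrib)
  have 2: "1 - (real n - 1) / real n = 1 / real n" using n0 by (simp add: field_simps)
  show ?thesis
  proof (cases "v < n")
    case True
    have "(real v - 1) / real n \<le> real v / real n" using n0 by (intro divide_right_mono) auto
    then show ?thesis using True 1 by (simp add: vertex_interval_def)
  next
    case False
    have "(real n - 1) / real n \<le> 1" using n0 by simp
    then show ?thesis using False 2 by (simp add: vertex_interval_def)
  qed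
qed

lemma empirical_graphon_eq:
  assumes n: "n \<ge> 1" and xy: "x \<in> {0..1}" "y \<in> {0..1}"
  shows "empirical_graphon n G (x, y) = of_bool ({vertex_of n x, vertex_of n y} \<in> G)"
proof -
  have "(\<exists>i\<in>{1..n}. \<exists>j\<in>{1..n}. x \<in> vertex_interval n i \<and> y \<in> vertex_interval n j \<and> {i, j} \<in> G) \<longleftrightarrow>
    {vertex_of n x, vertex_of n y} \<in> G"
    using in_vertex_interval_iff[OF n xy(1)] in_vertex_interval_iff[OF n xy(2)] vertex_of_range[OF n]
    by metis
  then show ?thesis by (simp add: empirical_graphon_def)
qed

section \<open>Cut norm and cut distance of graphons\<close>

lemma abs_cut_integral_le_1:
  assumes F: "\<And>p. p \<in> {0..1} \<times> {0..1} \<Longrightarrow> \<bar>F p\<bar> \<le> (1::real)"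
    and ST: "S \<in> sets lebesgue" "S \<subseteq> {0..1::real}" "T \<in> sets lebesgue" "T \<subseteq> {0..1::real}"
  shows "\<bar>LINT p:S \<times> T|lebesgue. F p\<bar> \<le> 1"
proof (cases "set_integrable lebesgue (S \<times> T) F")
  case True
  have m: "S \<times> T \<in> lmeasurable" by (rule lmeasurable_Times_unit[OF ST])
  have "\<bar>LINT p:S \<times> T|lebesgue. F p\<bar> \<le> (\<integral>p. indicator (S \<times> T) p \<partial>lebesgue)"
    unfolding set_lebesgue_integral_def
  proof (rule integral_abs_bound_integral)
    show "integrable lebesgue (\<lambda>p. indicator (S \<times> T) p *\<^sub>R F p)"
      using True by (simp add: set_integrable_def)
    show "integrable lebesgue (indicator (S \<times> T) :: real \<times> real \<Rightarrow> real)"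
      using m by (intro integrable_real_indicator) (auto simp: fmeasurable_def)
    fix p :: "real \<times> real"
    show "\<bar>indicator (S \<times> T) p *\<^sub>R F p\<bar> \<le> indicator (S \<times> T) p"
    proof (cases "p \<in> S \<times> T")
      case True
      then have "p \<in> {0..1} \<times> {0..1}" using ST(2,4) by (auto simp only: mem_Times_iff)
      then show ?thesis using True F by simp
    qed simp
  qed
  also have "\<dots> = measure lebesgue S * measure lebesgue T"
    by (simp add: measure_lebesgue_Times[OF ST(1,3)])
  also have "\<dots> \<le> 1 * 1" by (intro mult_mono measure_subset_unit_le ST) auto
  finally show ?thesis by simp
next
  \<comment> \<open>The integral of a non-integrable function is 0 by convention, so
    \<open>F\<close> may be any bounded function; this covers kernels relabelled by an arbitrary
    \<open>\<phi>\<close>.\<close>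
  case False
  then show ?thesis
    by (simp add: set_lebesgue_integral_def set_integrable_def not_integrable_integral_eq)
qed

lemma cut_norm_le:
  assumes "\<And>S T. S \<in> sets lebesgue \<Longrightarrow> S \<subseteq> {0..1} \<Longrightarrow> T \<in> sets lebesgue \<Longrightarrow> T \<subseteq> {0..1} \<Longrightarrow>
    \<bar>LINT p:S \<times> T|lebesgue. F p\<bar> \<le> B"
  shows "cut_norm F \<le> B"
  unfolding cut_norm_def by (rule cSUP_least) (use assms in auto)

text \<open>The empty rectangle gives the value 0. Boundedness of \<open>F\<close> enters because a
  supremum in the reals dominates its members only if the set is bounded above.\<close>

lemma cut_norm_nonneg:
  assumes F: "\<And>p. p \<in> {0..1} \<times> {0..1} \<Longrightarrow> \<bar>F p\<bar> \<le> (1::real)"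
  shows "0 \<le> cut_norm F"
proof -
  let ?R = "{(S, T). S \<in> sets lebesgue \<and> S \<subseteq> {0..1::real} \<and> T \<in> sets lebesgue \<and> T \<subseteq> {0..1::real}}"
  let ?g = "\<lambda>(S, T). \<bar>LINT p:S \<times> T|lebesgue. F p\<bar>"
  have "({}, {}) \<in> ?R" by simp
  moreover have "bdd_above (?g ` ?R)"
    by (rule bdd_aboveI[of _ 1]) (auto intro!: abs_cut_integral_le_1 F)
  ultimately have "?g ({}, {}) \<le> (SUP ST\<in>?R. ?g ST)" by (rule cSUP_upper)
  then have "0 \<le> (SUP ST\<in>?R. ?g ST)" by simp
  then show ?thesis unfolding cut_norm_def .
qed

lemma id_measure_preserving: "(\<lambda>x. x) \<in> measure_preserving_bijections"
proof -
  have inv: "the_inv_into {0..1::real} (\<lambda>x. x) x = x" if "x \<in> {0..1}" for x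
    using the_inv_into_f_f[of "\<lambda>x. x" "{0..1::real}" x] that by (simp add: inj_on_def)
  have "the_inv_into {0..1} (\<lambda>x. x) \<in> lebesgue_on {0..1} \<rightarrow>\<^sub>M lebesgue_on {0..1::real}"
    by (subst measurable_cong[of _ _ "\<lambda>x. x"]) (auto simp: space_restrict_space inv)
  then show ?thesis
    unfolding measure_preserving_bijections_def by (auto simp: bij_betw_def inj_on_def distr_id)
qed

text \<open>The identity serves as relabelling. Nonnegativity is shown for all relabelled members of
  the family, since an infimum in the reals lies below its members only if the set is bounded
  below.\<close>

lemma cut_dist_family_le:
  assumes W: "\<And>p. p \<in> {0..1} \<times> {0..1} \<Longrightarrow> W p \<in> {0..1}" and V: "V \<in> B_star q"
  shows "cut_dist_family W (B_star q) \<le> cut_norm (\<lambda>(x, y). W (x, y) - V (x, y))"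
proof -
  have nonneg: "0 \<le> cut_norm (\<lambda>(x, y). W (x, y) - V' (\<phi> x, \<phi> y))"
    if \<phi>: "\<phi> \<in> measure_preserving_bijections" and V': "V' \<in> B_star q" for \<phi> V'
  proof (rule cut_norm_nonneg)
    fix p :: "real \<times> real" assume p: "p \<in> {0..1} \<times> {0..1}"
    obtain x y where xy: "p = (x, y)" "x \<in> {0..1}" "y \<in> {0..1}" using p by auto
    have "\<phi> x \<in> {0..1}" "\<phi> y \<in> {0..1}"
      using \<phi> xy by (auto simp: measure_preserving_bijections_def bij_betw_def)
    then have "V' (\<phi> x, \<phi> y) \<in> {0..1}" using V' by (auto simp: B_star_def graphon_def)
    moreover have "W (x, y) \<in> {0..1}" using W[OF p] xy(1) by simp
    ultimately show "\<bar>case p of (x, y) \<Rightarrow> W (x, y) - V' (\<phi> x, \<phi> y)\<bar> \<le> 1" by (auto simp: xy(1) abs_le_iff)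
  qed
  have "cut_dist W V \<le> cut_norm (\<lambda>(x, y). W (x, y) - V (x, y))"
    unfolding cut_dist_def
    using cINF_lower[OF _ id_measure_preserving, of "\<lambda>\<phi>. cut_norm (\<lambda>(x, y). W (x, y) - V (\<phi> x, \<phi> y))"]
      bdd_belowI2[of measure_preserving_bijections 0 "\<lambda>\<phi>. cut_norm (\<lambda>(x, y). W (x, y) - V (\<phi> x, \<phi> y))"]
      nonneg[OF _ V] by simp
  moreover have "0 \<le> cut_dist W V'" if "V' \<in> B_star q" for V'
    unfolding cut_dist_def by (rule cINF_greatest) (use id_measure_preserving nonneg[OF _ that] in auto)
  then have "cut_dist_family W (B_star q) \<le> cut_dist W V"
    unfolding cut_dist_family_def by (intro cINF_lower bdd_belowI2[of _ 0] V)
  ultimately show ?thesis by linarith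
qed

lemma multipartite_half_in_B_star:
  fixes col :: "real \<Rightarrow> nat"
  assumes col: "\<And>x. col x \<in> {1..q}"
    and A: "\<And>i. i \<in> {1..q} \<Longrightarrow> {x\<in>{0..1}. col x = i} \<in> sets lebesgue"
      "\<And>i. i \<in> {1..q} \<Longrightarrow> measure lebesgue {x\<in>{0..1}. col x = i} = 1 / real q"
  shows "(\<lambda>(x, y). if col x \<noteq> col y then 1 / 2 else 0) \<in> B_star q"
proof -
  let ?U = "\<lambda>(x, y). if col x \<noteq> col y then 1 / 2 else (0::real)"
  let ?A = "\<lambda>i. {x\<in>{0..1::real}. col x = i}"
  let ?Q = "{0..1::real} \<times> {0..1::real}"
  \<comment> \<open>On the unit square the kernel is \<open>(1 - indicator D p) / 2\<close>, so its
    measurability reduces to that of finitely many diagonal blocks.\<close>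
  define D where "D = (\<Union>i\<in>{1..q}. ?A i \<times> ?A i)"
  have D: "D \<in> sets lebesgue" unfolding D_def
    using sets_lebesgue_Times[OF A(1) A(1)] by (intro sets.finite_UN) auto
  have "(\<lambda>p. (1 - indicator D p) / 2 :: real) \<in> borel_measurable (lebesgue_on ?Q)"
    by (rule measurable_restrict_space1) (use D in measurable)
  moreover have "?U p = (1 - indicator D p) / 2" if "p \<in> space (lebesgue_on ?Q)" for p
  proof -
    obtain x y where p: "p = (x, y)" "x \<in> {0..1}" "y \<in> {0..1}" using \<open>p \<in> space (lebesgue_on ?Q)\<close>
      by (auto simp: space_restrict_space)
    have "p \<in> D \<longleftrightarrow> col x = col y" using p col by (auto simp: D_def)
    then show ?thesis by (simp add: p(1) indicator_def)
  qed
  ultimately have meas: "?U \<in> borel_measurable (lebesgue_on ?Q)"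
    by (subst measurable_cong[of _ _ "\<lambda>p. (1 - indicator D p) / 2"])
  have gr: "graphon ?U" unfolding graphon_def
  proof (intro conjI ballI)
    show "?U p \<in> {0..1}" for p by (cases p) simp
    show "AE (x, y) in lebesgue_on ?Q. ?U (x, y) = ?U (y, x)"
      by (rule AE_I2) (simp add: case_prod_unfold eq_commute)
  qed (rule meas)
  have zero: "AE p in lebesgue. p \<in> ?A i \<times> ?A i \<longrightarrow> ?U p = 0" for i
    by (rule AE_I2) (simp add: case_prod_unfold mem_Times_iff)
  have half: "AE p in lebesgue. p \<in> ?A i \<times> ?A j \<longrightarrow> ?U p = 1 / 2" if "i \<noteq> j" for i j
    by (rule AE_I2) (use that in \<open>simp add: case_prod_unfold mem_Times_iff\<close>)
  show ?thesis
    unfolding B_star_def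
  proof (intro CollectI conjI exI[of _ ?A] ballI impI)
    show "(\<Union>i\<in>{1..q}. ?A i) = {0..1}" using col by blast
    show "disjoint_family_on ?A {1..q}" unfolding disjoint_family_on_def by blast
    show "AE p in lebesgue. p \<in> ?A i \<times> ?A i \<longrightarrow> ?U p = 0" for i by (rule zero)
    show "AE p in lebesgue. p \<in> ?A i \<times> ?A j \<longrightarrow> ?U p = 1 / 2" if "i \<noteq> j" for i j
      using that by (rule half)
  qed (fact gr A)+
qed

text \<open>The residual splits into a cross part and an inner part. Cutting \<open>S\<close> and
  \<open>T\<close> along the colour classes yields \<open>q ^ 2\<close> blocks of the cross part,
  each zero or bounded by the discrepancy condition; the inner edges, counted in both orders, add
  \<open>2 * \<epsilon> * n ^ 2\<close>.\<close>

lemma structured_cut_bounded: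
  assumes st: "structured \<epsilon> n q f G" and G: "G \<in> graphs_on n" and \<epsilon>: "\<epsilon> > 0"
  shows "cut_bounded {1..n} ((real q ^ 2 + 2) * \<epsilon> * real n ^ 2)
    (\<lambda>u v. of_bool ({u, v} \<in> G) - of_bool (f u \<noteq> f v) / 2)"
  unfolding cut_bounded_def
proof (intro allI impI)
  fix S T assume ST: "S \<subseteq> {1..n}" "T \<subseteq> {1..n}"
  have fin: "finite S" "finite T" using ST finite_subset by blast+
  have f: "\<And>v. f v \<in> {1..q}" and inner: "real (card (G \<inter> inner_edges n f)) \<le> \<epsilon> * real n ^ 2"
    and disc: "\<And>S T. S \<subseteq> {1..n} \<Longrightarrow> T \<subseteq> {1..n} \<Longrightarrow> (\<forall>u\<in>S. \<forall>v\<in>T. f u \<noteq> f v) \<Longrightarrow>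
      \<bar>real (edges_between G S T) - real (card S) * real (card T) / 2\<bar> \<le> \<epsilon> * real n ^ 2"
    using st unfolding structured_def by auto
  let ?k1 = "\<lambda>u v. of_bool (f u \<noteq> f v) * (of_bool ({u, v} \<in> G) - 1 / 2 :: real)"
  let ?k2 = "\<lambda>u v. of_bool ({u, v} \<in> G \<inter> inner_edges n f) :: real"
  let ?S = "\<lambda>i. {u\<in>S. f u = i}" and ?T = "\<lambda>j. {v\<in>T. f v = j}"
  have "(\<Sum>u\<in>S. \<Sum>v\<in>T. of_bool ({u, v} \<in> G) - of_bool (f u \<noteq> f v) / 2) =
    (\<Sum>u\<in>S. \<Sum>v\<in>T. ?k1 u v + ?k2 u v)"
  proof (intro sum.cong refl)
    fix u v assume "u \<in> S" "v \<in> T"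
    then have uv: "u \<in> {1..n}" "v \<in> {1..n}" using ST by auto
    have "{u, v} \<in> G \<Longrightarrow> u \<noteq> v" using G by (auto simp: graphs_on_def)
    then show "of_bool ({u, v} \<in> G) - of_bool (f u \<noteq> f v) / 2 = ?k1 u v + ?k2 u v"
      using uv by (auto simp: doubleton_in_inner_edges)
  qed
  also have "\<dots> = (\<Sum>u\<in>S. \<Sum>v\<in>T. ?k1 u v) + (\<Sum>u\<in>S. \<Sum>v\<in>T. ?k2 u v)"
    by (simp only: sum.distrib)
  finally have split: "(\<Sum>u\<in>S. \<Sum>v\<in>T. of_bool ({u, v} \<in> G) - of_bool (f u \<noteq> f v) / 2) =
    (\<Sum>u\<in>S. \<Sum>v\<in>T. ?k1 u v) + (\<Sum>u\<in>S. \<Sum>v\<in>T. ?k2 u v)" .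
  have k2: "\<bar>\<Sum>u\<in>S. \<Sum>v\<in>T. ?k2 u v\<bar> \<le> 2 * \<epsilon> * real n ^ 2"
  proof -
    have "(\<Sum>u\<in>S. \<Sum>v\<in>T. ?k2 u v) \<le> (\<Sum>u\<in>S. \<Sum>v\<in>{1..n}. ?k2 u v)"
      using ST by (intro sum_mono sum_mono2) auto
    also have "\<dots> \<le> (\<Sum>u\<in>{1..n}. \<Sum>v\<in>{1..n}. ?k2 u v)"
      using ST by (intro sum_mono2) (auto intro!: sum_nonneg)
    also have "\<dots> = 2 * real (card (G \<inter> inner_edges n f))"
      unfolding adj_sum_def[symmetric]
      by (rule twice_card_edges[symmetric]) (auto simp: inner_edges_def)
    finally have "(\<Sum>u\<in>S. \<Sum>v\<in>T. ?k2 u v) \<le> 2 * \<epsilon> * real n ^ 2" using inner by linarith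
    moreover have "0 \<le> (\<Sum>u\<in>S. \<Sum>v\<in>T. ?k2 u v)" by (intro sum_nonneg) auto
    ultimately show ?thesis by simp
  qed
  have block: "\<bar>\<Sum>u\<in>?S i. \<Sum>v\<in>?T j. ?k1 u v\<bar> \<le> \<epsilon> * real n ^ 2" for i j
  proof (cases "i = j")
    case True
    have "(\<Sum>u\<in>?S i. \<Sum>v\<in>?T j. ?k1 u v) = (\<Sum>u\<in>?S i. \<Sum>v\<in>?T j. 0)"
      using True by (intro sum.cong refl) auto
    then show ?thesis using \<epsilon> by simp
  next
    case False
    have "(\<Sum>u\<in>?S i. \<Sum>v\<in>?T j. ?k1 u v) = (\<Sum>u\<in>?S i. \<Sum>v\<in>?T j. of_bool ({u, v} \<in> G) - 1 / 2)"
      using False by (intro sum.cong refl) auto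
    also have "\<dots> = (\<Sum>u\<in>?S i. \<Sum>v\<in>?T j. of_bool ({u, v} \<in> G)) - real (card (?S i)) * real (card (?T j)) / 2"
      by (simp add: sum_subtractf)
    also have "(\<Sum>u\<in>?S i. \<Sum>v\<in>?T j. of_bool ({u, v} \<in> G)) = real (edges_between G (?S i) (?T j))"
    proof -
      have inj: "inj_on (\<lambda>(a, b). {a, b}) (?S i \<times> ?T j)"
        by (rule inj_on_doubleton[of _ _ f]) (use False in auto)
      have "(\<Sum>u\<in>?S i. \<Sum>v\<in>?T j. of_bool ({u, v} \<in> G)) =
        (\<Sum>p\<in>?S i \<times> ?T j. if (case p of (a, b) \<Rightarrow> {a, b}) \<in> G then 1 else (0::real))"
        by (simp only: sum.cartesian_product of_bool_def case_prod_unfold)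
      also have "\<dots> = (\<Sum>e\<in>(\<lambda>(a, b). {a, b}) ` (?S i \<times> ?T j). if e \<in> G then 1 else 0)"
        by (rule sum.reindex[OF inj, symmetric, unfolded comp_def])
      also have "\<dots> = real (card (G \<inter> (\<lambda>(a, b). {a, b}) ` (?S i \<times> ?T j)))"
        using fin by (simp add: sum.If_cases Int_commute)
      finally show ?thesis by (simp add: edges_between_eq)
    qed
    finally show ?thesis using disc[of "?S i" "?T j"] ST False by auto
  qed
  have "(\<Sum>u\<in>S. \<Sum>v\<in>T. ?k1 u v) = (\<Sum>i\<in>{1..q}. \<Sum>u\<in>?S i. \<Sum>v\<in>T. ?k1 u v)"
    by (rule sum.group[symmetric]) (use fin f in auto)
  also have "\<dots> = (\<Sum>i\<in>{1..q}. \<Sum>u\<in>?S i. \<Sum>j\<in>{1..q}. \<Sum>v\<in>?T j. ?k1 u v)"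
    by (intro sum.cong refl sum.group[symmetric]) (use fin f in auto)
  also have "\<dots> = (\<Sum>i\<in>{1..q}. \<Sum>j\<in>{1..q}. \<Sum>u\<in>?S i. \<Sum>v\<in>?T j. ?k1 u v)"
    by (intro sum.cong refl sum.swap)
  also have "\<bar>\<dots>\<bar> \<le> (\<Sum>i\<in>{1..q}. \<Sum>j\<in>{1..q}. \<epsilon> * real n ^ 2)"
    by (intro order_trans[OF sum_abs] sum_mono block)
  also have "\<dots> = real q ^ 2 * \<epsilon> * real n ^ 2" by (simp add: power2_eq_square)
  finally have "\<bar>\<Sum>u\<in>S. \<Sum>v\<in>T. ?k1 u v\<bar> \<le> real q ^ 2 * \<epsilon> * real n ^ 2" .
  then have "\<bar>(\<Sum>u\<in>S. \<Sum>v\<in>T. ?k1 u v) + (\<Sum>u\<in>S. \<Sum>v\<in>T. ?k2 u v)\<bar> \<le> real q ^ 2 * \<epsilon> * real n ^ 2 + 2 * \<epsilon> * real n ^ 2"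
    using k2 by linarith
  then show "\<bar>\<Sum>u\<in>S. \<Sum>v\<in>T. of_bool ({u, v} \<in> G) - of_bool (f u \<noteq> f v) / 2\<bar> \<le> (real q ^ 2 + 2) * \<epsilon> * real n ^ 2"
    unfolding split by (simp add: distrib_right)
qed

text \<open>The vertex colouring is carried over to the unit interval and rebalanced to give the
  limit kernel \<open>U\<close>. The error has two sources: the finite residual, whose cut bound
  survives fractional pieces of the vertex intervals, and the points in \<open>L\<close> that
  changed colour.\<close>

lemma structured_cut_dist_le:
  assumes st: "structured \<epsilon> n q f G" and G: "G \<in> graphs_on n" and \<epsilon>: "\<epsilon> > 0"
    and q: "q \<ge> 1" and n: "n \<ge> 1"
  shows "cut_dist_family (empirical_graphon n G) (B_star q) \<le> (real q ^ 2 + real q + 2) * \<epsilon>"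
proof -
  have f: "\<forall>v. f v \<in> {1..q}"
    and bal: "\<And>i. i \<in> {1..q} \<Longrightarrow> \<bar>real (card (colour_class n f i)) - real n / real q\<bar> \<le> \<epsilon> * real n"
    using st unfolding structured_def by auto
  have n0: "real n > 0" using n by simp
  define j where "j x = f (vertex_of n x)" for x
  have J: "{x\<in>{0..1}. j x = i} = (\<Union>v\<in>colour_class n f i. vertex_interval n v)" for i
  proof (rule set_eqI)
    fix x
    show "x \<in> {x\<in>{0..1}. j x = i} \<longleftrightarrow> x \<in> (\<Union>v\<in>colour_class n f i. vertex_interval n v)"
    proof
      assume x: "x \<in> {x\<in>{0..1}. j x = i}"
      then have "x \<in> vertex_interval n (vertex_of n x)"
        using in_vertex_interval_iff[OF n _ vertex_of_range[OF n]] by simp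
      moreover have "vertex_of n x \<in> colour_class n f i"
        using x vertex_of_range[OF n, of x] by (simp add: colour_class_def j_def)
      ultimately show "x \<in> (\<Union>v\<in>colour_class n f i. vertex_interval n v)" by (rule UN_I[rotated])
    next
      assume "x \<in> (\<Union>v\<in>colour_class n f i. vertex_interval n v)"
      then obtain v where v: "v \<in> {1..n}" "f v = i" "x \<in> vertex_interval n v" by (auto simp: colour_class_def)
      have "x \<in> {0..1}" using vertex_interval_subset[OF n v(1)] v(3) by (rule subsetD)
      moreover have "v = vertex_of n x" using in_vertex_interval_iff[OF n \<open>x \<in> {0..1}\<close> v(1)] v(3) by simp
      ultimately show "x \<in> {x\<in>{0..1}. j x = i}" using v(2) by (simp add: j_def)
    qed
  qed
  have fin_class: "finite (colour_class n f i)" for i by (simp add: colour_class_def)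
  have J_sets: "{x\<in>{0..1}. j x = i} \<in> sets lebesgue" for i
    unfolding J using fin_class by (intro sets.finite_UN) auto
  have J_meas: "measure lebesgue {x\<in>{0..1}. j x = i} = real (card (colour_class n f i)) / real n" for i
  proof -
    have "measure lebesgue (\<Union>v\<in>colour_class n f i. vertex_interval n v) =
      (\<Sum>v\<in>colour_class n f i. measure lebesgue (vertex_interval n v))"
    proof (rule measure_finite_Union[OF fin_class])
      show "vertex_interval n ` colour_class n f i \<subseteq> sets lebesgue" by auto
      show "disjoint_family_on (vertex_interval n) (colour_class n f i)"
        unfolding disjoint_family_on_def
      proof (intro ballI impI)
        fix v v' assume v: "v \<in> colour_class n f i" "v' \<in> colour_class n f i" "v \<noteq> v'"
        then have vn: "v \<in> {1..n}" "v' \<in> {1..n}" by (auto simp: colour_class_def)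
        show "vertex_interval n v \<inter> vertex_interval n v' = {}"
        proof (rule equals0I)
          fix x assume x: "x \<in> vertex_interval n v \<inter> vertex_interval n v'"
          then have x01: "x \<in> {0..1}" using vertex_interval_subset[OF n vn(1)] by blast
          have "v = vertex_of n x" using in_vertex_interval_iff[OF n x01 vn(1)] x by simp
          moreover have "v' = vertex_of n x" using in_vertex_interval_iff[OF n x01 vn(2)] x by simp
          ultimately show False using v(3) by simp
        qed
      qed
      fix v assume "v \<in> colour_class n f i"
      then have "v \<in> {1..n}" by (auto simp: colour_class_def)
      then show "emeasure lebesgue (vertex_interval n v) \<noteq> \<infinity>"
        using fmeasurableD2[OF lmeasurable_subset_unit[OF sets_vertex_interval vertex_interval_subset[OF n]]] by simp
    qed
    then show ?thesis unfolding J using measure_vertex_interval[OF n] by simp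
  qed
  have J_bal: "\<bar>measure lebesgue {x\<in>{0..1}. j x = i} - 1 / real q\<bar> \<le> \<epsilon>" if "i \<in> {1..q}" for i
  proof -
    have "real (card (colour_class n f i)) / real n - 1 / real q = (real (card (colour_class n f i)) - real n / real q) / real n"
      using n0 by (simp add: diff_divide_distrib)
    then have "\<bar>real (card (colour_class n f i)) / real n - 1 / real q\<bar> = \<bar>real (card (colour_class n f i)) - real n / real q\<bar> / real n"
      using n0 by simp
    also have "\<dots> \<le> \<epsilon>" using bal[OF that] n0 by (simp add: pos_divide_le_eq)
    finally show ?thesis unfolding J_meas .
  qed
  have j_range: "j x \<in> {1..q}" for x unfolding j_def using f by blast
  have "\<exists>col L. (\<forall>x. col x \<in> {1..q}) \<and>
    (\<forall>i\<in>{1..q}. {x\<in>{0..1}. col x = i} \<in> sets lebesgue \<and> measure lebesgue {x\<in>{0..1}. col x = i} = 1 / real q) \<and>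
    L \<in> sets lebesgue \<and> L \<subseteq> {0..1} \<and> measure lebesgue L \<le> real q * \<epsilon> \<and> (\<forall>x\<in>{0..1} - L. col x = j x)"
    by (rule rebalance_colouring[OF q j_range J_sets]) (rule J_bal)
  then obtain col L where col: "\<forall>x. col x \<in> {1..q}"
    "\<forall>i\<in>{1..q}. {x\<in>{0..1}. col x = i} \<in> sets lebesgue \<and> measure lebesgue {x\<in>{0..1}. col x = i} = 1 / real q"
    and L: "L \<in> sets lebesgue" "L \<subseteq> {0..1}" "measure lebesgue L \<le> real q * \<epsilon>" "\<forall>x\<in>{0..1} - L. col x = j x"
    by (elim exE conjE) (rule that)
  define U where "U = (\<lambda>(x, y). if col x \<noteq> col y then 1 / 2 else (0::real))"
  have U: "U \<in> B_star q"
    unfolding U_def by (rule multipartite_half_in_B_star) (use col in \<open>simp_all\<close>)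
  let ?W = "empirical_graphon n G"
  let ?k = "\<lambda>u v. of_bool ({u, v} \<in> G) - of_bool (f u \<noteq> f v) / 2 :: real"
  have cut: "cut_bounded {1..n} ((real q ^ 2 + 2) * \<epsilon> * real n ^ 2) ?k"
    by (rule structured_cut_bounded[OF st G \<epsilon>])
  have "cut_norm (\<lambda>(x, y). ?W (x, y) - U (x, y)) \<le> (real q ^ 2 + real q + 2) * \<epsilon>"
  proof (rule cut_norm_le)
    fix S T :: "real set"
    assume ST: "S \<in> sets lebesgue" "S \<subseteq> {0..1}" "T \<in> sets lebesgue" "T \<subseteq> {0..1}"
    define s where "s u = measure lebesgue (S \<inter> vertex_interval n u)" for u
    define t where "t v = measure lebesgue (T \<inter> vertex_interval n v)" for v
    let ?R = "\<lambda>u v. (S \<inter> vertex_interval n u) \<times> (T \<inter> vertex_interval n v)"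
    \<comment> \<open>The restriction to \<open>S \<times> T\<close> of the step function of the
      finite residual; it would be the whole integrand \<open>F\<close> if no point had been
      recoloured.\<close>
    define E where "E p = (\<Sum>u\<in>{1..n}. \<Sum>v\<in>{1..n}. ?k u v * indicator (?R u v) p)" for p
    define F where "F p = indicator (S \<times> T) p *\<^sub>R (case p of (x, y) \<Rightarrow> ?W (x, y) - U (x, y))" for p
    \<comment> \<open>Recolouring changes the kernel by at most \<open>1 / 2\<close>, and only where
      one coordinate lies in \<open>L\<close>. The two halves thus suffice pointwise, and together
      they integrate to \<open>measure lebesgue L\<close>.\<close>
    define B where "B p = (indicator (L \<times> {0..1}) p + indicator ({0..1} \<times> L) p) / (2::real)" for p
    have SI: "S \<inter> vertex_interval n u \<in> sets lebesgue" "S \<inter> vertex_interval n u \<subseteq> {0..1}" for u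
      using ST by auto
    have TI: "T \<inter> vertex_interval n u \<in> sets lebesgue" "T \<inter> vertex_interval n u \<subseteq> {0..1}" for u
      using ST by auto
    have R_int: "integrable lebesgue (indicator (?R u v) :: real \<times> real \<Rightarrow> real)" for u v
      using lmeasurable_Times_unit[OF SI TI, of u v]
      by (intro integrable_real_indicator) (auto simp: fmeasurable_def)
    have E_int: "integrable lebesgue E"
      unfolding E_def by (intro Bochner_Integration.integrable_sum integrable_mult_right R_int)
    have "integral\<^sup>L lebesgue E = (\<Sum>u\<in>{1..n}. \<Sum>v\<in>{1..n}. ?k u v * integral\<^sup>L lebesgue (indicator (?R u v)))"
    proof -
      have inner: "integrable lebesgue (\<lambda>p. ?k u v * indicator (?R u v) p)" for u v
        by (intro integrable_mult_right R_int)
      have "integral\<^sup>L lebesgue E = (\<Sum>u\<in>{1..n}. \<integral>p. (\<Sum>v\<in>{1..n}. ?k u v * indicator (?R u v) p) \<partial>lebesgue)"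
        unfolding E_def by (intro Bochner_Integration.integral_sum Bochner_Integration.integrable_sum inner)
      also have "\<dots> = (\<Sum>u\<in>{1..n}. \<Sum>v\<in>{1..n}. \<integral>p. ?k u v * indicator (?R u v) p \<partial>lebesgue)"
        by (intro sum.cong refl Bochner_Integration.integral_sum inner)
      finally show ?thesis by (simp only: integral_mult_right_zero)
    qed
    also have "\<dots> = (\<Sum>u\<in>{1..n}. \<Sum>v\<in>{1..n}. ?k u v * (s u * t v))"
      by (simp add: s_def t_def measure_lebesgue_Times[OF SI(1) TI(1)])
    finally have E_eq: "integral\<^sup>L lebesgue E = (\<Sum>u\<in>{1..n}. \<Sum>v\<in>{1..n}. ?k u v * (s u * t v))" .
    have weight: "0 \<le> real n * measure lebesgue (A \<inter> vertex_interval n v) \<and> real n * measure lebesgue (A \<inter> vertex_interval n v) \<le> 1"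
      if "A \<in> sets lebesgue" "v \<in> {1..n}" for A v
    proof -
      have "measure lebesgue (A \<inter> vertex_interval n v) \<le> measure lebesgue (vertex_interval n v)"
        by (rule measure_mono_fmeasurable)
          (use that lmeasurable_subset_unit[OF sets_vertex_interval vertex_interval_subset[OF n]] in auto)
      then show ?thesis using n0 by (simp add: measure_vertex_interval[OF n] field_simps)
    qed
    \<comment> \<open>Each vertex interval has length \<open>1 / n\<close>, so multiplication by
      \<open>n\<close> turns the measures into weights in the unit interval. The factor
      \<open>n ^ 2\<close> cancels against the normalisation of the cut bound.\<close>
    have "\<bar>\<Sum>u\<in>{1..n}. \<Sum>v\<in>{1..n}. (real n * s u) * (real n * t v) * ?k u v\<bar> \<le> (real q ^ 2 + 2) * \<epsilon> * real n ^ 2"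
      unfolding s_def t_def using weight ST by (intro cut_bounded_weighted[OF _ cut]) auto
    also have "(\<Sum>u\<in>{1..n}. \<Sum>v\<in>{1..n}. (real n * s u) * (real n * t v) * ?k u v) = real n ^ 2 * integral\<^sup>L lebesgue E"
      unfolding E_eq sum_distrib_left by (intro sum.cong refl) (simp add: power2_eq_square mult_ac)
    finally have "real n ^ 2 * \<bar>integral\<^sup>L lebesgue E\<bar> \<le> real n ^ 2 * ((real q ^ 2 + 2) * \<epsilon>)"
      by (simp add: abs_mult mult.commute)
    then have E_le: "\<bar>integral\<^sup>L lebesgue E\<bar> \<le> (real q ^ 2 + 2) * \<epsilon>" using n0 by simp
    have unit: "{0..1::real} \<in> sets lebesgue" "{0..1::real} \<subseteq> {0..1}" by auto
    have B_ind: "integrable lebesgue (indicator (L \<times> {0..1}) :: real \<times> real \<Rightarrow> real)"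
      "integrable lebesgue (indicator ({0..1} \<times> L) :: real \<times> real \<Rightarrow> real)"
      using lmeasurable_Times_unit[OF L(1,2) unit] lmeasurable_Times_unit[OF unit L(1,2)]
      by (auto intro!: integrable_real_indicator simp: fmeasurable_def)
    then have B_int: "integrable lebesgue B" unfolding B_def by (intro integrable_divide_zero Bochner_Integration.integrable_add)
    have "integral\<^sup>L lebesgue B = measure lebesgue L"
      unfolding B_def using B_ind by (simp add: measure_lebesgue_Times[OF L(1) unit(1)] measure_lebesgue_Times[OF unit(1) L(1)])
    then have B_le: "integral\<^sup>L lebesgue B \<le> real q * \<epsilon>" using L(3) by simp
    have FE: "\<bar>F p - E p\<bar> \<le> B p" for p
    proof (cases "p \<in> S \<times> T")
      case False
      have "p \<notin> ?R u v" for u v using False by auto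
      then have "E p = 0" by (simp add: E_def)
      moreover have "F p = 0" using False by (simp add: F_def)
      ultimately show ?thesis by (simp add: B_def)
    next
      case True
      obtain x y where p: "p = (x, y)" "x \<in> S" "y \<in> T" using True by auto
      have xy: "x \<in> {0..1}" "y \<in> {0..1}" using p ST by auto
      have mult_indicator: "k * indicator A p = (if b then (if a then k else 0) else 0)"
        if "p \<in> A \<longleftrightarrow> a \<and> b" for k :: real and A a b
        using that by (cases "p \<in> A") auto
      have "E p = (\<Sum>u\<in>{1..n}. \<Sum>v\<in>{1..n}. if v = vertex_of n y then (if u = vertex_of n x then ?k u v else 0) else 0)"
        unfolding E_def
      proof (intro sum.cong refl)
        fix u v assume uv: "u \<in> {1..n}" "v \<in> {1..n}"
        have "p \<in> ?R u v \<longleftrightarrow> u = vertex_of n x \<and> v = vertex_of n y"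
          using in_vertex_interval_iff[OF n xy(1) uv(1)] in_vertex_interval_iff[OF n xy(2) uv(2)] p by simp
        then show "?k u v * indicator (?R u v) p = (if v = vertex_of n y then (if u = vertex_of n x then ?k u v else 0) else 0)"
          by (rule mult_indicator)
      qed
      also have "\<dots> = ?k (vertex_of n x) (vertex_of n y)"
        using vertex_of_range[OF n, of x] vertex_of_range[OF n, of y] by (simp only: sum.delta finite_atLeastAtMost if_True)
      finally have "F p - E p = of_bool (j x \<noteq> j y) / 2 - of_bool (col x \<noteq> col y) / 2"
        using True p(1) empirical_graphon_eq[OF n xy, of G] by (simp add: F_def U_def j_def)
      moreover have "B p = (of_bool (x \<in> L) + of_bool (y \<in> L)) / 2"
        using xy by (simp add: B_def p(1) indicator_def)
      ultimately show ?thesis using L(4) xy by (cases "x \<in> L"; cases "y \<in> L") auto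
    qed
    have "\<bar>integral\<^sup>L lebesgue F\<bar> \<le> (real q ^ 2 + 2) * \<epsilon> + real q * \<epsilon>"
    proof (cases "integrable lebesgue F")
      case True
      have "\<bar>integral\<^sup>L lebesgue (\<lambda>p. F p - E p)\<bar> \<le> integral\<^sup>L lebesgue B"
        using True E_int B_int FE by (intro integral_abs_bound_integral Bochner_Integration.integrable_diff)
      then have "\<bar>integral\<^sup>L lebesgue F - integral\<^sup>L lebesgue E\<bar> \<le> real q * \<epsilon>"
        using B_le True E_int by simp
      then show ?thesis using E_le by linarith
    next
      \<comment> \<open>If \<open>F\<close> is not integrable its integral is 0 by convention and
        the bound is trivial.\<close>
      case False
      then show ?thesis using \<epsilon> by (simp add: not_integrable_integral_eq)
    qed
    then show "\<bar>LINT p:S \<times> T|lebesgue. (case p of (x, y) \<Rightarrow> ?W (x, y) - U (x, y))\<bar> \<le> (real q ^ 2 + real q + 2) * \<epsilon>"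
      unfolding set_lebesgue_integral_def F_def by (simp add: algebra_simps)
  qed
  moreover have "cut_dist_family ?W (B_star q) \<le> cut_norm (\<lambda>(x, y). ?W (x, y) - U (x, y))"
    by (rule cut_dist_family_le[OF _ U]) (auto simp: empirical_graphon_def)
  ultimately show ?thesis by linarith
qed

lemma gibbs_cut_dist:
  assumes \<epsilon>: "\<epsilon> > 0" and q: "q \<ge> 2"
  shows "\<exists>c>0. \<forall>w>0. \<exists>N. \<forall>n\<ge>N.
    measure (gibbs_measure n (q + 1) w)
      {G \<in> graphs_on n. cut_dist_family (empirical_graphon n G) (B_star q) \<ge> \<epsilon>}
    \<le> exp (- c * (real n)\<^sup>2)"
proof -
  define D where "D = real q ^ 2 + real q + 2"
  \<comment> \<open>The factor 2 makes \<open>D * \<epsilon>'\<close> strictly less than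
    \<open>\<epsilon>\<close>, as needed because the event includes equality.\<close>
  define \<epsilon>' where "\<epsilon>' = min 1 (\<epsilon> / (2 * D))"
  have D: "D > 0" by (simp add: D_def add_nonneg_pos)
  have \<epsilon>': "0 < \<epsilon>'" "\<epsilon>' \<le> 1" using \<epsilon> D by (auto simp: \<epsilon>'_def)
  have "\<epsilon>' \<le> \<epsilon> / (2 * D)" by (simp add: \<epsilon>'_def)
  then have "D * \<epsilon>' \<le> \<epsilon> / 2" using D by (simp add: field_simps)
  then have D\<epsilon>: "D * \<epsilon>' < \<epsilon>" using \<epsilon> by linarith
  obtain c where c: "c > 0" and st: "\<And>w. w > 0 \<Longrightarrow> \<exists>N. \<forall>n\<ge>N.
    measure (gibbs_measure n (q + 1) w) (unstructured \<epsilon>' n q) \<le> exp (- c * real n ^ 2)"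
    using gibbs_unstructured[OF \<epsilon>' q] by blast
  show ?thesis
  proof (rule exI[of _ c], intro conjI c allI impI)
    fix w :: real assume "w > 0"
    then obtain N where N: "\<And>n. n \<ge> N \<Longrightarrow> measure (gibbs_measure n (q + 1) w)
      (unstructured \<epsilon>' n q) \<le> exp (- c * real n ^ 2)"
      using st by blast
    show "\<exists>N. \<forall>n\<ge>N. measure (gibbs_measure n (q + 1) w)
      {G \<in> graphs_on n. cut_dist_family (empirical_graphon n G) (B_star q) \<ge> \<epsilon>} \<le> exp (- c * (real n)\<^sup>2)"
    proof (intro exI[of _ "max N 1"] allI impI)
      fix n assume n: "n \<ge> max N 1"
      let ?M = "gibbs_measure n (q + 1) w"
      let ?B = "unstructured \<epsilon>' n q"
      interpret prob_space ?M by (rule prob_space_gibbs_measure)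
      have sets: "sets ?M = Pow (graphs_on n)" by (simp add: gibbs_measure_def sets_point_measure)
      have "{G \<in> graphs_on n. cut_dist_family (empirical_graphon n G) (B_star q) \<ge> \<epsilon>} \<subseteq> ?B"
      proof (rule subsetI)
        fix G assume "G \<in> {G \<in> graphs_on n. cut_dist_family (empirical_graphon n G) (B_star q) \<ge> \<epsilon>}"
        then have G: "G \<in> graphs_on n" "cut_dist_family (empirical_graphon n G) (B_star q) \<ge> \<epsilon>" by auto
        have "\<not> structured \<epsilon>' n q f G" for f
        proof
          assume "structured \<epsilon>' n q f G"
          then have "cut_dist_family (empirical_graphon n G) (B_star q) \<le> D * \<epsilon>'"
            unfolding D_def by (rule structured_cut_dist_le[OF _ G(1) \<epsilon>'(1)]) (use n q in auto)
          then show False using G(2) D\<epsilon> by linarith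
        qed
        then show "G \<in> ?B" using G(1) by simp
      qed
      then have "measure ?M {G \<in> graphs_on n. cut_dist_family (empirical_graphon n G) (B_star q) \<ge> \<epsilon>} \<le> measure ?M ?B"
        by (rule finite_measure_mono) (unfold sets, blast)
      also have "\<dots> \<le> exp (- c * (real n)\<^sup>2)" using N n by simp
      finally show "measure ?M {G \<in> graphs_on n. cut_dist_family (empirical_graphon n G) (B_star q) \<ge> \<epsilon>}
        \<le> exp (- c * (real n)\<^sup>2)" .
    qed
  qed
qed

theorem theorem2p7:
  fixes r q :: nat
  assumes "r \<ge> 3" and "q = r - 1"
  shows
    "(\<forall>w::real. w > 0 \<longrightarrow>
        (\<lambda>n. reduced_free_energy n r w) \<longlonglongrightarrow> ln 2 / 2 * (1 - 1 / real q)) \<and>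
     (\<forall>\<epsilon>::real. \<epsilon> > 0 \<longrightarrow> (\<exists>c::real. c > 0 \<and> (\<forall>w::real. w > 0 \<longrightarrow> (\<exists>N::nat. \<forall>n\<ge>N.
        measure (gibbs_measure n r w)
          {G \<in> graphs_on n. cut_dist_family (empirical_graphon n G) (B_star q) \<ge> \<epsilon>}
        \<le> exp (- c * (real n)\<^sup>2))))) \<and>
     (\<forall>\<epsilon>::real. \<epsilon> > 0 \<longrightarrow> (\<exists>c::real. c > 0 \<and> (\<forall>w::real. w > 0 \<longrightarrow> (\<exists>n\<^sub>0::nat. \<forall>n\<ge>n\<^sub>0.
        measure (gibbs_measure n r w)
          {G \<in> graphs_on n. \<exists>V :: nat \<Rightarrow> nat set.
             vertex_partition n q V \<and> (\<forall>i\<in>{1..q}. V i \<noteq> {}) \<and>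
             (\<forall>i\<in>{1..q}. \<bar>real (card (V i)) - real n / real q\<bar> \<le> \<epsilon> * real n) \<and>
             (\<forall>i\<in>{1..q}. \<forall>j\<in>{1..q}. i \<noteq> j \<longrightarrow>
                \<bar>real (edges_between G (V i) (V j)) / (real (card (V i)) * real (card (V j)))
                  - 1 / 2\<bar> \<le> \<epsilon>) \<and>
             real (\<Sum>i\<in>{1..q}. edges_within G (V i)) \<le> \<epsilon> * (real n)\<^sup>2 / (10 * real q) \<and>
             real (\<Sum>i\<in>{1..q}. edges_within G (V i)) /
               real (\<Sum>i\<in>{1..q}. card (V i) choose 2) \<le> \<epsilon> \<and>
             q_partite n q (delete_inner_edges q V G) \<and>
             edit_dist n G (delete_inner_edges q V G) \<le> \<epsilon> / (10 * real q) \<and>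
             \<epsilon> / (10 * real q) \<le> \<epsilon> / 2}
        \<ge> 1 - exp (- c * (real n)\<^sup>2)))))"
proof -
  have q: "q \<ge> 2" and r: "r = q + 1" using assms by auto
  show ?thesis
    unfolding r
    using reduced_free_energy_limit[OF _ q] gibbs_cut_dist[OF _ q] gibbs_partition[OF _ q]
    by (simp only: max_entropy_def) blast
qed

end
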